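(* Let $\mathcal{K}=\{A_1,A_2,A_3\}\subset\mathbb{R}^{3\times3}$ with $A_1=0$, $A_2=\operatorname{diag}(-\frac12,\frac23,3)$, $A_3=\mathrm{Id}_{3\times3}$, let $\Omega=[0,1]^3$ and $F\in\mathcal{K}^{qc}\setminus\mathcal{K}$. For $\chi\in BV(\Omega;\mathcal{K})$ let $\chi_{jj}$, $j=1,2,3$, denote the diagonal entries of $\chi$, and let $E^{per}_\epsilon(\chi;F)$ be the periodic singularly perturbed energy defined in the context. Then there exists $\epsilon_0>0$ such that for any $\nu\in(0,1)$ there is a constant $c_\nu>0$ such that for all $\epsilon\in(0,\epsilon_0)$ and all such $\chi$ $$\sum_{j=1}^3\|\chi_{jj}-\langle\chi_{jj}\rangle\|^2_{L^2([0,1]^3)}\ \le\ \exp\left(c_\nu|\log\epsilon|^{\frac12+\nu}\right)\,E^{per}_\epsilon(\chi;F)^{\frac12}.$$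
   Context: $\mathbb{T}^3$ denotes the torus obtained from $[0,1]^3$ by identifying opposite faces; functions on $[0,1]^3$ are viewed as functions on $\mathbb{T}^3$ by periodic extension. $\langle f\rangle=\int_{\mathbb{T}^3}f\,dx$ denotes the mean. $\mathcal{D}^{per}_F$ is the set of $\mathbb{T}^3$-periodic $L^2_{loc}$ maps $u:\mathbb{R}^3\to\mathbb{R}^{3\times3}$ with $\operatorname{div}u=0$ in $\mathbb{R}^3$ (row-wise, distributionally) and $\langle u\rangle=F$. Set $$E^{per}_{el}(\chi;F)=\inf_{u\in\mathcal{D}^{per}_F}\int_{\mathbb{T}^3}|u-\chi|^2dx,\qquad E^{per}_{surf}(\chi)=\int_{\mathbb{T}^3}|\nabla\chi|,\qquad E^{per}_\epsilon(\chi;F)=E^{per}_{el}(\chi;F)+\epsilon E^{per}_{surf}(\chi),$$ where the surface term is the total variation on the torus (thus including possible jumps across the identified faces). $\mathcal{K}^{qc}$ is the $\operatorname{div}$-quasiconvex hull of $\mathcal{K}$; for this $\mathcal{K}$ it is known to be the union of the closed triangle with vertices $S_1=\operatorname{diag}(0,\frac23,2)$, $S_2=\operatorname{diag}(\frac12,\frac23,1)$, $S_3=\operatorname{diag}(0,\frac13,1)$ and the three segments $[A_j,S_j]$, $j=1,2,3$. *)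

theory Defs
  imports "HOL-Analysis.Analysis"
begin

section \<open>Matrices and the three wells\<close>

text \<open>
  The type \<^typ>\<open>real^3^3\<close> carries the Frobenius norm; the first index of a matrix is its row.
\<close>

definition diag3 :: "real \<Rightarrow> real \<Rightarrow> real \<Rightarrow> real^3^3" where
  "diag3 a b c = vector [vector [a, 0, 0], vector [0, b, 0], vector [0, 0, c]]"

definition wells :: "(real^3^3) set" where
  "wells = {0, diag3 (- 1/2) (2/3) 3, mat 1}"

section \<open>Differentiable and periodic functions\<close>

definition partial :: "3 \<Rightarrow> (real^3 \<Rightarrow> 'b::real_normed_vector) \<Rightarrow> real^3 \<Rightarrow> 'b" where
  "partial k f x = frechet_derivative f (at x) (axis k 1)"

primrec C_k :: "nat \<Rightarrow> (real^3 \<Rightarrow> 'b::real_normed_vector) \<Rightarrow> bool" where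
  "C_k 0 f \<longleftrightarrow> continuous_on UNIV f"
| "C_k (Suc n) f \<longleftrightarrow> (\<forall>x. f differentiable (at x)) \<and> (\<forall>k. C_k n (partial k f))"

definition C_infinity :: "(real^3 \<Rightarrow> 'b::real_normed_vector) \<Rightarrow> bool" where
  "C_infinity f \<longleftrightarrow> (\<forall>n. C_k n f)"

definition compact_support_in :: "(real^3) set \<Rightarrow> (real^3 \<Rightarrow> 'b::real_normed_vector) \<Rightarrow> bool" where
  "compact_support_in U f \<longleftrightarrow>
     compact (closure {x. f x \<noteq> 0}) \<and> closure {x. f x \<noteq> 0} \<subseteq> U"

definition periodic :: "(real^3 \<Rightarrow> 'b) \<Rightarrow> bool" where
  "periodic f \<longleftrightarrow> (\<forall>k x. f (x + axis k 1) = f x)"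

definition ae_periodic :: "(real^3 \<Rightarrow> 'b) \<Rightarrow> bool" where
  "ae_periodic f \<longleftrightarrow> (\<forall>k. AE x in lebesgue. f (x + axis k 1) = f x)"

abbreviation unit_cube :: "(real^3) set" where
  "unit_cube \<equiv> cbox 0 1"

text \<open>
  The torus has volume one, so the mean over it is the integral over the fundamental cell;
  the identified faces form a null set.
\<close>

definition mean :: "(real^3 \<Rightarrow> 'b::{banach, second_countable_topology}) \<Rightarrow> 'b" where
  "mean f = set_lebesgue_integral lebesgue unit_cube f"

section \<open>Functions of bounded variation\<close>

text \<open>
  The pairing of a matrix field with the divergence of a field of third-order tensors. Both total
  variations below are with respect to the Euclidean norm on the tensors.
\<close>

definition pairing :: "(real^3^3) \<Rightarrow> (real^3 \<Rightarrow> real^3^3^3) \<Rightarrow> real^3 \<Rightarrow> real" where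
  "pairing A \<phi> x = (\<Sum>i\<in>UNIV. \<Sum>j\<in>UNIV. \<Sum>k\<in>UNIV. A $ i $ j * partial k \<phi> x $ i $ j $ k)"

definition total_variation :: "(real^3) set \<Rightarrow> (real^3 \<Rightarrow> real^3^3) \<Rightarrow> ennreal" where
  "total_variation U chi =
     (SUP \<phi>\<in>{\<phi>. C_k 1 \<phi> \<and> compact_support_in U \<phi> \<and> (\<forall>x. norm (\<phi> x) \<le> 1)}.
        ennreal (set_lebesgue_integral lebesgue U (\<lambda>x. pairing (chi x) \<phi> x)))"

text \<open>
  Here the test fields are functions on the torus, and so need not vanish on the boundary of the
  cell: jumps of the periodic extension of \<open>chi\<close> across identified faces are counted.
  Only the values of \<open>chi\<close> on the cell enter.
\<close>

definition torus_variation :: "(real^3 \<Rightarrow> real^3^3) \<Rightarrow> ennreal" where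
  "torus_variation chi =
     (SUP \<phi>\<in>{\<phi>. C_k 1 \<phi> \<and> periodic \<phi> \<and> (\<forall>x. norm (\<phi> x) \<le> 1)}.
        ennreal (set_lebesgue_integral lebesgue unit_cube (\<lambda>x. pairing (chi x) \<phi> x)))"

definition BV :: "(real^3) set \<Rightarrow> (real^3^3) set \<Rightarrow> (real^3 \<Rightarrow> real^3^3) set" where
  "BV U K = {chi. set_integrable lebesgue U chi \<and> (AE x in lebesgue. x \<in> U \<longrightarrow> chi x \<in> K)
               \<and> total_variation U chi < \<infinity>}"

section \<open>Divergence-free fields and the periodic energy\<close>

definition weakly_div_free :: "(real^3 \<Rightarrow> real^3^3) \<Rightarrow> bool" where
  "weakly_div_free u \<longleftrightarrow>
     (\<forall>\<phi>::real^3 \<Rightarrow> real. C_infinity \<phi> \<and> compact_support_in UNIV \<phi> \<longrightarrow>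
        (\<forall>i. (\<integral>x. (\<Sum>j\<in>UNIV. u x $ i $ j * partial j \<phi> x) \<partial>lebesgue) = 0))"

definition L2_loc :: "(real^3 \<Rightarrow> 'b::real_normed_vector) \<Rightarrow> bool" where
  "L2_loc u \<longleftrightarrow> u \<in> borel_measurable lebesgue
     \<and> (\<forall>C. compact C \<longrightarrow> set_integrable lebesgue C (\<lambda>x. (norm (u x))\<^sup>2))"

definition D_per :: "real^3^3 \<Rightarrow> (real^3 \<Rightarrow> real^3^3) set" where
  "D_per F = {u. ae_periodic u \<and> L2_loc u \<and> weakly_div_free u \<and> mean u = F}"

definition E_el :: "(real^3 \<Rightarrow> real^3^3) \<Rightarrow> real^3^3 \<Rightarrow> ennreal" where
  "E_el chi F = (INF u\<in>D_per F. \<integral>\<^sup>+x\<in>unit_cube. ennreal ((norm (u x - chi x))\<^sup>2) \<partial>lebesgue)"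

definition E_per :: "real \<Rightarrow> (real^3 \<Rightarrow> real^3^3) \<Rightarrow> real^3^3 \<Rightarrow> ennreal" where
  "E_per \<epsilon> chi F = E_el chi F + ennreal \<epsilon> * torus_variation chi"

section \<open>The div-quasiconvex hull\<close>

definition div_quasiconvex :: "(real^3^3 \<Rightarrow> real) \<Rightarrow> bool" where
  "div_quasiconvex f \<longleftrightarrow>
     (\<forall>A w. C_infinity w \<and> periodic w \<and> mean w = 0
              \<and> (\<forall>x i. (\<Sum>j\<in>UNIV. partial j w x $ i $ j) = 0)
        \<longrightarrow> f A \<le> mean (\<lambda>x. f (A + w x)))"

text \<open>
  Real-valued, locally bounded Borel div-quasiconvex functions are continuous: they are convex in
  singular directions, and singular matrices span. So restricting to continuous \<open>f\<close> is harmless.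
\<close>

definition quasiconvex_hull :: "(real^3^3) set \<Rightarrow> (real^3^3) set" where
  "quasiconvex_hull K =
     {A. \<forall>f. continuous_on UNIV f \<and> div_quasiconvex f \<longrightarrow> ereal (f A) \<le> (SUP B\<in>K. ereal (f B))}"

section \<open>Norms and roots in the extended nonnegative reals\<close>

definition L2_norm_sq :: "(real^3 \<Rightarrow> real) \<Rightarrow> ennreal" where
  "L2_norm_sq g = (\<integral>\<^sup>+x\<in>unit_cube. ennreal ((g x)\<^sup>2) \<partial>lebesgue)"

definition ennreal_sqrt :: "ennreal \<Rightarrow> ennreal" where
  "ennreal_sqrt a = (if a = \<infinity> then \<infinity> else ennreal (sqrt (enn2real a)))"

end

theory Submission
  imports Defs
begin

text \<open>
  If \<open>u\<close> is an admissible competitor and \<open>g = chi - u\<close>, then row-wise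
  \<open>\<partial>\<^sub>j chi\<^sub>j\<^sub>j = div g\<^sub>j\<close>, because \<open>chi\<close> is diagonal and
  \<open>u\<close> is divergence free. Mollifying \<open>chi\<^sub>j\<^sub>j\<close> at scale \<open>r\<close> therefore bounds its
  \<open>L\<^sup>1\<close>-translation difference over distances \<open>t \<ge> r\<close> in direction \<open>j\<close> by a multiple of
  \<open>(t/r) \<parallel>g\<parallel>\<close> plus the translation differences over distances at most \<open>r\<close> in all
  directions. Since any two wells differ in each of the three diagonal entries, the translation
  differences of the three entries are comparable, so the estimate closes: the modulus of continuity
  at scale \<open>t\<close> is controlled by that at scale \<open>r\<close> up to a fixed factor. Starting at scale
  \<open>\<epsilon>\<close>, where the total variation gives the bound \<open>\<epsilon> E\<^sub>s\<^sub>u\<^sub>r\<^sub>f\<close>, and enlarging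
  the scale by the factor \<open>exp (sqrt \<bar>ln \<epsilon>\<bar>)\<close>, about \<open>sqrt \<bar>ln \<epsilon>\<bar>\<close> steps
  lead to scale one with a total loss \<open>exp (C sqrt \<bar>ln \<epsilon>\<bar>)\<close>.
\<close>

section \<open>Smooth test functions\<close>

text \<open>Row j of the divergence equation controls the derivative of the j-th diagonal entry in
  direction j only. The missing directions of one entry are read off from the other two entries,
  because two different wells differ in all three entries by amounts comparable up to the factor 6.
  This comparison is pointwise and survives integration of absolute values, which is why the moduli
  of continuity are taken in L1 and are carried for all entries and directions at once.

  The choice of scales balances two losses. Passing from \<epsilon> to 1 in n steps of ratio M costs
  a factor 37^n from the steps, but the factor M only once: the elastic error of a step depends on
  the ratio of its two scales and not on the scales themselves. Under M^n = 1/\<epsilon> the sum n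
  log 37 + log M is smallest, up to constants, when n and log M are both of order sqrt |log
  \<epsilon>|, whence the exponent 1/2.

  The power 1/2 of the energy has another origin. The elastic energy enters through the L1 norm of
  chi - u, which is at most the square root of that energy, whereas the variance of a bounded
  function is at most a multiple of its L1 oscillation.\<close>

primrec Ck_real :: "nat \<Rightarrow> (real \<Rightarrow> real) \<Rightarrow> bool" where
  "Ck_real 0 f \<longleftrightarrow> continuous_on UNIV f"
| "Ck_real (Suc n) f \<longleftrightarrow> (\<exists>f'. (\<forall>x. (f has_real_derivative f' x) (at x)) \<and> Ck_real n f')"

lemma Ck_real_SucI:
  "(\<And>x. (f has_real_derivative f' x) (at x)) \<Longrightarrow> Ck_real n f' \<Longrightarrow> Ck_real (Suc n) f"
  by auto

lemma Ck_real_Suc_imp: "Ck_real (Suc n) f \<Longrightarrow> Ck_real n f"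
proof (induction n arbitrary: f)
  case 0
  then show ?case using DERIV_isCont by (fastforce intro!: continuous_at_imp_continuous_on)
next
  case (Suc n)
  then show ?case by (metis Ck_real.simps(2))
qed

lemma Ck_real_imp_continuous: "Ck_real n f \<Longrightarrow> continuous_on UNIV f"
  by (induction n) (use Ck_real_Suc_imp in auto)

lemma Ck_real_add: "Ck_real n f \<Longrightarrow> Ck_real n g \<Longrightarrow> Ck_real n (\<lambda>x. f x + g x)"
proof (induction n arbitrary: f g)
  case 0
  then show ?case by (auto intro!: continuous_intros)
next
  case (Suc n)
  then obtain f' g' where d: "\<And>x. (f has_real_derivative f' x) (at x)" "Ck_real n f'"
    "\<And>x. (g has_real_derivative g' x) (at x)" "Ck_real n g'" by auto
  have "((\<lambda>x. f x + g x) has_real_derivative f' x + g' x) (at x)" for x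
    by (intro DERIV_add d)
  then show ?case using Suc.IH[OF d(2) d(4)] by (rule Ck_real_SucI)
qed

lemma Ck_real_mult: "Ck_real n f \<Longrightarrow> Ck_real n g \<Longrightarrow> Ck_real n (\<lambda>x. f x * g x)"
proof (induction n arbitrary: f g)
  case 0
  then show ?case by (auto intro!: continuous_intros)
next
  case (Suc n)
  note c = Ck_real_Suc_imp[OF Suc.prems(1)] Ck_real_Suc_imp[OF Suc.prems(2)]
  obtain f' g' where d: "\<And>x. (f has_real_derivative f' x) (at x)" "Ck_real n f'"
    "\<And>x. (g has_real_derivative g' x) (at x)" "Ck_real n g'" using Suc.prems by auto
  have "((\<lambda>x. f x * g x) has_real_derivative f' x * g x + g' x * f x) (at x)" for x
    by (intro DERIV_mult d)
  moreover have "Ck_real n (\<lambda>x. f' x * g x + g' x * f x)"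
    by (intro Ck_real_add Suc.IH d c)
  ultimately show ?case by (rule Ck_real_SucI)
qed

lemma Ck_real_const: "Ck_real n (\<lambda>x. c)"
proof (induction n arbitrary: c)
  case (Suc n)
  have "((\<lambda>x. c) has_real_derivative 0) (at x)" for x by simp
  then show ?case using Suc[of 0] by (rule Ck_real_SucI)
qed auto

lemma Ck_real_affine: "Ck_real n f \<Longrightarrow> Ck_real n (\<lambda>x. f (a * x + b))"
proof (induction n arbitrary: f)
  case 0
  then show ?case 
    by (auto intro!: continuous_intros continuous_on_compose2[of UNIV f UNIV "\<lambda>x. a * x + b"])
next
  case (Suc n)
  then obtain f' where d: "\<And>x. (f has_real_derivative f' x) (at x)" "Ck_real n f'" by auto
  have "((\<lambda>x. f (a * x + b)) has_real_derivative f' (a * x + b) * a) (at x)" for x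
    by (rule DERIV_chain2[OF d(1)]) (auto intro!: derivative_eq_intros)
  moreover have "Ck_real n (\<lambda>x. f' (a * x + b) * a)"
    by (rule Ck_real_mult[OF Suc.IH[OF d(2)] Ck_real_const[of n a]])
  ultimately show ?case by (rule Ck_real_SucI)
qed

lemma Ck_real_antiderivative:
  assumes "\<And>n. Ck_real n f" "\<And>x. (F has_real_derivative f x) (at x)"
  shows "Ck_real n F"
  using assms(2,1) by (rule Ck_real_Suc_imp[OF Ck_real_SucI])

section \<open>A smooth bump on the line\<close>

lemma poly_div_exp_tendsto_0: "((\<lambda>x::real. poly p x / exp x) \<longlongrightarrow> 0) at_top"
proof -
  have "((\<lambda>x::real. \<Sum>i\<le>degree p. coeff p i * (x ^ i / exp x)) \<longlongrightarrow> (\<Sum>i\<le>degree p. coeff p i * 0)) at_top"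
    by (intro tendsto_sum tendsto_mult tendsto_const tendsto_power_div_exp_0)
  then show ?thesis by (simp add: poly_altdef sum_divide_distrib)
qed

text \<open>The functions p(1/s) exp(-1/s), extended by zero to s \<le> 0, are closed under
  differentiation: the chain rule replaces the polynomial p by X^2 (p - p'). Smoothness of every
  order then follows by an induction that is uniform in p.\<close>

lemma flat_has_real_derivative:
  fixes p :: "real poly"
  defines "f \<equiv> \<lambda>p s. if s > 0 then poly p (1/s) * exp (- (1/s)) else (0::real)"
  shows "(f p has_real_derivative f ([:0,0,1:] * (p - pderiv p)) s) (at s)"
proof -
  consider "s < 0" | "s = 0" | "s > 0" by linarith
  then show ?thesis
  proof cases
    case 1
    have "((\<lambda>s. 0) has_real_derivative 0) (at s)" by simp
    then have "(f p has_real_derivative 0) (at s)"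
      by (rule has_field_derivative_transform_within_open[where S="{..<0}"]) (use 1 in \<open>auto simp: f_def\<close>)
    then show ?thesis using 1 by (simp add: f_def)
  next
    case 3
    have i: "((\<lambda>s. 1/s) has_real_derivative - (1/s^2)) (at s)"
      using 3 by (auto intro!: derivative_eq_intros simp: power2_eq_square)
    have "((\<lambda>s. poly p (1/s) * exp (- (1/s))) has_real_derivative 
        (poly (pderiv p) (1/s) * (- (1/s^2))) * exp (-(1/s)) + (exp (-(1/s)) * (- (- (1/s^2)))) * poly p (1/s)) (at s)"
      by (intro DERIV_mult DERIV_chain2[OF poly_DERIV i] DERIV_chain2[OF DERIV_exp] DERIV_minus i)
    also have "(poly (pderiv p) (1/s) * (- (1/s^2))) * exp (-(1/s)) + (exp (-(1/s)) * (- (- (1/s^2)))) * poly p (1/s)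
       = f ([:0,0,1:] * (p - pderiv p)) s"
      using 3 by (simp add: f_def power2_eq_square algebra_simps)
    finally show ?thesis
      by (rule has_field_derivative_transform_within_open[where S="{0<..}"]) (use 3 in \<open>auto simp: f_def\<close>)
  next
    case 2
    \<comment> \<open>At the origin the difference quotient is examined in the variable y = 1/h,
      where \<open>f p h / h\<close> becomes y p(y) / exp y.\<close>
    have "((\<lambda>y. poly ([:0,1:] * p) y / exp y) \<longlongrightarrow> 0) at_top" by (rule poly_div_exp_tendsto_0)
    then have "((\<lambda>h. poly ([:0,1:] * p) (inverse h) / exp (inverse h)) \<longlongrightarrow> 0) (at_right 0)"
      by (rule filterlim_compose) (rule filterlim_inverse_at_top_right)
    moreover have "\<forall>\<^sub>F h in at_right 0. poly ([:0,1:] * p) (inverse h) / exp (inverse h) = f p h / h"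
      unfolding eventually_at_filter f_def
      by (rule always_eventually) (simp add: exp_minus divide_simps)
    ultimately have r: "((\<lambda>h. f p h / h) \<longlongrightarrow> 0) (at_right 0)"
      by (rule Lim_transform_eventually)
    have "\<forall>\<^sub>F h in at_left 0. 0 = f p h / h"
      unfolding eventually_at_filter f_def by (rule always_eventually) simp
    then have l: "((\<lambda>h. f p h / h) \<longlongrightarrow> 0) (at_left 0)"
      by (rule Lim_transform_eventually[OF tendsto_const])
    have "((\<lambda>h. f p h / h) \<longlongrightarrow> 0) (at 0)"
      using l r by (simp add: filterlim_split_at)
    then show ?thesis using 2 by (simp add: DERIV_def f_def cong: if_cong)
  qed
qed

lemma Ck_real_flat:
  fixes p :: "real poly"
  shows "Ck_real n (\<lambda>s. if s > 0 then poly p (1/s) * exp (- (1/s)) else 0)"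
proof (induction n arbitrary: p)
  case 0
  then show ?case
    using DERIV_isCont[OF flat_has_real_derivative[of p]] by (simp add: continuous_at_imp_continuous_on)
next
  case (Suc n)
  show ?case using flat_has_real_derivative[of p] Suc[of "[:0,0,1:] * (p - pderiv p)"]
    by (rule Ck_real_SucI)
qed


text \<open>The product of e(s) and e(1 - s) with e(s) = exp(-1/s) works. On the middle half of the
  interval each factor is at least exp(-4). The lower bound exp(-8) stands in for a normalisation:
  it bounds the mass of the rescaled kernels from below.\<close>

lemma smooth_bump_exists:
  "\<exists>b. (\<forall>n. Ck_real n b) \<and> (\<forall>s. 0 \<le> b s \<and> b s \<le> 1) \<and> (\<forall>s. s \<notin> {0<..<1} \<longrightarrow> b s = 0)
     \<and> (\<forall>s\<in>{1/4..3/4}. exp (-8) \<le> b s)"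
proof -
  define e where "e s = (if s > 0 then poly 1 (1/s) * exp (- (1/s)) else 0)" for s :: real
  define b where "b s = e s * e ((-1) * s + 1)" for s
  have "Ck_real n b" for n
    unfolding b_def by (intro Ck_real_mult Ck_real_affine) (simp_all only: e_def Ck_real_flat)
  moreover have e01: "0 \<le> e s" "e s \<le> 1" for s by (simp_all add: e_def)
  moreover have "b s = 0" if "s \<notin> {0<..<1}" for s using that by (auto simp: b_def e_def)
  moreover have "exp (-8) \<le> b s" if "s \<in> {1/4..3/4}" for s
  proof -
    have e4: "exp (-4) \<le> e s" if "s \<ge> 1/4" for s
      using that by (simp add: e_def divide_simps)
    have "exp (-8) = exp (-4) * (exp (-4) :: real)" by (simp flip: exp_add)
    also have "\<dots> \<le> b s" unfolding b_def
      by (rule mult_mono) (use that e4[of s] e4[of "(-1) * s + 1"] e01 in auto)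
    finally show ?thesis .
  qed
  moreover have "0 \<le> b s" "b s \<le> 1" for s
    unfolding b_def using e01 by (auto intro: mult_le_one)
  ultimately show ?thesis by blast
qed

section \<open>Products of functions of one coordinate\<close>

definition tensor :: "(3 \<Rightarrow> real \<Rightarrow> real) \<Rightarrow> real^3 \<Rightarrow> real" where
  "tensor \<psi> x = (\<Prod>k\<in>UNIV. \<psi> k (x $ k))"

text \<open>A partial derivative changes only the factor of its own coordinate. Smoothness, supports
  and integral bounds in space thus reduce to the line, and a kernel can be integrated in one
  coordinate while the others are left alone.\<close>

lemma tensor_has_derivative:
  assumes "\<And>k s. (\<psi> k has_real_derivative \<psi>' k s) (at s)"
  shows "(tensor \<psi> has_derivative (\<lambda>v. \<Sum>k\<in>UNIV. tensor (\<psi>(k := \<psi>' k)) x * v $ k)) (at x)"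
proof -
  have 1: "((\<lambda>x. \<psi> k (x $ k)) has_derivative (\<lambda>v. \<psi>' k (x $ k) * v $ k)) (at x)" for k
    using has_derivative_compose[of "\<lambda>x. x $ k" "\<lambda>v. v $ k" x UNIV "\<psi> k" "\<lambda>v. \<psi>' k (x $ k) * v"] assms
    by (auto simp: has_field_derivative_def intro!: bounded_linear_imp_has_derivative bounded_linear_vec_nth)
  have "(tensor \<psi> has_derivative (\<lambda>v. \<Sum>k\<in>UNIV. (\<psi>' k (x $ k) * v $ k) * (\<Prod>j\<in>UNIV-{k}. \<psi> j (x $ j)))) (at x)"
    unfolding tensor_def[abs_def] by (rule has_derivative_prod) (rule 1)
  moreover have "tensor (\<psi>(k := \<psi>' k)) x = \<psi>' k (x $ k) * (\<Prod>j\<in>UNIV-{k}. \<psi> j (x $ j))" for k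
    unfolding tensor_def by (subst prod.remove[of _ k]) (auto intro!: prod.cong)
  ultimately show ?thesis by (simp add: mult_ac)
qed

lemma partial_tensor:
  assumes "\<And>k s. (\<psi> k has_real_derivative \<psi>' k s) (at s)"
  shows "partial k (tensor \<psi>) = tensor (\<psi>(k := \<psi>' k))"
proof
  fix x
  show "partial k (tensor \<psi>) x = tensor (\<psi>(k := \<psi>' k)) x"
    unfolding partial_def frechet_derivative_at[OF tensor_has_derivative[OF assms], symmetric]
    by (simp add: axis_def if_distrib cong: if_cong)
qed

lemma continuous_tensor:
  assumes "\<And>k. continuous_on UNIV (\<psi> k)"
  shows "continuous_on UNIV (tensor \<psi>)"
proof -
  have "continuous_on UNIV (\<lambda>x::real^3. \<psi> k (x $ k))" for k
    by (rule continuous_on_compose2[OF assms]) (auto intro!: continuous_intros)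
  then show ?thesis unfolding tensor_def[abs_def] by (intro continuous_on_prod) auto
qed

lemma C_k_tensor: "(\<And>k. Ck_real n (\<psi> k)) \<Longrightarrow> C_k n (tensor \<psi>)"
proof (induction n arbitrary: \<psi>)
  case 0
  then show ?case by (simp add: continuous_tensor)
next
  case (Suc n)
  then have "\<forall>k. \<exists>f'. (\<forall>x. (\<psi> k has_real_derivative f' x) (at x)) \<and> Ck_real n f'" by simp
  then obtain \<psi>' where d: "\<And>k s. (\<psi> k has_real_derivative \<psi>' k s) (at s)" "\<And>k. Ck_real n (\<psi>' k)"
    by metis
  have "C_k n (partial k (tensor \<psi>))" for k
    unfolding partial_tensor[OF d(1)] by (rule Suc.IH) (use d(2) Suc.prems Ck_real_Suc_imp in auto)
  moreover have "tensor \<psi> differentiable (at x)" for x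
    using tensor_has_derivative[of \<psi> \<psi>' x, OF d(1)] by (auto simp: differentiable_def)
  ultimately show ?case by simp
qed

text \<open>\<open>P\<close> is a difference of two translates of an antiderivative B of \<beta>.
  Beyond r the function B is constant but in general not zero, and the difference restores compact
  support. The bound r is the total increase of B, since \<beta> is at most 1 on an interval of
  length r and zero elsewhere.\<close>

lemma Ck_real_sliding_window:
  fixes \<beta> :: "real \<Rightarrow> real"
  assumes \<beta>: "\<And>n. Ck_real n \<beta>" "\<And>s. 0 \<le> \<beta> s" "\<And>s. \<beta> s \<le> 1" "\<And>s. s \<notin> {0<..<r} \<Longrightarrow> \<beta> s = 0"
    and "0 < r" "0 \<le> t"
  obtains P where "\<And>n. Ck_real n P" "\<And>s. (P has_real_derivative \<beta> s - \<beta> (s - t)) (at s)"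
    "\<And>s. s \<notin> {0..r + t} \<Longrightarrow> P s = 0" "\<And>s. \<bar>P s\<bar> \<le> r"
proof -
  have "isCont \<beta> x" for x
    using Ck_real_imp_continuous[OF \<beta>(1)] by (simp add: continuous_on_eq_continuous_at)
  then obtain B where B: "\<And>x. (B has_real_derivative \<beta> x) (at x)"
    using einterval_antiderivative[of "-\<infinity>" "\<infinity>" \<beta>]
    by (auto simp: has_real_derivative_iff_has_vector_derivative)
  have mono: "B x \<le> B y" if "x \<le> y" for x y
    by (rule DERIV_nonneg_imp_nondecreasing[OF that]) (use B \<beta>(2) in blast)
  have lip: "B y - B x \<le> y - x" if "x \<le> y" for x y
  proof -
    have "(\<lambda>x. x - B x) x \<le> (\<lambda>x. x - B x) y"
    proof (rule DERIV_nonneg_imp_nondecreasing[OF that])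
      fix z show "\<exists>d. ((\<lambda>x. x - B x) has_real_derivative d) (at z) \<and> 0 \<le> d"
        by (rule exI[of _ "1 - \<beta> z"]) (auto intro!: derivative_eq_intros B \<beta>)
    qed
    then show ?thesis by simp
  qed
  have left: "B x = B 0" if "x \<le> 0" for x
  proof (rule antisym)
    show "B 0 \<le> B x"
      by (rule DERIV_nonpos_imp_nonincreasing[OF that]) (metis B \<beta>(4) greaterThanLessThan_iff not_less order_refl)
  qed (use mono that in auto)
  have right: "B x = B r" if "r \<le> x" for x
  proof (rule antisym)
    show "B x \<le> B r"
      by (rule DERIV_nonpos_imp_nonincreasing[OF that]) (metis B \<beta>(4) greaterThanLessThan_iff not_less order_refl)
  qed (use mono that in auto)
  have range: "B 0 \<le> B x" "B x \<le> B r" for x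
    using mono[of 0 x] left[of x] mono[of x r] right[of x] by linarith+
  define P where "P s = B s - B (s - t)" for s
  have d: "(P has_real_derivative \<beta> s - \<beta> (s - t)) (at s)" for s
  proof -
    have "((\<lambda>s. B (s - t)) has_real_derivative \<beta> (s - t) * 1) (at s)"
      by (rule DERIV_chain2[OF B]) (auto intro!: derivative_eq_intros)
    then show ?thesis unfolding P_def by (auto intro: DERIV_diff B)
  qed
  have "Ck_real n (\<lambda>s. \<beta> s + (-1) * \<beta> (1 * s + (- t)))" for n
    by (intro Ck_real_add Ck_real_mult Ck_real_const \<beta>(1) Ck_real_affine)
  then have "Ck_real n P" for n
    by (intro Ck_real_antiderivative[OF _ d]) simp
  moreover have "P s = 0" if "s \<notin> {0..r+t}" for s
    using that left[of s] left[of "s-t"] right[of s] right[of "s-t"] \<open>0 < r\<close> \<open>0 \<le> t\<close>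
    by (auto simp: P_def)
  moreover have "\<bar>P s\<bar> \<le> r" for s
    using range[of s] range[of "s-t"] lip[of 0 r] \<open>0 < r\<close> by (simp add: P_def)
  ultimately show ?thesis using d that by blast
qed

lemma tensor_fun_upd: "tensor (\<psi>(j := f)) x = f (x $ j) * (\<Prod>k\<in>UNIV-{j}. \<psi> k (x $ k))"
  unfolding tensor_def by (subst prod.remove[of _ j]) (auto intro!: prod.cong)

lemma tensor_zero_outside:
  assumes "\<And>k s. s \<notin> {l k..u k} \<Longrightarrow> \<psi> k s = 0" "tensor \<psi> x \<noteq> 0"
  shows "x \<in> cbox (\<chi> k. l k) (\<chi> k. u k)"
proof -
  have "x $ k \<in> {l k..u k}" for k
    using assms unfolding tensor_def by (metis UNIV_I finite prod_zero)
  then show ?thesis by (simp add: mem_box_cart)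
qed

lemma compact_support_tensor:
  assumes "\<And>k s. s \<notin> {l k..u k} \<Longrightarrow> \<psi> k s = 0"
  shows "compact_support_in UNIV (tensor \<psi>)"
proof -
  have "{x. tensor \<psi> x \<noteq> 0} \<subseteq> cbox (\<chi> k. l k) (\<chi> k. u k)"
    using tensor_zero_outside[of l u \<psi>, OF assms] by blast
  then have "bounded {x. tensor \<psi> x \<noteq> 0}" by (rule bounded_subset[OF bounded_cbox])
  then show ?thesis unfolding compact_support_in_def by (simp add: compact_closure)
qed

lemma nn_integral_tensor_le:
  assumes bound: "\<And>k s. \<bar>\<psi> k s\<bar> \<le> c k" and supp: "\<And>k s. s \<notin> {l k..u k} \<Longrightarrow> \<psi> k s = 0"
    and lu: "\<And>k. l k \<le> u k"
  shows "(\<integral>\<^sup>+x. ennreal \<bar>tensor \<psi> x\<bar> \<partial>lborel) \<le> ennreal ((\<Prod>k\<in>UNIV. c k) * (\<Prod>k\<in>UNIV. u k - l k))"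
proof -
  let ?Q = "cbox (\<chi> k. l k) (\<chi> k. u k)"
  have c0: "0 \<le> c k" for k using bound[of k 0] by linarith
  have ab: "\<bar>tensor \<psi> x\<bar> \<le> (\<Prod>k\<in>UNIV. c k)" for x
    unfolding tensor_def abs_prod by (intro prod_mono) (auto intro: bound)
  have "(\<integral>\<^sup>+x. ennreal \<bar>tensor \<psi> x\<bar> \<partial>lborel) \<le> (\<integral>\<^sup>+x. ennreal (\<Prod>k\<in>UNIV. c k) * indicator ?Q x \<partial>lborel)"
  proof (rule nn_integral_mono)
    fix x :: "real^3"
    show "ennreal \<bar>tensor \<psi> x\<bar> \<le> ennreal (\<Prod>k\<in>UNIV. c k) * indicator ?Q x"
      using ab[of x] tensor_zero_outside[of l u \<psi> x, OF supp]
      by (cases "tensor \<psi> x = 0") (auto intro: ennreal_leI)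
  qed
  also have "\<dots> = ennreal (\<Prod>k\<in>UNIV. c k) * emeasure lborel ?Q"
    by (simp add: nn_integral_cmult_indicator)
  also have "emeasure lborel ?Q = ennreal (measure lborel ?Q)"
    by (rule emeasure_eq_ennreal_measure) (use emeasure_lborel_cbox_finite[of "\<chi> k. l k" "\<chi> k. u k"] in auto)
  also have "measure lborel ?Q = (\<Prod>k\<in>UNIV. u k - l k)"
    using content_cbox_cart[of "\<chi> k. l k" "\<chi> k. u k"] lu by (auto simp: interval_ne_empty_cart)
  finally show ?thesis
    by (simp add: ennreal_mult c0 lu prod_nonneg)
qed

lemma Ck_real_bump_deriv:
  assumes \<beta>: "\<And>n. Ck_real n \<beta>" "\<And>s. s \<notin> {0<..<r} \<Longrightarrow> \<beta> s = 0"
  obtains \<beta>' C where "\<And>s. (\<beta> has_real_derivative \<beta>' s) (at s)" "\<And>s. s \<notin> {0..r} \<Longrightarrow> \<beta>' s = 0"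
    "\<And>s. \<bar>\<beta>' s\<bar> \<le> C" "0 < C"
proof -
  obtain \<beta>' where d: "\<And>s. (\<beta> has_real_derivative \<beta>' s) (at s)" and c: "Ck_real 0 \<beta>'"
    using \<beta>(1)[of "Suc 0"] by auto
  have z: "\<beta>' s = 0" if "s \<notin> {0..r}" for s
  proof -
    have "((\<lambda>s. 0) has_real_derivative 0) (at s)" by simp
    then have "(\<beta> has_real_derivative 0) (at s)"
      by (rule has_field_derivative_transform_within_open[where S="-{0..r}"]) (use \<beta>(2) that in auto)
    then show ?thesis using d DERIV_unique by blast
  qed
  have "bounded (\<beta>' ` {0..r})"
    by (intro compact_imp_bounded compact_continuous_image) (use c continuous_on_subset in auto)
  then obtain C where "C > 0" "\<And>s. s \<in> {0..r} \<Longrightarrow> \<bar>\<beta>' s\<bar> \<le> C"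
    by (auto simp: bounded_pos)
  then show ?thesis using d z that[of \<beta>' C] by (metis abs_zero less_imp_le)
qed

text \<open>
  The function \<open>\<Phi>\<close> is a smooth test function whose \<open>j\<close>-th partial derivative is a difference of
  two translates of the kernel \<open>\<kappa>\<close>: in the \<open>j\<close>-th variable the bump is replaced by its integral over a
  sliding window of length \<open>t\<close>. Nothing is normalised: \<open>\<integral>\<kappa>\<close> is of order \<open>r\<^sup>3\<close>.
\<close>

lemma mollifier_exists:
  obtains c C :: real where "0 < c" "0 < C"
    "\<And>(r::real) t j. 0 < r \<Longrightarrow> r \<le> t \<Longrightarrow> \<exists>\<kappa> \<Phi>. continuous_on UNIV \<kappa> \<and> (\<forall>z. 0 \<le> \<kappa> z \<and> \<kappa> z \<le> 1)
      \<and> (\<forall>z. \<kappa> z \<noteq> 0 \<longrightarrow> (\<forall>k. 0 \<le> z $ k \<and> z $ k \<le> r))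
      \<and> ennreal (c * r ^ 3) \<le> (\<integral>\<^sup>+z. ennreal (\<kappa> z) \<partial>lborel)
      \<and> C_infinity \<Phi> \<and> compact_support_in UNIV \<Phi>
      \<and> (\<forall>y. partial j \<Phi> y = \<kappa> y - \<kappa> (y - axis j t))
      \<and> (\<forall>k. (\<integral>\<^sup>+z. ennreal \<bar>partial k \<Phi> z\<bar> \<partial>lborel) \<le> ennreal (C * r\<^sup>2 * t))"
proof -
  obtain b where b: "\<And>n. Ck_real n b" "\<And>s. 0 \<le> b s" "\<And>s. b s \<le> 1"
    "\<And>s. s \<notin> {0<..<1} \<Longrightarrow> b s = 0" "\<And>s. s \<in> {1/4..3/4} \<Longrightarrow> exp (-8) \<le> b s"
    using smooth_bump_exists by blast
  obtain b' C where b': "\<And>s. (b has_real_derivative b' s) (at s)" "\<And>s. s \<notin> {0..1} \<Longrightarrow> b' s = 0"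
    "\<And>s. \<bar>b' s\<bar> \<le> C" "0 < C"
    using Ck_real_bump_deriv[OF b(1,4)] by blast
  \<comment> \<open>\<open>exp (-8) ^ 3\<close> bounds the product of three bumps from below on a
    concentric cube of side r/2, and \<open>(1/2)^3\<close> comes from the volume of that
    cube.\<close>
  define c :: real where "c = exp (-8) ^ 3 * (1/2)^3"
  have "\<exists>\<kappa> \<Phi>. continuous_on UNIV \<kappa> \<and> (\<forall>z. 0 \<le> \<kappa> z \<and> \<kappa> z \<le> 1)
      \<and> (\<forall>z. \<kappa> z \<noteq> 0 \<longrightarrow> (\<forall>k. 0 \<le> z $ k \<and> z $ k \<le> r))
      \<and> ennreal (c * r ^ 3) \<le> (\<integral>\<^sup>+z. ennreal (\<kappa> z) \<partial>lborel)
      \<and> C_infinity \<Phi> \<and> compact_support_in UNIV \<Phi>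
      \<and> (\<forall>y. partial j \<Phi> y = \<kappa> y - \<kappa> (y - axis j t))
      \<and> (\<forall>k. (\<integral>\<^sup>+z. ennreal \<bar>partial k \<Phi> z\<bar> \<partial>lborel) \<le> ennreal ((2 * max 1 C) * r\<^sup>2 * t))"
    if r: "0 < r" "r \<le> t" for r t :: real and j :: 3
  proof -
    define \<beta> where "\<beta> s = b ((1/r) * s + 0)" for s
    define \<beta>' where "\<beta>' s = b' ((1/r) * s + 0) * (1/r)" for s
    have "Ck_real n \<beta>" for n
      unfolding \<beta>_def by (rule Ck_real_affine[OF b(1)])
    moreover have "\<beta> s = 0" if "s \<notin> {0<..<r}" for s
      unfolding \<beta>_def by (rule b(4)) (use that r in \<open>auto simp: zero_less_divide_iff divide_simps\<close>)
    ultimately have \<beta>: "Ck_real n \<beta>" "0 \<le> \<beta> s" "\<beta> s \<le> 1" "s \<notin> {0<..<r} \<Longrightarrow> \<beta> s = 0" for n s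
      using b(2,3) by (auto simp: \<beta>_def)
    have d\<beta>: "(\<beta> has_real_derivative \<beta>' s) (at s)" for s
      unfolding \<beta>_def[abs_def] \<beta>'_def
      by (rule DERIV_chain2[OF b'(1)]) (use r in \<open>auto intro!: derivative_eq_intros\<close>)
    have \<beta>': "s \<notin> {0..r} \<Longrightarrow> \<beta>' s = 0" "\<bar>\<beta>' s\<bar> \<le> C / r" for s
      using b'(2)[of "s/r"] b'(3)[of "s/r"] r unfolding \<beta>'_def 
      by (auto simp: abs_mult divide_right_mono zero_le_divide_iff)
    obtain P where P: "\<And>n. Ck_real n P" "\<And>s. (P has_real_derivative \<beta> s - \<beta> (s - t)) (at s)"
      "\<And>s. s \<notin> {0..r + t} \<Longrightarrow> P s = 0" "\<And>s. \<bar>P s\<bar> \<le> r"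
      using Ck_real_sliding_window[of \<beta> r t, OF \<beta>] r by auto
    define \<kappa> where "\<kappa> = tensor (\<lambda>_. \<beta>)"
    define \<psi> where "\<psi> = (\<lambda>_. \<beta>)(j := P)"
    define \<psi>' where "\<psi>' = (\<lambda>_. \<beta>')(j := (\<lambda>s. \<beta> s - \<beta> (s - t)))"
    define \<Phi> where "\<Phi> = tensor \<psi>"
    have d\<psi>: "(\<psi> k has_real_derivative \<psi>' k s) (at s)" for k s
      using d\<beta> P(2) by (simp add: \<psi>_def \<psi>'_def)
    note p\<Phi> = partial_tensor[of \<psi> \<psi>', OF d\<psi>, folded \<Phi>_def]
    have "continuous_on UNIV \<kappa>"
      unfolding \<kappa>_def by (intro continuous_tensor Ck_real_imp_continuous[OF \<beta>(1)])
    moreover have \<kappa>0: "0 \<le> \<kappa> z" for z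
      unfolding \<kappa>_def tensor_def by (intro prod_nonneg) (auto intro: \<beta>)
    moreover have "\<kappa> z \<le> 1" for z
      unfolding \<kappa>_def tensor_def by (intro prod_le_1) (auto intro: \<beta>)
    moreover have "0 \<le> z $ k \<and> z $ k \<le> r" if "\<kappa> z \<noteq> 0" for z k
    proof -
      have "\<beta> s = 0" if "s \<notin> {0..r}" for s using that by (intro \<beta>(4)) auto
      from tensor_zero_outside[of "\<lambda>_. 0" "\<lambda>_. r" "\<lambda>_. \<beta>" z, OF this] show ?thesis
        using that by (auto simp: \<kappa>_def mem_box_cart)
    qed
    moreover have "ennreal (c * r ^ 3) \<le> (\<integral>\<^sup>+z. ennreal (\<kappa> z) \<partial>lborel)"
    proof -
      let ?l = "(\<chi> k. r/4) :: real^3" and ?u = "(\<chi> k. 3*r/4) :: real^3"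
      let ?Q = "cbox ?l ?u :: (real^3) set"
      have "emeasure lborel ?Q = ennreal (measure lborel ?Q)"
        by (rule emeasure_eq_ennreal_measure) (use emeasure_lborel_cbox_finite[of ?l ?u] in auto)
      also have "measure lborel ?Q = (\<Prod>k\<in>(UNIV::3 set). 3*r/4 - r/4)"
        using content_cbox_cart[of ?l ?u] r by (auto simp: interval_ne_empty_cart)
      also have "\<dots> = (1/2)^3 * r^3" by (simp add: power_mult_distrib power_divide)
      finally have "ennreal (c * r ^ 3) = (\<integral>\<^sup>+z. ennreal (exp (-8) ^ 3) * indicator ?Q z \<partial>lborel)"
        using r by (simp add: nn_integral_cmult_indicator c_def ennreal_mult' mult_ac)
      also have "\<dots> \<le> (\<integral>\<^sup>+z. ennreal (\<kappa> z) \<partial>lborel)"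
      proof (rule nn_integral_mono)
        fix z :: "real^3"
        have "exp (-8) ^ 3 \<le> \<kappa> z" if "z \<in> ?Q"
        proof -
          have "(\<Prod>k\<in>(UNIV::3 set). exp (-8)) \<le> \<kappa> z"
            unfolding \<kappa>_def tensor_def
          proof (rule prod_mono, intro conjI)
            fix k :: 3
            have "z $ k / r \<in> {1/4..3/4}" using that r by (auto simp: mem_box_cart field_simps)
            from b(5)[OF this] show "exp (-8) \<le> \<beta> (z $ k)" by (simp add: \<beta>_def)
          qed simp
          then show ?thesis by simp
        qed
        then show "ennreal (exp (-8) ^ 3) * indicator ?Q z \<le> ennreal (\<kappa> z)"
          using \<kappa>0 by (auto simp: indicator_def intro: ennreal_leI)
      qed
      finally show ?thesis .
    qed
    moreover have "C_infinity \<Phi>"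
      unfolding C_infinity_def \<Phi>_def by (intro allI C_k_tensor) (simp add: \<psi>_def \<beta>(1) P(1))
    moreover have supp: "s \<notin> {0..if k = j then r + t else r} \<Longrightarrow> \<psi> k s = 0" for k s
      using \<beta>(4) P(3) by (auto simp: \<psi>_def)
    then have "compact_support_in UNIV \<Phi>"
      unfolding \<Phi>_def by (rule compact_support_tensor)
    moreover have "partial j \<Phi> y = \<kappa> y - \<kappa> (y - axis j t)" for y
    proof -
      have "\<kappa> = tensor ((\<lambda>_. \<beta>)(j := \<beta>))" by (simp add: \<kappa>_def fun_upd_def)
      \<comment> \<open>A shift along axis j is invisible in the other coordinates, so the kernel
        and its translate differ in the j-th factor only.\<close>
      moreover have e: "(\<Prod>k\<in>UNIV - {j}. \<beta> (y $ k - (if k = j then t else 0))) = (\<Prod>k\<in>UNIV - {j}. \<beta> (y $ k))"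
        by (rule prod.cong) auto
      ultimately show ?thesis
        unfolding p\<Phi> \<psi>_def \<psi>'_def fun_upd_upd fun_upd_same
        by (simp add: tensor_fun_upd left_diff_distrib e axis_def)
    qed
    moreover have "(\<integral>\<^sup>+z. ennreal \<bar>partial k \<Phi> z\<bar> \<partial>lborel) \<le> ennreal ((2 * max 1 C) * r\<^sup>2 * t)" for k
    proof -
      \<comment> \<open>Sup bounds of the factors. For k \<noteq> j the size r of the window
        function cancels the 1/r of the differentiated bump, so all three partial derivatives are
        bounded by \<open>max 1 C\<close>. Only the support sees t: its length in direction j is r +
        t \<le> 2 t, the origin of the factor 2.\<close>
      define a where "a = (if k = j then (\<lambda>_. 1) else (\<lambda>_::3. 1::real)(j := r, k := C / r))"
      define u where "u = (\<lambda>l. if l = j then r + t else r)"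
      have le: "(\<integral>\<^sup>+z. ennreal \<bar>tensor (\<psi>(k := \<psi>' k)) z\<bar> \<partial>lborel)
          \<le> ennreal ((\<Prod>l\<in>UNIV. a l) * (\<Prod>l\<in>UNIV. u l - 0))"
      proof (rule nn_integral_tensor_le)
        fix l s
        have "\<bar>\<beta> s - \<beta> (s - t)\<bar> \<le> 1" "\<bar>\<beta> s\<bar> \<le> 1"
          using \<beta>(2,3)[of s] \<beta>(2,3)[of "s-t"] by (auto simp: abs_if)
        then show "\<bar>(\<psi>(k := \<psi>' k)) l s\<bar> \<le> a l"
          using P(4) \<beta>'(2) by (auto simp: \<psi>_def \<psi>'_def a_def)
        have "\<beta> s - \<beta> (s - t) = 0" if "s \<notin> {0..r + t}"
          using that r \<beta>(4)[of s] \<beta>(4)[of "s-t"] by (auto split: if_splits)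
        then show "(\<psi>(k := \<psi>' k)) l s = 0" if "s \<notin> {0..u l}"
          using that supp[of s l] \<beta>'(1)[of s] by (auto simp: u_def \<psi>'_def split: if_splits)
        show "0 \<le> u l" using r by (simp add: u_def)
      qed
      have p1: "(\<Prod>l\<in>UNIV. a l) \<le> max 1 C"
      proof (cases "k = j")
        case False
        have "(\<Prod>l\<in>UNIV. a l) = r * ((C / r) * (\<Prod>l\<in>UNIV - {j} - {k}. a l))"
          using False by (subst prod.remove[of _ j], simp, simp, subst prod.remove[of _ k]) (simp_all add: a_def)
        also have "(\<Prod>l\<in>UNIV - {j} - {k}. a l) = 1"
          by (rule prod.neutral) (auto simp: a_def)
        finally show ?thesis using r by simp
      qed (simp add: a_def)
      have "(\<Prod>l\<in>UNIV. u l - 0) = (r + t) * (\<Prod>l\<in>UNIV - {j}. r)"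
        by (subst prod.remove[of _ j]) (simp_all add: u_def)
      then have "(\<Prod>l\<in>UNIV. a l) * (\<Prod>l\<in>UNIV. u l - 0) \<le> max 1 C * ((t + t) * r\<^sup>2)"
        using r by (auto intro!: mult_mono p1 mult_nonneg_nonneg)
      also have "\<dots> = (2 * max 1 C) * r\<^sup>2 * t" by (simp add: algebra_simps)
      finally have "ennreal ((\<Prod>l\<in>UNIV. a l) * (\<Prod>l\<in>UNIV. u l - 0)) \<le> ennreal ((2 * max 1 C) * r\<^sup>2 * t)"
        by (rule ennreal_leI)
      with le show ?thesis unfolding p\<Phi> by (rule order_trans)
    qed
    ultimately show ?thesis by blast
  qed
  moreover have "0 < c" "0 < 2 * max 1 C" by (auto simp: c_def)
  ultimately show ?thesis using that by blast
qed

section \<open>Periodic functions and translations\<close>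

text \<open>Half-open, so that its integer translates tile space exactly and fractional parts stay
  inside it. It agrees with \<open>unit_cube\<close> and with the open box up to a null set.\<close>

definition cell :: "(real^3) set" where
  "cell = {x. \<forall>k. 0 \<le> x $ k \<and> x $ k < 1}"

text \<open>The counterpart of \<open>ae_periodic\<close> for \<open>lborel\<close>. The estimates
  are made there for Borel functions, where translation invariance and Tonelli are applied;
  \<open>lebesgue\<close> returns only when the fields of the theorem are inserted.\<close>

definition ae_per :: "(real^3 \<Rightarrow> 'b) \<Rightarrow> bool" where
  "ae_per f \<longleftrightarrow> (\<forall>k. AE x in lborel. f (x + axis k 1) = f x)"

lemma cell_iff: "x \<in> cell \<longleftrightarrow> 0 \<le> x $ k \<and> x $ k < 1 \<and> (\<forall>i. i \<noteq> k \<longrightarrow> 0 \<le> x $ i \<and> x $ i < 1)"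
  by (auto simp: cell_def)

lemma cell_borel [measurable]: "cell \<in> sets borel"
  unfolding cell_def by measurable

lemma box_subset_cell: "box 0 1 \<subseteq> cell"
  by (auto simp: cell_def mem_box_cart intro: less_imp_le)

lemma cell_subset_cbox: "cell \<subseteq> cbox 0 1"
  by (force simp: cell_def mem_box_cart intro: less_imp_le)

lemma emeasure_unit_box: "emeasure lborel (box 0 (1::real^3)) = 1"
  "emeasure lborel (cbox 0 (1::real^3)) = 1"
proof -
  have "(\<Prod>b\<in>Basis. (1::real^3) \<bullet> b) = 1"
    by (rule prod.neutral) (auto simp: Basis_vec_def inner_axis)
  then show "emeasure lborel (box 0 (1::real^3)) = 1" "emeasure lborel (cbox 0 (1::real^3)) = 1"
    by (auto simp: emeasure_lborel_box_eq emeasure_lborel_cbox_eq Basis_vec_def inner_axis)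
qed

lemma AE_cell_iff: "AE x in lborel. x \<in> cell \<longleftrightarrow> x \<in> unit_cube" "AE x in lborel. x \<in> cell \<longleftrightarrow> x \<in> box 0 1"
proof -
  have "emeasure lborel (cbox 0 (1::real^3) - box 0 1) = 0"
    by (subst emeasure_Diff) (use emeasure_unit_box box_subset_cbox in auto)
  then have "cbox 0 (1::real^3) - box 0 1 \<in> null_sets lborel" by auto
  from AE_not_in[OF this] have "AE x in lborel. x \<in> cbox 0 (1::real^3) - box 0 1 \<longrightarrow> False" by simp
  then show "AE x in lborel. x \<in> cell \<longleftrightarrow> x \<in> unit_cube" "AE x in lborel. x \<in> cell \<longleftrightarrow> x \<in> box 0 1"
    using box_subset_cell cell_subset_cbox by (auto elim!: eventually_mono)
qed

lemma emeasure_cell: "emeasure lborel cell = 1"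
  using emeasure_eq_AE[OF AE_cell_iff(1)] emeasure_unit_box by simp

section \<open>Invariance of integrals over the cell under translation\<close>

lemma nn_integral_lborel_shift:
  fixes f :: "real^3 \<Rightarrow> ennreal"
  assumes [measurable]: "f \<in> borel_measurable borel"
  shows "(\<integral>\<^sup>+x. f (x + v) \<partial>lborel) = (\<integral>\<^sup>+x. f x \<partial>lborel)"
proof -
  have "(\<integral>\<^sup>+x. f x \<partial>lborel) = (\<integral>\<^sup>+x. f x \<partial>(distr lborel borel ((+) v)))"
    by (simp add: lborel_distr_plus)
  also have "\<dots> = (\<integral>\<^sup>+x. f (v + x) \<partial>lborel)"
    by (rule nn_integral_distr) auto
  finally show ?thesis by (simp add: add.commute)
qed

lemma AE_lborel_shift:
  fixes v :: "real^3"
  assumes "AE x in lborel. P x"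
  shows "AE x in lborel. P (x + v)"
proof -
  have "AE x in distr lborel borel ((+) v). P x"
    unfolding lborel_distr_plus by (rule assms)
  then have "AE x in lborel. P (v + x)" 
    by (rule AE_distrD[rotated]) simp
  then show ?thesis by (simp add: add.commute)
qed

lemma ae_per_shift: "ae_per f \<Longrightarrow> ae_per (\<lambda>x. f (x + v))"
  unfolding ae_per_def
proof
  fix k assume *: "\<forall>k. AE x in lborel. f (x + axis k 1) = f x"
  from AE_lborel_shift[OF *[rule_format, of k], of v]
  show "AE x in lborel. f (x + axis k 1 + v) = f (x + v)" by (simp only: add.assoc add.commute[of v])
qed

lemma ae_per_comp2:
  assumes "ae_per f" "ae_per g"
  shows "ae_per (\<lambda>x. h (f x) (g x))"
  unfolding ae_per_def
proof
  fix k
  have "AE x in lborel. f (x + axis k 1) = f x" "AE x in lborel. g (x + axis k 1) = g x"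
    using assms by (auto simp: ae_per_def)
  then show "AE x in lborel. h (f (x + axis k 1)) (g (x + axis k 1)) = h (f x) (g x)"
    by eventually_elim simp
qed

lemma ae_per_comp: "ae_per f \<Longrightarrow> ae_per (\<lambda>x. h (f x))"
  by (rule ae_per_comp2)

lemma ae_per_of_periodic: "periodic f \<Longrightarrow> ae_per f"
  by (simp add: periodic_def ae_per_def)

text \<open>For shifts of at most one period the shifted cell splits into a part \<open>A\<close>
  inside the cell and a part \<open>B\<close> beyond its upper face, and \<open>B\<close> moved back
  by one period is exactly the rest of the cell.\<close>

lemma nn_integral_cell_shift_axis_le1:
  fixes g :: "real^3 \<Rightarrow> ennreal"
  assumes [measurable]: "g \<in> borel_measurable borel" and per: "ae_per g" and t: "0 \<le> t" "t \<le> 1"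
  shows "(\<integral>\<^sup>+x\<in>cell. g (x + axis k t) \<partial>lborel) = (\<integral>\<^sup>+x\<in>cell. g x \<partial>lborel)"
proof -
  define A where "A = {y\<in>cell. t \<le> y $ k}"
  define B where "B = {y. y - axis k t \<in> cell \<and> 1 \<le> y $ k}"
  have [measurable]: "A \<in> sets borel" "B \<in> sets borel" unfolding A_def B_def by measurable
  have eq: "indicator cell (y - axis k t) = indicator A y + (indicator B y :: ennreal)" for y
  proof -
    have "y - axis k t \<in> cell \<longleftrightarrow> y \<in> A \<or> y \<in> B"
      using t by (auto simp: A_def B_def cell_iff[of _ k] axis_def)
    moreover have "\<not> (y \<in> A \<and> y \<in> B)" by (auto simp: A_def B_def cell_iff[of _ k])
    ultimately show ?thesis by (auto simp: indicator_def)
  qed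
  have eqB: "y + axis k 1 \<in> B \<longleftrightarrow> y \<in> cell \<and> y \<notin> A" for y
    using t by (auto simp: A_def B_def cell_iff[of _ k] axis_def)
  have "(\<integral>\<^sup>+x\<in>cell. g (x + axis k t) \<partial>lborel) = (\<integral>\<^sup>+x. (\<lambda>y. g y * indicator cell (y - axis k t)) (x + axis k t) \<partial>lborel)"
    by simp
  also have "\<dots> = (\<integral>\<^sup>+y. g y * indicator cell (y - axis k t) \<partial>lborel)"
    by (rule nn_integral_lborel_shift) measurable
  also have "\<dots> = (\<integral>\<^sup>+y\<in>A. g y \<partial>lborel) + (\<integral>\<^sup>+y\<in>B. g y \<partial>lborel)"
    unfolding eq distrib_left by (rule nn_integral_add) auto
  also have "(\<integral>\<^sup>+y\<in>B. g y \<partial>lborel) = (\<integral>\<^sup>+y. g (y + axis k 1) * indicator B (y + axis k 1) \<partial>lborel)"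
    by (rule nn_integral_lborel_shift[symmetric]) measurable
  also have "\<dots> = (\<integral>\<^sup>+y\<in>cell - A. g y \<partial>lborel)"
  proof (rule nn_integral_cong_AE)
    have "AE y in lborel. g (y + axis k 1) = g y" using per by (simp add: ae_per_def)
    then show "AE y in lborel. g (y + axis k 1) * indicator B (y + axis k 1) = g y * indicator (cell - A) y"
      by eventually_elim (auto simp: eqB indicator_def)
  qed
  also have "(\<integral>\<^sup>+y\<in>A. g y \<partial>lborel) + (\<integral>\<^sup>+y\<in>cell - A. g y \<partial>lborel) = (\<integral>\<^sup>+y. g y * indicator A y + g y * indicator (cell - A) y \<partial>lborel)"
    by (rule nn_integral_add[symmetric]) auto
  also have "\<dots> = (\<integral>\<^sup>+x\<in>cell. g x \<partial>lborel)"
    by (intro nn_integral_cong) (auto simp: indicator_def A_def)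
  finally show ?thesis .
qed

lemma nn_integral_cell_shift_axis:
  fixes g :: "real^3 \<Rightarrow> ennreal"
  assumes "g \<in> borel_measurable borel" "ae_per g" "0 \<le> t"
  shows "(\<integral>\<^sup>+x\<in>cell. g (x + axis k t) \<partial>lborel) = (\<integral>\<^sup>+x\<in>cell. g x \<partial>lborel)"
proof -
  have *: "(\<integral>\<^sup>+x\<in>cell. g (x + axis k (real n * s)) \<partial>lborel) = (\<integral>\<^sup>+x\<in>cell. g x \<partial>lborel)"
    if "g \<in> borel_measurable borel" "ae_per g" "0 \<le> s" "s \<le> 1" for n s and g :: "real^3 \<Rightarrow> ennreal"
    using that(1,2)
  proof (induction n arbitrary: g)
    case 0
    then show ?case by (simp add: axis_def flip: zero_vec_def)
  next
    case (Suc n)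
    note [measurable] = Suc.prems(1)
    have e: "axis k (real (Suc n) * s) = axis k (real n * s) + axis k s"
      by (auto simp: vec_eq_iff axis_def algebra_simps)
    have "(\<integral>\<^sup>+x\<in>cell. g (x + axis k (real (Suc n) * s)) \<partial>lborel)
        = (\<integral>\<^sup>+x\<in>cell. (\<lambda>y. g (y + axis k s)) (x + axis k (real n * s)) \<partial>lborel)"
      by (simp only: e add_ac)
    also have "\<dots> = (\<integral>\<^sup>+x\<in>cell. g (x + axis k s) \<partial>lborel)"
      by (rule Suc.IH) (auto intro: ae_per_shift Suc.prems)
    also have "\<dots> = (\<integral>\<^sup>+x\<in>cell. g x \<partial>lborel)"
      by (rule nn_integral_cell_shift_axis_le1) (use Suc.prems that in auto)
    finally show ?case .
  qed
  \<comment> \<open>More than t pieces, so that each shift t/n is at most 1 and wraps around at most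
    once.\<close>
  obtain n where n: "t < real n" using reals_Archimedean2 by blast
  then have "t = real n * (t / real n)" using assms(3) by simp
  then show ?thesis using *[OF assms(1,2), of "t / real n" n] n assms(3) by auto
qed

lemma nn_integral_cell_shift_nonneg:
  fixes g :: "real^3 \<Rightarrow> ennreal"
  assumes [measurable]: "g \<in> borel_measurable borel" and per: "ae_per g" and v: "\<And>k. 0 \<le> v $ k"
  shows "(\<integral>\<^sup>+x\<in>cell. g (x + v) \<partial>lborel) = (\<integral>\<^sup>+x\<in>cell. g x \<partial>lborel)"
proof -
  have e: "v = axis 1 (v $ 1) + axis 2 (v $ 2) + axis 3 (v $ 3)"
    unfolding vec_eq_iff by (subst forall_3) (simp add: axis_def)
  have "(\<integral>\<^sup>+x\<in>cell. g (x + v) \<partial>lborel) = (\<integral>\<^sup>+x\<in>cell. (\<lambda>y. g (y + axis 2 (v $ 2) + axis 3 (v $ 3))) (x + axis 1 (v $ 1)) \<partial>lborel)"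
    by (subst e) (simp add: add_ac)
  also have "\<dots> = (\<integral>\<^sup>+x\<in>cell. (\<lambda>y. g (y + axis 3 (v $ 3))) (x + axis 2 (v $ 2)) \<partial>lborel)"
    by (rule nn_integral_cell_shift_axis) (auto intro!: v ae_per_shift[OF ae_per_shift[OF per], simplified])
  also have "\<dots> = (\<integral>\<^sup>+x\<in>cell. g (x + axis 3 (v $ 3)) \<partial>lborel)"
    by (rule nn_integral_cell_shift_axis) (auto intro!: v ae_per_shift per)
  also have "\<dots> = (\<integral>\<^sup>+x\<in>cell. g x \<partial>lborel)"
    by (rule nn_integral_cell_shift_axis) (auto intro!: v per)
  finally show ?thesis .
qed

text \<open>A negative shift is undone rather than computed: the translate of \<open>g\<close> by
  -q, shifted by q, is \<open>g\<close> again, so the nonnegative case applied to that translate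
  gives the claim.\<close>

lemma nn_integral_cell_shift:
  fixes g :: "real^3 \<Rightarrow> ennreal"
  assumes [measurable]: "g \<in> borel_measurable borel" and per: "ae_per g"
  shows "(\<integral>\<^sup>+x\<in>cell. g (x + v) \<partial>lborel) = (\<integral>\<^sup>+x\<in>cell. g x \<partial>lborel)"
proof -
  define p where "p = (\<chi> k. max 0 (v $ k))"
  define q where "q = (\<chi> k. max 0 (- v $ k))"
  have v: "v = p - q" by (auto simp: p_def q_def vec_eq_iff max_def)
  have pq: "0 \<le> p $ k" "0 \<le> q $ k" for k by (auto simp: p_def q_def)
  have "(\<integral>\<^sup>+x\<in>cell. g (x + v) \<partial>lborel) = (\<integral>\<^sup>+x\<in>cell. (\<lambda>y. g (y + - q)) (x + p) \<partial>lborel)"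
    by (simp add: v algebra_simps)
  also have "\<dots> = (\<integral>\<^sup>+x\<in>cell. g (x + - q) \<partial>lborel)"
    by (rule nn_integral_cell_shift_nonneg) (auto intro!: pq ae_per_shift[OF per, of "- q", simplified])
  also have "\<dots> = (\<integral>\<^sup>+x\<in>cell. (\<lambda>y. g (y + - q)) (x + q) \<partial>lborel)"
    by (rule nn_integral_cell_shift_nonneg[symmetric]) (auto intro!: pq ae_per_shift[OF per, of "- q", simplified])
  finally show ?thesis by simp
qed

lemma set_integrable_cell_bounded:
  fixes f :: "real^3 \<Rightarrow> real"
  assumes [measurable]: "f \<in> borel_measurable borel" and b: "\<And>x. \<bar>f x\<bar> \<le> K"
  shows "set_integrable lborel cell f"
  unfolding set_integrable_def
  by (rule integrableI_bounded_set_indicator[where B=K]) (auto simp: emeasure_cell b)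

text \<open>Adding the bound \<open>K\<close> makes the function nonnegative, and since the cell has
  finite measure the constant can be subtracted again afterwards.\<close>

lemma integral_cell_shift:
  fixes f :: "real^3 \<Rightarrow> real"
  assumes [measurable]: "f \<in> borel_measurable borel" and per: "ae_per f" and b: "\<And>x. \<bar>f x\<bar> \<le> K"
  shows "(LINT x:cell|lborel. f (x + v)) = (LINT x:cell|lborel. f x)"
proof -
  have K: "(LINT x:cell|lborel. h x + K) = enn2real (\<integral>\<^sup>+x\<in>cell. ennreal (h x + K) \<partial>lborel)"
    if [measurable]: "h \<in> borel_measurable borel" and b: "\<And>x. \<bar>h x\<bar> \<le> K" for h :: "real^3 \<Rightarrow> real"
  proof -
    have n: "0 \<le> h x + K" for x using b[of x] by linarith
    have "(LINT x:cell|lborel. h x + K) = enn2real (\<integral>\<^sup>+x. ennreal (indicator cell x *\<^sub>R (h x + K)) \<partial>lborel)"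
      unfolding set_lebesgue_integral_def
      by (rule integral_eq_nn_integral) (auto intro!: AE_I2 mult_nonneg_nonneg n simp: indicator_def)
    also have "(\<integral>\<^sup>+x. ennreal (indicator cell x *\<^sub>R (h x + K)) \<partial>lborel) = (\<integral>\<^sup>+x\<in>cell. ennreal (h x + K) \<partial>lborel)"
      by (intro nn_integral_cong) (auto simp: indicator_def)
    finally show ?thesis .
  qed
  have s: "(LINT x:cell|lborel. h x + K) = (LINT x:cell|lborel. h x) + (LINT x:cell|lborel. K)"
    if "h \<in> borel_measurable borel" "\<And>x. \<bar>h x\<bar> \<le> K" for h :: "real^3 \<Rightarrow> real"
    by (rule set_integral_add) (auto intro!: set_integrable_cell_bounded that)
  have "(\<integral>\<^sup>+x\<in>cell. ennreal (f (x + v) + K) \<partial>lborel) = (\<integral>\<^sup>+x\<in>cell. ennreal (f x + K) \<partial>lborel)"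
    by (rule nn_integral_cell_shift[of "\<lambda>x. ennreal (f x + K)"]) (auto intro!: ae_per_comp[OF per])
  then have "(LINT x:cell|lborel. f (x + v) + K) = (LINT x:cell|lborel. f x + K)"
    using K[of f] K[of "\<lambda>x. f (x + v)"] b by simp
  then show ?thesis using s[of f] s[of "\<lambda>x. f (x + v)"] b by simp
qed

text \<open>Composition with this map turns a function known on the cell into one that is periodic
  everywhere, not merely almost everywhere.\<close>

definition frac_part :: "real^3 \<Rightarrow> real^3" where
  "frac_part x = (\<chi> k. frac (x $ k))"

lemma frac_part_periodic: "frac_part (x + axis k 1) = frac_part x"
  by (auto simp: frac_part_def vec_eq_iff axis_def frac_1_eq)

lemma frac_part_cell: "x \<in> cell \<Longrightarrow> frac_part x = x"
  by (auto simp: frac_part_def vec_eq_iff cell_def frac_eq)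

lemma frac_part_borel [measurable]: "frac_part \<in> borel_measurable borel"
proof (subst borel_measurable_euclidean_space, intro ballI)
  fix i :: "real^3" assume "i \<in> Basis"
  then obtain k where i: "i = axis k 1" by (auto simp: Basis_vec_def)
  have "(\<lambda>x::real^3. real_of_int \<lfloor>x $ k\<rfloor>) \<in> borel_measurable borel"
    by (rule measurable_compose[OF _ borel_measurable_real_floor]) measurable
  then have "(\<lambda>x::real^3. frac (x $ k)) \<in> borel_measurable borel"
    unfolding frac_def by measurable
  then show "(\<lambda>x. frac_part x \<bullet> i) \<in> borel_measurable borel"
    by (simp add: i inner_axis frac_part_def)
qed

section \<open>One rescaling step\<close>

lemma has_derivative_at_shift:
  fixes f :: "'a::real_normed_vector \<Rightarrow> 'b::real_normed_vector"
  shows "((\<lambda>y. f (y + v)) has_derivative D) (at y) \<longleftrightarrow> (f has_derivative D) (at (y + v))"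
proof -
  have id: "((\<lambda>y. y + w) has_derivative (\<lambda>y. y)) (at z)" for w z :: 'a
    by (rule has_derivative_add_const[OF has_derivative_ident])
  show ?thesis
    using has_derivative_compose[OF id[of v y], of f D]
      has_derivative_compose[OF id[of "- v" "y + v"], of "\<lambda>y. f (y + v)" D] by auto
qed

lemma partial_shift: "partial k (\<lambda>y. f (y + v)) = (\<lambda>y. partial k f (y + v))"
  by (simp add: partial_def frechet_derivative_def has_derivative_at_shift fun_eq_iff)

lemma C_k_shift: "C_k n f \<Longrightarrow> C_k n (\<lambda>y. f (y + v))"
proof (induction n arbitrary: f)
  case 0
  then show ?case by (auto intro!: continuous_on_compose2[of UNIV f UNIV "\<lambda>y. y + v"] continuous_intros)
next
  case (Suc n)
  then show ?case by (auto simp: partial_shift differentiable_def has_derivative_at_shift)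
qed

lemma compact_support_shift:
  assumes "compact_support_in UNIV f"
  shows "compact_support_in UNIV (\<lambda>y. f (y + v))"
proof -
  have "bounded {y. f y \<noteq> 0}"
    using assms closure_subset by (auto simp: compact_support_in_def intro: bounded_subset[OF compact_imp_bounded])
  then have "bounded ((\<lambda>y. y - v) ` {y. f y \<noteq> 0})" by (rule bounded_translation_minus)
  moreover have "{y. f (y + v) \<noteq> 0} \<subseteq> (\<lambda>y. y - v) ` {y. f y \<noteq> 0}"
    by (auto intro!: image_eqI[of _ _ "_ + v"])
  ultimately have "bounded {y. f (y + v) \<noteq> 0}" by (rule bounded_subset)
  then show ?thesis by (simp add: compact_support_in_def compact_closure)
qed

lemma C_infinity_shift: "C_infinity f \<Longrightarrow> C_infinity (\<lambda>y. f (y + v))"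
  by (simp add: C_infinity_def C_k_shift)

lemma C_k_imp_continuous: "C_k n f \<Longrightarrow> continuous_on UNIV f"
  by (cases n) (auto intro!: continuous_at_imp_continuous_on differentiable_imp_continuous_within)

lemma continuous_partial: "C_k 1 f \<Longrightarrow> continuous_on UNIV (partial k f)"
  by simp

lemma integral_lborel_shift:
  fixes f :: "real^3 \<Rightarrow> real"
  assumes [measurable]: "f \<in> borel_measurable borel"
  shows "(\<integral>x. f (x + v) \<partial>lborel) = (\<integral>x. f x \<partial>lborel)"
proof -
  have "(\<integral>x. f x \<partial>lborel) = (\<integral>x. f x \<partial>(distr lborel borel ((+) v)))"
    by (simp add: lborel_distr_plus)
  also have "\<dots> = (\<integral>x. f (v + x) \<partial>lborel)"
    by (rule integral_distr) auto
  finally show ?thesis by (simp add: add.commute)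
qed

text \<open>The L1 modulus of continuity on the torus for a single translation. With values in
  \<open>ennreal\<close>, subadditivity and Tonelli are available without any integrability
  argument.\<close>

definition shift_diff :: "(real^3 \<Rightarrow> real) \<Rightarrow> real^3 \<Rightarrow> ennreal" where
  "shift_diff f v = (\<integral>\<^sup>+x\<in>cell. ennreal \<bar>f (x + v) - f x\<bar> \<partial>lborel)"

lemma shift_diff_add:
  assumes [measurable]: "f \<in> borel_measurable borel" and per: "ae_per f"
  shows "shift_diff f (v + w) \<le> shift_diff f v + shift_diff f w"
proof -
  have "shift_diff f (v + w) \<le> (\<integral>\<^sup>+x. ennreal \<bar>f (x + w + v) - f (x + w)\<bar> * indicator cell x
      + ennreal \<bar>f (x + w) - f x\<bar> * indicator cell x \<partial>lborel)"
    unfolding shift_diff_def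
  proof (rule nn_integral_mono)
    fix x
    have "ennreal \<bar>f (x + (v + w)) - f x\<bar> \<le> ennreal (\<bar>f (x + w + v) - f (x + w)\<bar> + \<bar>f (x + w) - f x\<bar>)"
      by (intro ennreal_leI) (simp add: algebra_simps)
    then show "ennreal \<bar>f (x + (v + w)) - f x\<bar> * indicator cell x \<le> 
        ennreal \<bar>f (x + w + v) - f (x + w)\<bar> * indicator cell x
      + ennreal \<bar>f (x + w) - f x\<bar> * indicator cell x"
      by (simp add: indicator_def)
  qed
  also have "\<dots> = (\<integral>\<^sup>+x\<in>cell. ennreal \<bar>f (x + w + v) - f (x + w)\<bar> \<partial>lborel) + shift_diff f w"
    unfolding shift_diff_def by (rule nn_integral_add) auto
  also have "(\<integral>\<^sup>+x\<in>cell. ennreal \<bar>f (x + w + v) - f (x + w)\<bar> \<partial>lborel) = shift_diff f v"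
    unfolding shift_diff_def
    by (rule nn_integral_cell_shift[of "\<lambda>x. ennreal \<bar>f (x + v) - f x\<bar>"])
      (auto intro!: ae_per_comp2[OF ae_per_shift[OF per] per])
  finally show ?thesis .
qed

lemma shift_diff_le_axes:
  assumes f: "f \<in> borel_measurable borel" "ae_per f" and b: "\<And>k. shift_diff f (axis k (v $ k)) \<le> ennreal \<beta>"
    and "0 \<le> \<beta>"
  shows "shift_diff f v \<le> ennreal (3 * \<beta>)"
proof -
  have e: "v = axis 1 (v $ 1) + axis 2 (v $ 2) + axis 3 (v $ 3)"
    unfolding vec_eq_iff by (subst forall_3) (simp add: axis_def)
  have "shift_diff f v \<le> ennreal \<beta> + ennreal \<beta> + ennreal \<beta>"
    by (subst e) (intro order_trans[OF shift_diff_add[OF f]] add_mono b)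
  then show ?thesis using \<open>0 \<le> \<beta>\<close> by (simp flip: ennreal_plus)
qed

lemma nn_integral_cell_swap:
  fixes H :: "real^3 \<Rightarrow> real^3 \<Rightarrow> ennreal"
  assumes [measurable]: "K \<in> borel_measurable borel" "case_prod H \<in> borel_measurable (lborel \<Otimes>\<^sub>M lborel)"
  shows "(\<integral>\<^sup>+x\<in>cell. (\<integral>\<^sup>+z. K z * H x z \<partial>lborel) \<partial>lborel) = (\<integral>\<^sup>+z. K z * (\<integral>\<^sup>+x\<in>cell. H x z \<partial>lborel) \<partial>lborel)"
proof -
  have "(\<integral>\<^sup>+x\<in>cell. (\<integral>\<^sup>+z. K z * H x z \<partial>lborel) \<partial>lborel)
      = (\<integral>\<^sup>+x. (\<integral>\<^sup>+z. K z * H x z * indicator cell x \<partial>lborel) \<partial>lborel)"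
    by (intro nn_integral_cong nn_integral_multc[symmetric]) measurable
  also have "\<dots> = (\<integral>\<^sup>+z. (\<integral>\<^sup>+x. K z * H x z * indicator cell x \<partial>lborel) \<partial>lborel)"
    by (rule lborel_pair.Fubini'[symmetric]) measurable
  also have "\<dots> = (\<integral>\<^sup>+z. K z * (\<integral>\<^sup>+x\<in>cell. H x z \<partial>lborel) \<partial>lborel)"
    by (intro nn_integral_cong) (simp add: mult.assoc nn_integral_cmult)
  finally show ?thesis .
qed

lemma ennreal_le_divide_of_mult_le:
  assumes "ennreal m * D \<le> ennreal X" "0 < m" 
  shows "D \<le> ennreal (X / m)"
proof (cases D)
  case (real d)
  then show ?thesis using assms
    by (cases "0 \<le> X") (auto simp: field_simps ennreal_le_iff2 ennreal_neg simp flip: ennreal_mult)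
next
  case top
  then show ?thesis using assms by (auto simp: ennreal_mult_top top_unique)
qed

lemma integrable_lborel_shift:
  fixes f :: "real^3 \<Rightarrow> real"
  assumes "integrable lborel f"
  shows "integrable lborel (\<lambda>x. f (x + v))"
proof -
  have "integrable (distr lborel borel ((+) v)) f"
    unfolding lborel_distr_plus by (rule assms)
  then have "integrable lborel (\<lambda>x. f (v + x))"
    by (rule integrable_distr[rotated]) simp
  then show ?thesis by (simp add: add.commute)
qed

lemma integrable_mult_bounded:
  fixes \<kappa> h :: "real^3 \<Rightarrow> real"
  assumes "integrable lborel \<kappa>" and [measurable]: "h \<in> borel_measurable borel" and "\<And>x. \<bar>h x\<bar> \<le> K"
  shows "integrable lborel (\<lambda>x. \<kappa> x * h x)"
proof (rule Bochner_Integration.integrable_bound)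
  show "integrable lborel (\<lambda>x. K * \<kappa> x)" using assms by simp
  have [measurable]: "\<kappa> \<in> borel_measurable borel" using assms(1) by simp
  show "(\<lambda>x. \<kappa> x * h x) \<in> borel_measurable lborel" by measurable
  show "AE x in lborel. norm (\<kappa> x * h x) \<le> norm (K * \<kappa> x)"
  proof (rule AE_I2)
    fix x
    have "0 \<le> K" using assms(3)[of x] by linarith
    then show "norm (\<kappa> x * h x) \<le> norm (K * \<kappa> x)"
      using mult_left_mono[OF assms(3)[of x], of "\<bar>\<kappa> x\<bar>"] by (simp add: abs_mult mult.commute)
  qed
qed

text \<open>
  The increment of \<open>f\<close> is split into the increment of the mollification \<open>\<integral>\<kappa>(z) f(x + z) dz\<close>, which is
  a pairing of \<open>f\<close> with \<open>\<partial>\<^sub>j \<Phi>\<close> and hence of \<open>g\<close> with \<open>\<nabla>\<Phi>\<close>, and two mollification errors, which only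
  involve translations by vectors in the support of \<open>\<kappa>\<close>.
\<close>

lemma mollified_step:
  fixes f :: "real^3 \<Rightarrow> real" and g :: "3 \<Rightarrow> real^3 \<Rightarrow> real"
  assumes f[measurable]: "f \<in> borel_measurable borel" and perf: "ae_per f" and bf: "\<And>x. \<bar>f x\<bar> \<le> K"
    and g[measurable]: "\<And>k. g k \<in> borel_measurable borel" and perg: "\<And>k. ae_per (g k)"
    and G: "\<And>k. (\<integral>\<^sup>+x\<in>cell. ennreal \<bar>g k x\<bar> \<partial>lborel) \<le> ennreal G" "0 \<le> G"
    and weak: "\<And>\<phi>. C_infinity \<phi> \<Longrightarrow> compact_support_in UNIV \<phi> \<Longrightarrow>
        ennreal \<bar>\<integral>y. f y * partial j \<phi> y \<partial>lborel\<bar>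
          \<le> (\<Sum>k\<in>UNIV. \<integral>\<^sup>+y. ennreal \<bar>partial k \<phi> y\<bar> * ennreal \<bar>g k y\<bar> \<partial>lborel)"
    and \<beta>: "\<And>k s. 0 \<le> s \<Longrightarrow> s \<le> r \<Longrightarrow> shift_diff f (axis k s) \<le> ennreal \<beta>" "0 \<le> \<beta>"
    and \<kappa>: "continuous_on UNIV \<kappa>" "\<And>z. 0 \<le> \<kappa> z" "\<And>z. \<kappa> z \<le> 1"
      "\<And>z k. \<kappa> z \<noteq> 0 \<Longrightarrow> 0 \<le> z $ k \<and> z $ k \<le> r"
      "ennreal m0 \<le> (\<integral>\<^sup>+z. ennreal (\<kappa> z) \<partial>lborel)" "0 < m0"
    and \<Phi>: "C_infinity \<Phi>" "compact_support_in UNIV \<Phi>"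
      "\<And>y. partial j \<Phi> y = \<kappa> y - \<kappa> (y - axis j t)"
      "\<And>k. (\<integral>\<^sup>+z. ennreal \<bar>partial k \<Phi> z\<bar> \<partial>lborel) \<le> ennreal B" "0 \<le> B"
  shows "shift_diff f (axis j t) \<le> ennreal (6 * \<beta> + 3 * (B * G) / m0)"
proof -
  define e where "e = (axis j t :: real^3)"
  define m where "m = (\<integral>z. \<kappa> z \<partial>lborel)"
  have [measurable]: "\<kappa> \<in> borel_measurable borel"
    using \<kappa>(1) by (rule borel_measurable_continuous_onI)
  have "C_k 1 \<Phi>" using \<Phi>(1) by (simp add: C_infinity_def)
  then have p\<Phi>[measurable]: "partial k \<Phi> \<in> borel_measurable borel" for k
    by (intro borel_measurable_continuous_onI continuous_partial)
  \<comment> \<open>The kernel is at most 1 and lives in a cube, so its mass \<open>m\<close> is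
    finite; together with the lower bound \<open>m0\<close> this permits dividing by
    \<open>m\<close> at the end.\<close>
  have "(\<integral>\<^sup>+z. ennreal (\<kappa> z) \<partial>lborel) \<le> (\<integral>\<^sup>+z. indicator (cbox 0 (\<chi> k. r)) (z :: real^3) \<partial>lborel)"
  proof (rule nn_integral_mono)
    fix z :: "real^3"
    show "ennreal (\<kappa> z) \<le> indicator (cbox 0 (\<chi> k. r)) z"
      using \<kappa>(3)[of z] \<kappa>(4)[of z] by (cases "\<kappa> z = 0") (auto simp: mem_box_cart)
  qed
  also have "\<dots> < \<infinity>" using emeasure_lborel_cbox_finite[of 0 "\<chi> k. r"] by simp
  finally have fin: "(\<integral>\<^sup>+z. ennreal (\<kappa> z) \<partial>lborel) < \<infinity>" .
  then have int\<kappa>: "integrable lborel \<kappa>"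
    by (intro integrableI_bounded) (auto simp: \<kappa>(2))
  have nn\<kappa>: "(\<integral>\<^sup>+z. ennreal (\<kappa> z) \<partial>lborel) = ennreal m"
    unfolding m_def by (rule nn_integral_eq_integral[OF int\<kappa>]) (simp add: \<kappa>(2))
  have m: "m0 \<le> m" using \<kappa>(5,6) unfolding nn\<kappa> by (simp add: ennreal_le_iff2)
  note bd = integrable_mult_bounded[where K="2*K"]
  have b2: "\<bar>f x - f y\<bar> \<le> 2 * K" "\<bar>f x\<bar> \<le> 2 * K" for x y using bf[of x] bf[of y] by linarith+
  have pw: "ennreal m * ennreal \<bar>f (x + e) - f x\<bar> \<le> 
      (\<integral>\<^sup>+z. ennreal (\<kappa> z) * ennreal \<bar>f (x + e + z) - f (x + e)\<bar> \<partial>lborel)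
      + (\<Sum>k\<in>UNIV. \<integral>\<^sup>+z. ennreal \<bar>partial k \<Phi> z\<bar> * ennreal \<bar>g k (x + z)\<bar> \<partial>lborel)
      + (\<integral>\<^sup>+z. ennreal (\<kappa> z) * ennreal \<bar>f (x + z) - f x\<bar> \<partial>lborel)" for x
  proof -
    define X1 where "X1 = (\<integral>z. \<kappa> z * (f (x + e) - f (x + e + z)) \<partial>lborel)"
    define X2 where "X2 = (\<integral>z. \<kappa> z * (f (x + e + z) - f (x + z)) \<partial>lborel)"
    define X3 where "X3 = (\<integral>z. \<kappa> z * (f (x + z) - f x) \<partial>lborel)"
    have i: "integrable lborel (\<lambda>z. \<kappa> z * (f (x + e) - f (x + e + z)))"
      "integrable lborel (\<lambda>z. \<kappa> z * (f (x + e + z) - f (x + z)))"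
      "integrable lborel (\<lambda>z. \<kappa> z * (f (x + z) - f x))"
      "integrable lborel (\<lambda>z. \<kappa> z * f (x + e + z))"
      "integrable lborel (\<lambda>z. \<kappa> z * f (x + z))"
      "integrable lborel (\<lambda>z. \<kappa> (z + - e) * f (x + z))"
      by (auto intro!: bd int\<kappa> b2 integrable_lborel_shift[OF int\<kappa>, of "- e", simplified])
    have "X1 + X2 + X3 = (\<integral>z. \<kappa> z * (f (x + e) - f (x + e + z)) + \<kappa> z * (f (x + e + z) - f (x + z))
          + \<kappa> z * (f (x + z) - f x) \<partial>lborel)"
      unfolding X1_def X2_def X3_def using i by simp
    also have "\<dots> = (\<integral>z. \<kappa> z * (f (x + e) - f x) \<partial>lborel)"
      by (intro Bochner_Integration.integral_cong) (auto simp: algebra_simps)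
    also have "\<dots> = m * (f (x + e) - f x)" unfolding m_def by simp
    finally have "m * (f (x + e) - f x) = X1 + X2 + X3" by simp
    then have "m * \<bar>f (x + e) - f x\<bar> = \<bar>X1 + X2 + X3\<bar>"
      using m \<kappa>(6) by (metis abs_mult abs_of_nonneg less_eq_real_def order_trans)
    then have le: "m * \<bar>f (x + e) - f x\<bar> \<le> \<bar>X1\<bar> + \<bar>X2\<bar> + \<bar>X3\<bar>" by linarith
    have X1: "ennreal \<bar>X1\<bar> \<le> (\<integral>\<^sup>+z. ennreal (\<kappa> z) * ennreal \<bar>f (x + e + z) - f (x + e)\<bar> \<partial>lborel)"
      using integral_norm_bound_ennreal[OF i(1)] 
      by (simp add: X1_def abs_mult \<kappa>(2) ennreal_mult abs_minus_commute)
    have X3: "ennreal \<bar>X3\<bar> \<le> (\<integral>\<^sup>+z. ennreal (\<kappa> z) * ennreal \<bar>f (x + z) - f x\<bar> \<partial>lborel)"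
      using integral_norm_bound_ennreal[OF i(3)] by (simp add: X3_def abs_mult \<kappa>(2) ennreal_mult)
    \<comment> \<open>For each fixed x the test function is \<Phi> recentred at x. Its j-th
      derivative is the recentred kernel minus its translate, so \<open>X2\<close> is minus the
      pairing of \<open>f\<close> with that derivative.\<close>
    define \<phi> where "\<phi> y = \<Phi> (y + - x)" for y
    have \<phi>: "partial k \<phi> = (\<lambda>y. partial k \<Phi> (y + - x))" for k
      unfolding \<phi>_def[abs_def] by (rule partial_shift)
    have "(\<integral>z. \<kappa> z * f (x + e + z) \<partial>lborel) = (\<integral>z. (\<lambda>z. \<kappa> (z + - e) * f (x + z)) (z + e) \<partial>lborel)"
      by (simp add: algebra_simps)
    also have "\<dots> = (\<integral>z. \<kappa> (z + - e) * f (x + z) \<partial>lborel)"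
      by (rule integral_lborel_shift) measurable
    finally have "X2 = (\<integral>z. \<kappa> (z + - e) * f (x + z) \<partial>lborel) - (\<integral>z. \<kappa> z * f (x + z) \<partial>lborel)"
      unfolding X2_def right_diff_distrib using i by simp
    also have "\<dots> = (\<integral>z. \<kappa> (z + - e) * f (x + z) - \<kappa> z * f (x + z) \<partial>lborel)"
      using i by simp
    also have "\<dots> = (\<integral>z. - (\<lambda>y. f y * partial j \<phi> y) (z + x) \<partial>lborel)"
      by (intro Bochner_Integration.integral_cong) (auto simp: \<phi> \<Phi>(3) e_def algebra_simps)
    also have "\<dots> = - (\<integral>z. (\<lambda>y. f y * partial j \<phi> y) (z + x) \<partial>lborel)"
      by (rule Bochner_Integration.integral_minus)
    also have "(\<integral>z. (\<lambda>y. f y * partial j \<phi> y) (z + x) \<partial>lborel) = (\<integral>y. f y * partial j \<phi> y \<partial>lborel)"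
      unfolding \<phi> by (rule integral_lborel_shift) measurable
    finally have "ennreal \<bar>X2\<bar> \<le> (\<Sum>k\<in>UNIV. \<integral>\<^sup>+y. ennreal \<bar>partial k \<phi> y\<bar> * ennreal \<bar>g k y\<bar> \<partial>lborel)"
      using weak[of \<phi>] C_infinity_shift[OF \<Phi>(1), of "- x"] compact_support_shift[OF \<Phi>(2), of "- x"]
      unfolding \<phi>_def[abs_def] by simp
    also have "\<dots> = (\<Sum>k\<in>UNIV. \<integral>\<^sup>+z. ennreal \<bar>partial k \<Phi> z\<bar> * ennreal \<bar>g k (x + z)\<bar> \<partial>lborel)"
    proof (rule sum.cong)
      fix k
      have "(\<integral>\<^sup>+z. ennreal \<bar>partial k \<Phi> z\<bar> * ennreal \<bar>g k (x + z)\<bar> \<partial>lborel)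
         = (\<integral>\<^sup>+z. (\<lambda>y. ennreal \<bar>partial k \<phi> y\<bar> * ennreal \<bar>g k y\<bar>) (z + x) \<partial>lborel)"
        unfolding \<phi> by (simp add: add.commute)
      also have "\<dots> = (\<integral>\<^sup>+y. ennreal \<bar>partial k \<phi> y\<bar> * ennreal \<bar>g k y\<bar> \<partial>lborel)"
        unfolding \<phi> by (rule nn_integral_lborel_shift) measurable
      finally show "(\<integral>\<^sup>+y. ennreal \<bar>partial k \<phi> y\<bar> * ennreal \<bar>g k y\<bar> \<partial>lborel)
         = (\<integral>\<^sup>+z. ennreal \<bar>partial k \<Phi> z\<bar> * ennreal \<bar>g k (x + z)\<bar> \<partial>lborel)" by simp
    qed simp
    finally have X2: "ennreal \<bar>X2\<bar> \<le> (\<Sum>k\<in>UNIV. \<integral>\<^sup>+z. ennreal \<bar>partial k \<Phi> z\<bar> * ennreal \<bar>g k (x + z)\<bar> \<partial>lborel)" .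
    have "ennreal m * ennreal \<bar>f (x + e) - f x\<bar> = ennreal (m * \<bar>f (x + e) - f x\<bar>)"
      using m \<kappa>(6) by (simp add: ennreal_mult)
    also have "\<dots> \<le> ennreal (\<bar>X1\<bar> + \<bar>X2\<bar> + \<bar>X3\<bar>)" by (intro ennreal_leI le)
    also have "\<dots> = ennreal \<bar>X1\<bar> + ennreal \<bar>X2\<bar> + ennreal \<bar>X3\<bar>" by simp
    finally show ?thesis by (rule order_trans) (intro add_mono X1 X2 X3)
  qed
  \<comment> \<open>The kernel only sees vectors in the cube of side r, each of them a sum of three
    axis shifts of length at most r; hence \<open>3 * \<beta>\<close>.\<close>
  have D: "ennreal (\<kappa> z) * shift_diff f z \<le> ennreal (\<kappa> z) * ennreal (3 * \<beta>)" for z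
  proof (cases "\<kappa> z = 0")
    case False
    then show ?thesis
      by (intro mult_left_mono shift_diff_le_axes f perf \<beta>) (use \<kappa>(4) in auto)
  qed simp
  have int\<kappa>D: "(\<integral>\<^sup>+z. ennreal (\<kappa> z) * shift_diff f z \<partial>lborel) \<le> ennreal (3 * \<beta> * m)"
  proof -
    have "(\<integral>\<^sup>+z. ennreal (\<kappa> z) * shift_diff f z \<partial>lborel) \<le> (\<integral>\<^sup>+z. ennreal (\<kappa> z) * ennreal (3 * \<beta>) \<partial>lborel)"
      by (intro nn_integral_mono D)
    also have "\<dots> = ennreal m * ennreal (3 * \<beta>)" by (simp add: nn_integral_multc nn\<kappa>)
    finally show ?thesis using \<beta>(2) m \<kappa>(6) by (simp add: mult.commute flip: ennreal_mult)
  qed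
  have eqf: "(\<integral>\<^sup>+x\<in>cell. ennreal \<bar>f (x + e + z) - f (x + e)\<bar> \<partial>lborel) = shift_diff f z" for z
    unfolding shift_diff_def 
    by (rule nn_integral_cell_shift[of "\<lambda>x. ennreal \<bar>f (x + z) - f x\<bar>"])
      (measurable, rule ae_per_comp2[OF ae_per_shift[OF perf] perf])
  have "(\<integral>\<^sup>+x\<in>cell. (\<integral>\<^sup>+z. ennreal (\<kappa> z) * ennreal \<bar>f (x + e + z) - f (x + e)\<bar> \<partial>lborel) \<partial>lborel)
      = (\<integral>\<^sup>+z. ennreal (\<kappa> z) * (\<integral>\<^sup>+x\<in>cell. ennreal \<bar>f (x + e + z) - f (x + e)\<bar> \<partial>lborel) \<partial>lborel)"
    by (rule nn_integral_cell_swap) measurable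
  also have "\<dots> = (\<integral>\<^sup>+z. ennreal (\<kappa> z) * shift_diff f z \<partial>lborel)"
    by (simp only: eqf)
  finally have U: "(\<integral>\<^sup>+x\<in>cell. (\<integral>\<^sup>+z. ennreal (\<kappa> z) * ennreal \<bar>f (x + e + z) - f (x + e)\<bar> \<partial>lborel) \<partial>lborel)
      \<le> ennreal (3 * \<beta> * m)" using int\<kappa>D by simp
  have "(\<integral>\<^sup>+x\<in>cell. (\<integral>\<^sup>+z. ennreal (\<kappa> z) * ennreal \<bar>f (x + z) - f x\<bar> \<partial>lborel) \<partial>lborel)
      = (\<integral>\<^sup>+z. ennreal (\<kappa> z) * shift_diff f z \<partial>lborel)"
    unfolding shift_diff_def by (rule nn_integral_cell_swap) measurable
  then have W: "(\<integral>\<^sup>+x\<in>cell. (\<integral>\<^sup>+z. ennreal (\<kappa> z) * ennreal \<bar>f (x + z) - f x\<bar> \<partial>lborel) \<partial>lborel)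
      \<le> ennreal (3 * \<beta> * m)" using int\<kappa>D by simp
  have V: "(\<integral>\<^sup>+x\<in>cell. (\<integral>\<^sup>+z. ennreal \<bar>partial k \<Phi> z\<bar> * ennreal \<bar>g k (x + z)\<bar> \<partial>lborel) \<partial>lborel) \<le> ennreal (B * G)" for k
  proof -
    have eqg: "(\<integral>\<^sup>+x\<in>cell. ennreal \<bar>g k (x + z)\<bar> \<partial>lborel) = (\<integral>\<^sup>+x\<in>cell. ennreal \<bar>g k x\<bar> \<partial>lborel)" for z
      by (rule nn_integral_cell_shift[of "\<lambda>x. ennreal \<bar>g k x\<bar>"]) (measurable, rule ae_per_comp[OF perg])
    have "(\<integral>\<^sup>+x\<in>cell. (\<integral>\<^sup>+z. ennreal \<bar>partial k \<Phi> z\<bar> * ennreal \<bar>g k (x + z)\<bar> \<partial>lborel) \<partial>lborel)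
      = (\<integral>\<^sup>+z. ennreal \<bar>partial k \<Phi> z\<bar> * (\<integral>\<^sup>+x\<in>cell. ennreal \<bar>g k (x + z)\<bar> \<partial>lborel) \<partial>lborel)"
      by (rule nn_integral_cell_swap) measurable
    also have "\<dots> = (\<integral>\<^sup>+z. ennreal \<bar>partial k \<Phi> z\<bar> \<partial>lborel) * (\<integral>\<^sup>+x\<in>cell. ennreal \<bar>g k x\<bar> \<partial>lborel)"
      unfolding eqg by (rule nn_integral_multc) measurable
    also have "\<dots> \<le> ennreal B * ennreal G"
      by (intro mult_mono \<Phi> G) auto
    finally show ?thesis using G(2) \<Phi>(5) by (simp add: ennreal_mult)
  qed
  have "ennreal m * shift_diff f e = (\<integral>\<^sup>+x. ennreal m * ennreal \<bar>f (x + e) - f x\<bar> * indicator cell x \<partial>lborel)"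
    unfolding shift_diff_def by (simp add: mult.assoc nn_integral_cmult)
  also have "\<dots> \<le> (\<integral>\<^sup>+x. (\<integral>\<^sup>+z. ennreal (\<kappa> z) * ennreal \<bar>f (x + e + z) - f (x + e)\<bar> \<partial>lborel) * indicator cell x
      + (\<Sum>k\<in>UNIV. (\<integral>\<^sup>+z. ennreal \<bar>partial k \<Phi> z\<bar> * ennreal \<bar>g k (x + z)\<bar> \<partial>lborel) * indicator cell x)
      + (\<integral>\<^sup>+z. ennreal (\<kappa> z) * ennreal \<bar>f (x + z) - f x\<bar> \<partial>lborel) * indicator cell x \<partial>lborel)"
    unfolding sum_distrib_right[symmetric] distrib_right[symmetric]
    by (intro nn_integral_mono mult_right_mono pw) auto
  also have "\<dots> = (\<integral>\<^sup>+x\<in>cell. (\<integral>\<^sup>+z. ennreal (\<kappa> z) * ennreal \<bar>f (x + e + z) - f (x + e)\<bar> \<partial>lborel) \<partial>lborel)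
      + (\<Sum>k\<in>UNIV. \<integral>\<^sup>+x\<in>cell. (\<integral>\<^sup>+z. ennreal \<bar>partial k \<Phi> z\<bar> * ennreal \<bar>g k (x + z)\<bar> \<partial>lborel) \<partial>lborel)
      + (\<integral>\<^sup>+x\<in>cell. (\<integral>\<^sup>+z. ennreal (\<kappa> z) * ennreal \<bar>f (x + z) - f x\<bar> \<partial>lborel) \<partial>lborel)"
    by (subst nn_integral_add, measurable, subst nn_integral_add, measurable, subst nn_integral_sum, measurable)
  also have "\<dots> \<le> ennreal (3 * \<beta> * m) + (\<Sum>k\<in>(UNIV::3 set). ennreal (B * G)) + ennreal (3 * \<beta> * m)"
    by (intro add_mono sum_mono U V W)
  also have "\<dots> = ennreal (6 * \<beta> * m + 3 * (B * G))"
  proof -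
    have "(\<Sum>k\<in>(UNIV::3 set). ennreal (B * G)) = ennreal (3 * (B * G))"
      using G(2) \<Phi>(5) by (subst sum_ennreal) simp_all
    moreover have "6 * \<beta> * m + 3 * (B * G) = 3 * \<beta> * m + 3 * (B * G) + 3 * \<beta> * m" by simp
    moreover have "0 \<le> 3 * \<beta> * m" "0 \<le> 3 * (B * G)" using \<beta>(2) m \<kappa>(6) G(2) \<Phi>(5) by auto
    ultimately show ?thesis by (simp only: ennreal_plus add_nonneg_nonneg)
  qed
  finally have "shift_diff f e \<le> ennreal ((6 * \<beta> * m + 3 * (B * G)) / m)"
    by (rule ennreal_le_divide_of_mult_le) (use m \<kappa>(6) in simp)
  \<comment> \<open>The two mollification errors contribute \<open>3 * \<beta> * m\<close> each, so
    the mass cancels and leaves \<open>6 * \<beta>\<close>; in the term with \<open>G\<close> it is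
    replaced by its lower bound \<open>m0\<close>.\<close>
  also have "(6 * \<beta> * m + 3 * (B * G)) / m \<le> 6 * \<beta> + 3 * (B * G) / m0"
    using m \<kappa>(6) G(2) \<Phi>(5) by (simp add: add_divide_distrib frac_le)
  finally show ?thesis unfolding e_def by (simp add: ennreal_leI)
qed

section \<open>Total variation and translations\<close>

lemma C_k_1_mult:
  fixes f g :: "real^3 \<Rightarrow> real"
  assumes "C_k 1 f" "C_k 1 g"
  shows "C_k 1 (\<lambda>x. f x * g x)"
proof -
  have d: "(f has_derivative frechet_derivative f (at x)) (at x)" "(g has_derivative frechet_derivative g (at x)) (at x)" for x
    using assms by (auto simp: frechet_derivative_works)
  note m = has_derivative_mult[OF d]
  have "partial k (\<lambda>x. f x * g x) = (\<lambda>x. f x * partial k g x + partial k f x * g x)" for k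
    unfolding partial_def frechet_derivative_at[OF m, symmetric] by simp
  moreover have "continuous_on UNIV (\<lambda>x. f x * partial k g x + partial k f x * g x)" for k
    using assms C_k_imp_continuous[OF assms(1)] C_k_imp_continuous[OF assms(2)]
    by (auto intro!: continuous_intros)
  ultimately show ?thesis using m by (auto simp: differentiable_def)
qed

lemma C_k_1_diff:
  fixes f g :: "real^3 \<Rightarrow> real"
  assumes "C_k 1 f" "C_k 1 g"
  shows "C_k 1 (\<lambda>x. f x - g x)"
proof -
  have d: "(f has_derivative frechet_derivative f (at x)) (at x)" "(g has_derivative frechet_derivative g (at x)) (at x)" for x
    using assms by (auto simp: frechet_derivative_works)
  note m = has_derivative_diff[OF d]
  have "partial k (\<lambda>x. f x - g x) = (\<lambda>x. partial k f x - partial k g x)" for k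
    unfolding partial_def frechet_derivative_at[OF m, symmetric] by simp
  moreover have "continuous_on UNIV (\<lambda>x. partial k f x - partial k g x)" for k
    using assms by (auto intro!: continuous_intros)
  ultimately show ?thesis using m by (auto simp: differentiable_def)
qed

lemma C_k_coordinate:
  assumes "Ck_real n \<phi>"
  shows "C_k n (\<lambda>x. \<phi> (x $ k))"
proof -
  have "C_k n (tensor ((\<lambda>_ _. 1)(k := \<phi>)))"
    by (rule C_k_tensor) (use assms in \<open>auto simp: Ck_real_const\<close>)
  moreover have "tensor ((\<lambda>_ _. 1)(k := \<phi>)) = (\<lambda>x. \<phi> (x $ k))"
    by (simp add: fun_eq_iff tensor_fun_upd)
  ultimately show ?thesis by simp
qed

lemma C_k_const: "C_k n (\<lambda>_::real^3. c::real)"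
  using C_k_coordinate[OF Ck_real_const[of n c]] .

section \<open>Density of periodic C1 functions in L1\<close>

definition torus_test :: "(real^3 \<Rightarrow> real) \<Rightarrow> bool" where
  "torus_test \<sigma> \<longleftrightarrow> C_k 1 \<sigma> \<and> periodic \<sigma> \<and> (\<forall>x. 0 \<le> \<sigma> x \<and> \<sigma> x \<le> 1)"

text \<open>
  The C1 test functions of the total variation are dense enough to detect the sign of an increment
  of \<open>f\<close>, which turns a bound for smooth test functions into an \<open>L\<^sup>1\<close> bound.
\<close>

definition torus_approx :: "(real^3) set \<Rightarrow> bool" where
  "torus_approx A \<longleftrightarrow> A \<in> sets borel \<and>
     (\<forall>e>0. \<exists>\<sigma>. torus_test \<sigma> \<and> (LINT x:cell|lborel. \<bar>\<sigma> x - indicator A x\<bar>) \<le> e)"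

lemma torus_test_borel: "torus_test \<sigma> \<Longrightarrow> \<sigma> \<in> borel_measurable borel"
  unfolding torus_test_def by (blast intro: borel_measurable_continuous_onI C_k_imp_continuous)

lemma torus_test_complement: "torus_test \<sigma> \<Longrightarrow> torus_test (\<lambda>x. 1 - \<sigma> x)"
  using C_k_1_diff[OF C_k_const, of \<sigma> 1]
  by (auto simp: torus_test_def periodic_def)

lemma torus_test_mult: "torus_test \<sigma> \<Longrightarrow> torus_test \<tau> \<Longrightarrow> torus_test (\<lambda>x. \<sigma> x * \<tau> x)"
  using C_k_1_mult[of \<sigma> \<tau>] by (auto simp: torus_test_def periodic_def intro: mult_le_one)

lemma torus_test_const: "0 \<le> c \<Longrightarrow> c \<le> 1 \<Longrightarrow> torus_test (\<lambda>_. c)"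
  using C_k_const[of 1 c] by (auto simp: torus_test_def periodic_def)

lemma cell_integral_tendsto_0:
  fixes F :: "nat \<Rightarrow> real^3 \<Rightarrow> real"
  assumes [measurable]: "\<And>n. F n \<in> borel_measurable borel" and b: "\<And>n x. \<bar>F n x\<bar> \<le> 1"
    and lim: "AE x in lborel. x \<in> cell \<longrightarrow> (\<lambda>n. F n x) \<longlonglongrightarrow> 0"
  shows "(\<lambda>n. LINT x:cell|lborel. F n x) \<longlonglongrightarrow> 0"
proof -
  have "(\<lambda>n. \<integral>x. indicator cell x *\<^sub>R F n x \<partial>lborel) \<longlonglongrightarrow> (\<integral>x. 0 \<partial>(lborel :: (real^3) measure))"
  proof (rule integral_dominated_convergence[where w="indicator cell"])
    show "integrable lborel (indicator cell :: real^3 \<Rightarrow> real)" by (simp add: emeasure_cell)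
    show "AE x in lborel. (\<lambda>n. indicator cell x *\<^sub>R F n x) \<longlonglongrightarrow> 0"
      using lim by eventually_elim (auto simp: indicator_def)
    show "AE x in lborel. norm (indicator cell x *\<^sub>R F n x) \<le> indicator cell x" for n
      using b by (auto simp: indicator_def)
  qed auto
  then show ?thesis by (simp add: set_lebesgue_integral_def)
qed

lemma torus_test_indicator_diff:
  assumes "torus_test \<sigma>"
  shows "\<bar>\<bar>\<sigma> x - indicator A x\<bar>\<bar> \<le> 1"
  using assms by (auto simp: torus_test_def indicator_def abs_le_iff) (smt (verit))+

lemma torus_approx_seq:
  assumes A: "A \<in> sets borel" and \<sigma>: "\<And>n. torus_test (\<sigma> n)"
    and lim: "AE x in lborel. x \<in> cell \<longrightarrow> (\<lambda>n. \<sigma> n x) \<longlonglongrightarrow> indicator A x"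
  shows "torus_approx A"
  unfolding torus_approx_def
proof (intro conjI A allI impI)
  fix e :: real assume "0 < e"
  note [measurable] = A torus_test_borel[OF \<sigma>]
  have "(\<lambda>n. LINT x:cell|lborel. \<bar>\<sigma> n x - indicator A x\<bar>) \<longlonglongrightarrow> 0"
  proof (rule cell_integral_tendsto_0)
    show "AE x in lborel. x \<in> cell \<longrightarrow> (\<lambda>n. \<bar>\<sigma> n x - indicator A x\<bar>) \<longlonglongrightarrow> 0"
      using lim by eventually_elim (auto intro!: tendsto_rabs_zero LIM_zero)
    show "\<bar>\<bar>\<sigma> n x - indicator A x\<bar>\<bar> \<le> 1" for n x
      by (rule torus_test_indicator_diff[OF \<sigma>])
  qed measurable
  from order_tendstoD(2)[OF this \<open>0 < e\<close>] obtain n where "(LINT x:cell|lborel. \<bar>\<sigma> n x - indicator A x\<bar>) < e"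
    by (auto simp: eventually_sequentially)
  then show "\<exists>\<sigma>. torus_test \<sigma> \<and> (LINT x:cell|lborel. \<bar>\<sigma> x - indicator A x\<bar>) \<le> e"
    using \<sigma> by (intro exI[of _ "\<sigma> n"]) auto
qed

lemma torus_approx_compl: "torus_approx A \<Longrightarrow> torus_approx (UNIV - A)"
  unfolding torus_approx_def
proof (intro conjI allI impI)
  fix e :: real assume A: "A \<in> sets borel \<and> (\<forall>e>0. \<exists>\<sigma>. torus_test \<sigma> \<and> (LINT x:cell|lborel. \<bar>\<sigma> x - indicator A x\<bar>) \<le> e)" and "0 < e"
  then obtain \<sigma> where \<sigma>: "torus_test \<sigma>" "(LINT x:cell|lborel. \<bar>\<sigma> x - indicator A x\<bar>) \<le> e" by blast
  have "\<bar>(1 - \<sigma> x) - indicator (UNIV - A) x\<bar> = \<bar>\<sigma> x - indicator A x\<bar>" for x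
    by (auto simp: indicator_def)
  then show "\<exists>\<sigma>. torus_test \<sigma> \<and> (LINT x:cell|lborel. \<bar>\<sigma> x - indicator (UNIV - A) x\<bar>) \<le> e"
    using \<sigma> torus_test_complement by (intro exI[of _ "\<lambda>x. 1 - \<sigma> x"]) auto
qed auto

lemma torus_approx_Int:
  assumes A: "torus_approx A" and B: "torus_approx B"
  shows "torus_approx (A \<inter> B)"
  unfolding torus_approx_def
proof (intro conjI allI impI)
  have [measurable]: "A \<in> sets borel" "B \<in> sets borel" using A B by (auto simp: torus_approx_def)
  show "A \<inter> B \<in> sets borel" by measurable
  fix e :: real assume "0 < e"
  then obtain \<sigma> \<tau> where \<sigma>: "torus_test \<sigma>" "(LINT x:cell|lborel. \<bar>\<sigma> x - indicator A x\<bar>) \<le> e/2"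
    and \<tau>: "torus_test \<tau>" "(LINT x:cell|lborel. \<bar>\<tau> x - indicator B x\<bar>) \<le> e/2"
    using A B unfolding torus_approx_def by (meson half_gt_zero)
  note [measurable] = torus_test_borel[OF \<sigma>(1)] torus_test_borel[OF \<tau>(1)] torus_test_borel[OF torus_test_mult[OF \<sigma>(1) \<tau>(1)]]
  note si = set_integrable_cell_bounded[OF _ torus_test_indicator_diff]
  have i: "set_integrable lborel cell (\<lambda>x. \<bar>\<sigma> x - indicator A x\<bar>)" "set_integrable lborel cell (\<lambda>x. \<bar>\<tau> x - indicator B x\<bar>)"
    "set_integrable lborel cell (\<lambda>x. \<bar>\<sigma> x * \<tau> x - indicator (A \<inter> B) x\<bar>)"
    by (rule si[OF _ \<sigma>(1)], measurable) (rule si[OF _ \<tau>(1)], measurable, rule si[OF _ torus_test_mult[OF \<sigma>(1) \<tau>(1)]], measurable)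
  have "\<bar>\<sigma> x * \<tau> x - indicator (A \<inter> B) x\<bar> \<le> \<bar>\<sigma> x - indicator A x\<bar> + \<bar>\<tau> x - indicator B x\<bar>" for x
  proof -
    have r: "0 \<le> \<sigma> x" "\<sigma> x \<le> 1" "0 \<le> \<tau> x" "\<tau> x \<le> 1" using \<sigma> \<tau> by (auto simp: torus_test_def)
    have "\<sigma> x * \<tau> x - indicator (A \<inter> B) x = (\<sigma> x - indicator A x) * \<tau> x + indicator A x * (\<tau> x - indicator B x)"
      by (simp add: indicator_inter_arith algebra_simps)
    also have "\<bar>\<dots>\<bar> \<le> \<bar>\<sigma> x - indicator A x\<bar> * \<bar>\<tau> x\<bar> + \<bar>indicator A x\<bar> * \<bar>\<tau> x - indicator B x\<bar>"
      by (metis abs_mult abs_triangle_ineq)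
    also have "\<dots> \<le> \<bar>\<sigma> x - indicator A x\<bar> * 1 + 1 * \<bar>\<tau> x - indicator B x\<bar>"
      using r by (intro add_mono mult_mono) (auto simp: indicator_def)
    finally show ?thesis by simp
  qed
  then have "(LINT x:cell|lborel. \<bar>\<sigma> x * \<tau> x - indicator (A \<inter> B) x\<bar>)
      \<le> (LINT x:cell|lborel. \<bar>\<sigma> x - indicator A x\<bar> + \<bar>\<tau> x - indicator B x\<bar>)"
    by (intro set_integral_mono i set_integral_add(1)) auto
  also have "\<dots> \<le> e" using \<sigma>(2) \<tau>(2) i by (simp add: set_integral_add)
  finally show "\<exists>\<sigma>. torus_test \<sigma> \<and> (LINT x:cell|lborel. \<bar>\<sigma> x - indicator (A \<inter> B) x\<bar>) \<le> e"
    using torus_test_mult[OF \<sigma>(1) \<tau>(1)] by (intro exI[of _ "\<lambda>x. \<sigma> x * \<tau> x"]) auto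
qed

lemma torus_approx_limit:
  assumes B: "\<And>n. torus_approx (B n)" and A[measurable]: "A \<in> sets borel"
    and lim: "\<And>x. (\<lambda>n. indicator (B n) x :: real) \<longlonglongrightarrow> indicator A x"
  shows "torus_approx A"
  unfolding torus_approx_def
proof (intro conjI A allI impI)
  have [measurable]: "B n \<in> sets borel" for n using B by (auto simp: torus_approx_def)
  fix e :: real assume "0 < e"
  have "(\<lambda>n. LINT x:cell|lborel. \<bar>indicator (B n) x - indicator A x\<bar> :: real) \<longlonglongrightarrow> 0"
  proof (rule cell_integral_tendsto_0)
    show "AE x in lborel. x \<in> cell \<longrightarrow> (\<lambda>n. \<bar>indicator (B n) x - indicator A x\<bar> :: real) \<longlonglongrightarrow> 0"
      using lim by (intro AE_I2 impI tendsto_rabs_zero LIM_zero)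
  qed (auto simp: indicator_def)
  from order_tendstoD(2)[OF this, of "e/2"] \<open>0 < e\<close> 
  obtain n where n: "(LINT x:cell|lborel. \<bar>indicator (B n) x - indicator A x\<bar> :: real) < e/2"
    by (auto simp: eventually_sequentially)
  obtain \<sigma> where \<sigma>: "torus_test \<sigma>" "(LINT x:cell|lborel. \<bar>\<sigma> x - indicator (B n) x\<bar>) \<le> e/2"
    using B[of n] \<open>0 < e\<close> unfolding torus_approx_def by (meson half_gt_zero)
  note [measurable] = torus_test_borel[OF \<sigma>(1)]
  have i: "set_integrable lborel cell (\<lambda>x. \<bar>\<sigma> x - indicator A x\<bar>)" "set_integrable lborel cell (\<lambda>x. \<bar>\<sigma> x - indicator (B n) x\<bar>)"
    "set_integrable lborel cell (\<lambda>x. \<bar>indicator (B n) x - indicator A x\<bar> :: real)"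
    by (rule set_integrable_cell_bounded[OF _ torus_test_indicator_diff[OF \<sigma>(1)]], measurable)+
       (rule set_integrable_cell_bounded[where K=1], measurable, simp add: indicator_def)
  have "(LINT x:cell|lborel. \<bar>\<sigma> x - indicator A x\<bar>)
      \<le> (LINT x:cell|lborel. \<bar>\<sigma> x - indicator (B n) x\<bar> + \<bar>indicator (B n) x - indicator A x\<bar>)"
    by (intro set_integral_mono i set_integral_add(1)) auto
  also have "\<dots> \<le> e" using \<sigma>(2) n i by (simp add: set_integral_add)
  finally show "\<exists>\<sigma>. torus_test \<sigma> \<and> (LINT x:cell|lborel. \<bar>\<sigma> x - indicator A x\<bar>) \<le> e"
    using \<sigma>(1) by blast
qed

lemma torus_approx_empty: "torus_approx {}"
  by (rule torus_approx_seq[where \<sigma>="\<lambda>_ _. 0"]) (auto simp: torus_test_const)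

lemma torus_approx_Union:
  fixes A :: "nat \<Rightarrow> (real^3) set"
  assumes A: "\<And>i. torus_approx (A i)"
  shows "torus_approx (\<Union>i. A i)"
proof (rule torus_approx_limit)
  show "torus_approx (\<Union>i<n. A i)" for n
  proof (induction n)
    case 0
    then show ?case by (simp add: torus_approx_empty)
  next
    case (Suc n)
    have "(\<Union>i<Suc n. A i) = UNIV - ((UNIV - (\<Union>i<n. A i)) \<inter> (UNIV - A n))"
      by (auto simp: less_Suc_eq)
    then show ?case using Suc A by (simp add: torus_approx_compl torus_approx_Int)
  qed
  show "(\<Union>i. A i) \<in> sets borel" using A by (auto simp: torus_approx_def)
  show "(\<lambda>n. indicator (\<Union>i<n. A i) x :: real) \<longlonglongrightarrow> indicator (\<Union>i. A i) x" for x
    by (rule LIMSEQ_indicator_UN)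
qed

lemma Ck_real_1I:
  assumes "\<And>x. (f has_real_derivative f' x) (at x)" "continuous_on UNIV f'"
  shows "Ck_real 1 f"
  using assms by auto

text \<open>
  On the torus the halfspace becomes the band \<open>0 < s < a\<close> in the coordinate \<open>s\<close>; the 1-periodic
  function \<open>sin (pi * s) * sin (pi * (a - s))\<close> is positive inside and negative outside of it.
\<close>

lemma torus_approx_halfspace:
  "torus_approx {x. x $ k < a}"
proof -
  have [measurable]: "{x::real^3. x $ k < a} \<in> sets borel" by measurable
  \<comment> \<open>For a outside the open unit interval the halfspace contains none or all of the
    cell, and a constant test function is exact.\<close>
  consider "a \<le> 0" | "1 \<le> a" | "0 < a" "a < 1" by linarith
  then show ?thesis
  proof cases
    case 1
    then have "indicator {x. x $ k < a} x = (0::real)" if "x \<in> cell" for x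
      using that by (auto simp: indicator_def cell_def) (meson leD less_le_trans)
    then show ?thesis
      by (intro torus_approx_seq[where \<sigma>="\<lambda>_ _. 0"] AE_I2) (auto simp: torus_test_const)
  next
    case 2
    then have "indicator {x. x $ k < a} x = (1::real)" if "x \<in> cell" for x
      using that by (auto simp: indicator_def cell_def) (meson less_le_trans)
    then show ?thesis
      by (intro torus_approx_seq[where \<sigma>="\<lambda>_ _. 1"] AE_I2) (auto simp: torus_test_const)
  next
    case 3
    define h where "h s = sin (pi * s) * sin (pi * (a - s))" for s
    define h' where "h' s = cos (pi * s) * pi * sin (pi * (a - s)) + cos (pi * (a - s)) * (- pi) * sin (pi * s)" for s
    have dh: "(h has_real_derivative h' s) (at s)" for s
      unfolding h_def[abs_def] h'_def by (auto intro!: derivative_eq_intros)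
    have hc: "continuous_on UNIV h" "continuous_on UNIV h'" 
      unfolding h_def[abs_def] h'_def[abs_def] by (auto intro!: continuous_intros)
    \<comment> \<open>Each sine changes sign when s increases by 1, so the product has period 1
      although the factors do not.\<close>
    have hp: "h (s + 1) = h s" for s
    proof -
      have "pi * (s + 1) = pi * s + pi" "pi * (a - (s + 1)) = pi * (a - s) - pi" by (auto simp: algebra_simps)
      then show ?thesis by (simp add: h_def sin_diff)
    qed
    \<comment> \<open>A smooth sigmoid applied to n h: it stays between 0 and 1 and tends to 1 where
      h is positive and to 0 where h is negative.\<close>
    define \<phi> where "\<phi> n s = 1/2 + arctan (real n * h s) / pi" for n s
    have "Ck_real 1 (\<phi> n)" for n
    proof (rule Ck_real_1I)
      show "(\<phi> n has_real_derivative (inverse (1 + (real n * h s)\<^sup>2) * (real n * h' s)) / pi) (at s)" for s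
        unfolding \<phi>_def[abs_def]
        using DERIV_add[OF DERIV_const DERIV_cdivide[OF DERIV_chain2[OF DERIV_arctan DERIV_cmult[OF dh]]], 
            of "1/2" "real n" pi s] by simp
      have "1 + (real n * h s)\<^sup>2 \<noteq> 0" for s by (metis add_nonneg_eq_0_iff zero_le_one zero_le_power2 zero_neq_one)
      then show "continuous_on UNIV (\<lambda>s. (inverse (1 + (real n * h s)\<^sup>2) * (real n * h' s)) / pi)"
        by (intro continuous_on_divide continuous_on_mult continuous_on_inverse continuous_on_add 
            continuous_on_power continuous_on_const hc ballI) auto
    qed
    then have c: "C_k 1 (\<lambda>x. \<phi> n (x $ k))" for n by (rule C_k_coordinate)
    have "0 \<le> \<phi> n s" "\<phi> n s \<le> 1" for n s
      using arctan_bounded[of "real n * h s"] pi_gt_zero unfolding \<phi>_def by (auto simp: field_simps)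
    moreover have "periodic (\<lambda>x. \<phi> n (x $ k))" for n
      by (auto simp: periodic_def axis_def \<phi>_def hp)
    ultimately have test: "torus_test (\<lambda>x. \<phi> n (x $ k))" for n
      using c by (auto simp: torus_test_def)
    show ?thesis
    proof (rule torus_approx_seq[where \<sigma>="\<lambda>n x. \<phi> n (x $ k)"])
      \<comment> \<open>On s = 0 and s = a the function h vanishes and the sequence stays at 1/2, so
        these two hyperplanes are discarded as null sets.\<close>
      have hyp: "AE x in lborel. x $ k \<noteq> c" for c :: real
      proof -
        have "negligible {x::real^3. x $ k = c}" 
          using negligible_standard_hyperplane[of "axis k 1 :: real^3" c] by (simp add: inner_axis)
        then have "AE x in lebesgue. x \<notin> {x::real^3. x $ k = c}"
          by (intro AE_not_in) (simp add: negligible_iff_null_sets)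
        then show ?thesis by (simp add: AE_completion_iff)
      qed
      show "AE x in lborel. x \<in> cell \<longrightarrow> (\<lambda>n. \<phi> n (x $ k)) \<longlonglongrightarrow> indicator {x. x $ k < a} x"
        using hyp[of 0] hyp[of a]
      proof eventually_elim
        case (elim x)
        show ?case
        proof
          assume "x \<in> cell"
          define s where "s = x $ k"
          have s: "0 < s" "s < 1" "s \<noteq> a" using elim \<open>x \<in> cell\<close> by (auto simp: s_def cell_def less_le)
          have sp: "sin (pi * s) > 0" using s by (intro sin_gt_zero) auto
          have at: "filterlim (\<lambda>n. real n * \<bar>h s\<bar>) at_top sequentially" if "h s \<noteq> 0"
            using that by (intro filterlim_tendsto_pos_mult_at_top[OF tendsto_const] 
              filterlim_at_top_mult_tendsto_pos[OF tendsto_const] filterlim_real_sequentially) auto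
          have lim: "(\<lambda>n. arctan (real n * \<bar>h s\<bar>)) \<longlonglongrightarrow> pi / 2" if "h s \<noteq> 0"
            using filterlim_compose[OF tendsto_arctan_at_top at[OF that]] .
          show "(\<lambda>n. \<phi> n (x $ k)) \<longlonglongrightarrow> indicator {x. x $ k < a} x"
          proof (cases "s < a")
            case True
            have "sin (pi * (a - s)) > 0" using True s 3 by (intro sin_gt_zero) auto
            then have "h s > 0" using sp by (simp add: h_def)
            then have "(\<lambda>n. 1/2 + arctan (real n * h s) / pi) \<longlonglongrightarrow> 1/2 + (pi/2) / pi"
              using lim by (intro tendsto_intros) auto
            then show ?thesis using True by (simp add: \<phi>_def s_def)
          next
            case False
            have "sin (pi * (s - a)) > 0" using False s 3 by (intro sin_gt_zero) auto
            moreover have "sin (pi * (a - s)) = - sin (pi * (s - a))"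
              by (metis minus_diff_eq mult_minus_right sin_minus)
            ultimately have neg: "h s < 0" using sp by (simp add: h_def)
            then have "(\<lambda>n. 1/2 + - arctan (real n * \<bar>h s\<bar>) / pi) \<longlonglongrightarrow> 1/2 + - (pi/2) / pi"
              using lim by (intro tendsto_intros) auto
            then show ?thesis using False neg by (simp add: \<phi>_def s_def flip: arctan_minus)
          qed
        qed
      qed
    qed (auto intro: test)
  qed
qed

text \<open>The sets approximable in L1 by test functions form a sigma-algebra: complements
  correspond to 1 - \<sigma>, intersections to products, countable unions to limits. It contains the
  halfspaces, which generate the Borel sets.\<close>

lemma torus_approx_borel:
  assumes "A \<in> sets borel"
  shows "torus_approx A"
proof -
  have "A \<in> sigma_sets UNIV ((\<lambda>(a, i). {x::real^3. x \<bullet> i < a}) ` (UNIV \<times> Basis))"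
    using assms by (subst (asm) borel_eq_halfspace_less) simp
  then show ?thesis
  proof (induction rule: sigma_sets.induct)
    case (Basic b)
    then obtain a k where "b = {x. x $ k < a}"
      by (auto simp: Basis_vec_def inner_axis)
    then show ?case by (simp add: torus_approx_halfspace)
  qed (auto intro: torus_approx_empty torus_approx_compl torus_approx_Union)
qed

section \<open>Translation differences bounded by the total variation\<close>

lemma partial_uminus:
  fixes f :: "real^3 \<Rightarrow> real"
  assumes "C_k 1 f"
  shows "partial k (\<lambda>x. - f x) = (\<lambda>x. - partial k f x)"
proof -
  have d: "(f has_derivative frechet_derivative f (at x)) (at x)" for x
    using assms by (auto simp: frechet_derivative_works)
  show ?thesis
    unfolding partial_def frechet_derivative_at[OF has_derivative_minus[OF d], symmetric] by simp
qed

lemma C_k_1_uminus: "C_k 1 f \<Longrightarrow> C_k 1 (\<lambda>x. - f x :: real)"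
  using C_k_1_diff[OF C_k_const[of 1 0], of f] by simp

lemma nn_integral_cell_eq:
  fixes h :: "real^3 \<Rightarrow> real"
  assumes [measurable]: "h \<in> borel_measurable borel" and "\<And>x. 0 \<le> h x" "\<And>x. h x \<le> K"
  shows "(\<integral>\<^sup>+x\<in>cell. ennreal (h x) \<partial>lborel) = ennreal (LINT x:cell|lborel. h x)"
proof -
  have i: "integrable lborel (\<lambda>x. indicator cell x *\<^sub>R h x)"
    using set_integrable_cell_bounded[of h K] assms by (simp add: set_integrable_def)
  have "(\<integral>\<^sup>+x\<in>cell. ennreal (h x) \<partial>lborel) = (\<integral>\<^sup>+x. ennreal (indicator cell x *\<^sub>R h x) \<partial>lborel)"
    by (intro nn_integral_cong) (auto simp: indicator_def)
  also have "\<dots> = ennreal (LINT x:cell|lborel. h x)"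
    unfolding set_lebesgue_integral_def
    by (rule nn_integral_eq_integral[OF i]) (use assms in auto)
  finally show ?thesis .
qed

lemma scaleR_axis_one: "s *\<^sub>R (axis k 1 :: real^'n) = axis k s"
  by (auto simp: vec_eq_iff axis_def)

lemma has_derivative_along_axis:
  fixes \<phi> :: "real^3 \<Rightarrow> real"
  assumes "C_k 1 \<phi>"
  shows "((\<lambda>s. \<phi> (x - axis k s)) has_real_derivative - partial k \<phi> (x - axis k s)) (at s)"
proof -
  have d: "(\<phi> has_derivative frechet_derivative \<phi> (at y)) (at y)" for y
    using assms by (auto simp: frechet_derivative_works)
  then have lin: "linear (frechet_derivative \<phi> (at y))" for y
    using has_derivative_linear by blast
  have "((\<lambda>s. x - s *\<^sub>R (axis k 1 :: real^3)) has_derivative (\<lambda>h. - (h *\<^sub>R axis k 1))) (at s)"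
    by (auto intro!: derivative_eq_intros)
  from has_derivative_compose[OF this d]
  have "((\<lambda>s. \<phi> (x - axis k s)) has_derivative (\<lambda>h. frechet_derivative \<phi> (at (x - axis k s)) (- axis k h))) (at s)"
    unfolding scaleR_axis_one .
  moreover have "frechet_derivative \<phi> (at y) (- axis k h) = - partial k \<phi> y * h" for y h
    using linear_scale[OF lin, of y h "axis k 1"] linear_neg[OF lin, of y "axis k h"]
    by (simp add: partial_def scaleR_axis_one)
  ultimately show ?thesis by (simp only: has_field_derivative_def)
qed

text \<open>The translation is moved from \<open>f\<close> onto \<phi>, and the increment of \<phi>
  is written as an integral of its derivative along the axis. Fubini then gives an integral over s
  in [0, t] of pairings of \<open>f\<close> with derivatives of translates of - \<phi>. These
  translates are again admissible, so each pairing is at most \<open>T\<close>.\<close>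

lemma shift_pairing_le_variation:
  fixes f \<phi> :: "real^3 \<Rightarrow> real"
  assumes f[measurable]: "f \<in> borel_measurable borel" and per: "ae_per f" and bf: "\<And>x. \<bar>f x\<bar> \<le> K"
    and T: "\<And>\<phi>. C_k 1 \<phi> \<Longrightarrow> periodic \<phi> \<Longrightarrow> (\<And>x. \<bar>\<phi> x\<bar> \<le> 1) \<Longrightarrow>
       (LINT x:cell|lborel. f x * partial k \<phi> x) \<le> T"
    and \<phi>: "C_k 1 \<phi>" "periodic \<phi>" "\<And>x. \<bar>\<phi> x\<bar> \<le> 1" and t: "0 \<le> t"
  shows "(LINT x:cell|lborel. (f (x + axis k t) - f x) * \<phi> x) \<le> t * T"
proof -
  have [measurable]: "\<phi> \<in> borel_measurable borel"
    by (intro borel_measurable_continuous_onI C_k_imp_continuous[OF \<phi>(1)])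
  have pc: "continuous_on UNIV (partial k \<phi>)" by (rule continuous_partial[OF \<phi>(1)])
  then have [measurable]: "partial k \<phi> \<in> borel_measurable borel"
    by (rule borel_measurable_continuous_onI)
  have K: "0 \<le> K" using bf[of 0] by linarith
  have fb: "\<bar>f x * \<phi> y\<bar> \<le> K" for x y
    unfolding abs_mult using mult_mono[OF bf[of x] \<phi>(3)[of y]] K by simp
  have ax[measurable]: "(\<lambda>s. axis k s :: real^3) \<in> borel_measurable borel"
  proof -
    have "(\<lambda>s. s *\<^sub>R axis k 1 :: real^3) \<in> borel_measurable borel" by measurable
    then show ?thesis unfolding scaleR_axis_one .
  qed
  \<comment> \<open>\<open>C\<close> contains every point \<open>x - axis k s\<close> with x in the
    cell and s in [0, t]. The derivative is bounded on it, so \<open>H\<close> is bounded with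
    support of finite measure, which gives the integrability behind Fubini.\<close>
  define C where "C = cbox (\<chi> i. - t) (\<chi> i. 1) \<union> (cbox 0 1 :: (real^3) set)"
  have "bounded (partial k \<phi> ` C)"
    unfolding C_def by (intro compact_imp_bounded compact_continuous_image continuous_on_subset[OF pc] compact_Un compact_cbox) auto
  then obtain M where M: "\<And>x. x \<in> C \<Longrightarrow> \<bar>partial k \<phi> x\<bar> \<le> M" "0 < M" by (auto simp: bounded_pos)
  define H where "H x s = indicator cell x * (f x * (- partial k \<phi> (x - axis k s))) * indicator {0..t} s" for x s
  have Hb: "\<bar>H x s\<bar> \<le> K * M" for x s
  proof (cases "x \<in> cell \<and> s \<in> {0..t}")
    case True
    then have "x - axis k s \<in> C"
      by (auto simp: C_def cell_def mem_box_cart axis_def less_imp_le add_increasing algebra_simps)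
         (smt (verit))+
    then have "\<bar>f x\<bar> * \<bar>partial k \<phi> (x - axis k s)\<bar> \<le> K * M"
      by (intro mult_mono bf M K) auto
    then show ?thesis using True by (simp add: H_def abs_mult)
  next
    case False
    then have "H x s = 0" by (auto simp: H_def)
    then show ?thesis using K M(2) by simp
  qed
  have Hint: "integrable (lborel \<Otimes>\<^sub>M lborel) (case_prod H)"
  proof (rule integrableI_bounded_set[where A="cell \<times> {0..t}" and B="K * M"])
    show "cell \<times> {0..t} \<in> sets (lborel \<Otimes>\<^sub>M lborel)" by (intro pair_measureI) auto
    show "case_prod H \<in> borel_measurable (lborel \<Otimes>\<^sub>M lborel)"
      unfolding H_def by measurable
    have "emeasure (lborel \<Otimes>\<^sub>M lborel) (cell \<times> {0..t}) = emeasure lborel cell * emeasure lborel {0..t}"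
      by (rule lborel.emeasure_pair_measure_Times) auto
    then show "emeasure (lborel \<Otimes>\<^sub>M lborel) (cell \<times> {0..t}) < \<infinity>"
      using t by (simp add: emeasure_cell)
    show "AE x in lborel \<Otimes>\<^sub>M lborel. x \<in> cell \<times> {0..t} \<longrightarrow> norm (case x of (x, s) \<Rightarrow> H x s) \<le> K * M"
      using Hb by auto
    show "AE x in lborel \<Otimes>\<^sub>M lborel. x \<notin> cell \<times> {0..t} \<longrightarrow> (case x of (x, s) \<Rightarrow> H x s) = 0"
      by (auto simp: H_def indicator_def)
  qed
  have inner1: "(\<integral>s. H x s \<partial>lborel) = indicator cell x *\<^sub>R (f x * (\<phi> (x - axis k t) - \<phi> x))" for x
  proof -
    have ftc: "(\<integral>s. (- partial k \<phi> (x - axis k s)) * indicator {0..t} s \<partial>lborel) = \<phi> (x - axis k t) - \<phi> (x - axis k 0)"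
    proof (rule integral_FTC_Icc_real[OF t])
      show "((\<lambda>s. \<phi> (x - axis k s)) has_real_derivative - partial k \<phi> (x - axis k s)) (at s)" for s
        by (rule has_derivative_along_axis[OF \<phi>(1)])
      have "isCont (partial k \<phi>) y" for y using pc by (simp add: continuous_on_eq_continuous_at)
      moreover have "isCont (\<lambda>s. x - axis k s) s" for s
      proof -
        have "isCont (\<lambda>s. x - s *\<^sub>R (axis k 1 :: real^3)) s" by (intro continuous_intros)
        then show ?thesis unfolding scaleR_axis_one .
      qed
      ultimately show "isCont (\<lambda>s. - partial k \<phi> (x - axis k s)) s" for s
        using isCont_o2[of s "\<lambda>s. x - axis k s" "partial k \<phi>"] by (auto intro!: continuous_intros)
    qed
    have axis0: "axis k 0 = (0::real^3)" by (simp add: vec_eq_iff axis_def)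
    have "(\<integral>s. H x s \<partial>lborel) = (\<integral>s. (indicator cell x * f x) * ((- partial k \<phi> (x - axis k s)) * indicator {0..t} s) \<partial>lborel)"
      by (intro Bochner_Integration.integral_cong) (auto simp: H_def)
    then have "(\<integral>s. H x s \<partial>lborel) = (indicator cell x * f x) * (\<phi> (x - axis k t) - \<phi> (x - axis k 0))"
      unfolding integral_mult_right_zero ftc .
    then show ?thesis unfolding axis0 by simp
  qed
  have inner2: "(\<integral>x. H x s \<partial>lborel) \<le> indicator {0..t} s * T" for s
  proof -
    \<comment> \<open>The minus sign absorbs the one produced by differentiating along - s.\<close>
    define \<psi> where "\<psi> x = - \<phi> (x + - axis k s)" for x
    have c\<phi>: "C_k 1 (\<lambda>x. \<phi> (x + - axis k s))" by (rule C_k_shift[OF \<phi>(1)])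
    have \<psi>: "partial k \<psi> = (\<lambda>x. - partial k \<phi> (x + - axis k s))"
      unfolding \<psi>_def[abs_def] partial_uminus[OF c\<phi>] partial_shift ..
    have pp: "periodic \<psi>"
    proof -
      have "\<phi> (x + axis i 1 - axis k s) = \<phi> (x - axis k s)" for x i
        using \<phi>(2)[unfolded periodic_def, rule_format, of "x - axis k s" i] by (simp add: algebra_simps)
      then show ?thesis by (simp add: periodic_def \<psi>_def)
    qed
    have "(LINT x:cell|lborel. f x * partial k \<psi> x) \<le> T"
    proof (rule T[OF _ pp])
      show "C_k 1 \<psi>" unfolding \<psi>_def[abs_def] by (rule C_k_1_uminus[OF c\<phi>])
      show "\<bar>\<psi> x\<bar> \<le> 1" for x using \<phi>(3) by (simp add: \<psi>_def)
    qed
    moreover have "(\<integral>x. H x s \<partial>lborel) = indicator {0..t} s * (LINT x:cell|lborel. f x * partial k \<psi> x)"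
      unfolding set_lebesgue_integral_def \<psi> integral_mult_right_zero[symmetric]
      by (intro Bochner_Integration.integral_cong) (auto simp: H_def)
    ultimately show ?thesis by (auto simp: indicator_def)
  qed
  have sh: "(LINT x:cell|lborel. f (x + axis k t) * \<phi> x) = (LINT x:cell|lborel. f x * \<phi> (x - axis k t))"
  proof -
    have "(LINT x:cell|lborel. (\<lambda>y. f y * \<phi> (y + - axis k t)) (x + axis k t)) = (LINT x:cell|lborel. f x * \<phi> (x + - axis k t))"
      by (rule integral_cell_shift[where K=K])
        (measurable, rule ae_per_comp2[OF per ae_per_shift[OF ae_per_of_periodic[OF \<phi>(2)]]], rule fb)
    then show ?thesis by simp
  qed
  have i: "set_integrable lborel cell (\<lambda>x. f (x + axis k t) * \<phi> x)" "set_integrable lborel cell (\<lambda>x. f x * \<phi> x)"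
    "set_integrable lborel cell (\<lambda>x. f x * \<phi> (x - axis k t))"
    by (rule set_integrable_cell_bounded[where K=K], measurable, rule fb)+
  have "(LINT x:cell|lborel. (f (x + axis k t) - f x) * \<phi> x)
     = (LINT x:cell|lborel. f (x + axis k t) * \<phi> x) - (LINT x:cell|lborel. f x * \<phi> x)"
    unfolding left_diff_distrib using i by (simp add: set_integral_diff)
  also have "\<dots> = (LINT x:cell|lborel. f x * \<phi> (x - axis k t)) - (LINT x:cell|lborel. f x * \<phi> x)"
    unfolding sh ..
  also have "\<dots> = (LINT x:cell|lborel. f x * (\<phi> (x - axis k t) - \<phi> x))"
    unfolding right_diff_distrib using i by (simp add: set_integral_diff)
  also have "\<dots> = (\<integral>x. (\<integral>s. H x s \<partial>lborel) \<partial>lborel)"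
    unfolding inner1 set_lebesgue_integral_def ..
  also have "\<dots> = (\<integral>s. (\<integral>x. H x s \<partial>lborel) \<partial>lborel)"
    by (rule lborel_pair.Fubini_integral[OF Hint, symmetric])
  also have "\<dots> \<le> (\<integral>s. indicator {0..t} s * T \<partial>lborel)"
  proof (rule integral_mono)
    show "integrable lborel (\<lambda>s. \<integral>x. H x s \<partial>lborel)"
      by (rule lborel_pair.integrable_snd[OF Hint])
    show "integrable lborel (\<lambda>s. indicator {0..t} s * T)"
      using t by (intro integrable_mult_left) simp
  qed (rule inner2)
  also have "\<dots> = t * T" using t by simp
  finally show ?thesis .
qed

text \<open>The sign of the increment \<open>F\<close> would be the optimal test function, but it is
  not C1. It is replaced by \<sigma> - \<tau>, with \<sigma> and \<tau> close in L1 to the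
  indicators of F > 0 and F < 0; since \<open>F\<close> is bounded, the error in the pairing is
  small.\<close>

lemma shift_diff_le_variation:
  fixes f :: "real^3 \<Rightarrow> real"
  assumes f[measurable]: "f \<in> borel_measurable borel" and per: "ae_per f" and bf: "\<And>x. \<bar>f x\<bar> \<le> K"
    and T: "\<And>\<phi>. C_k 1 \<phi> \<Longrightarrow> periodic \<phi> \<Longrightarrow> (\<And>x. \<bar>\<phi> x\<bar> \<le> 1) \<Longrightarrow>
       (LINT x:cell|lborel. f x * partial k \<phi> x) \<le> T"
    and t: "0 \<le> t"
  shows "shift_diff f (axis k t) \<le> ennreal (t * T)"
proof -
  define F where "F x = f (x + axis k t) - f x" for x
  have [measurable]: "F \<in> borel_measurable borel" unfolding F_def by measurable
  have bF: "\<bar>F x\<bar> \<le> 2 * K" for x using bf[of x] bf[of "x + axis k t"] by (simp add: F_def)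
  have K: "0 \<le> K" using bf[of 0] by linarith
  have "(LINT x:cell|lborel. \<bar>F x\<bar>) \<le> t * T"
  proof (rule field_le_epsilon)
    fix e :: real assume "0 < e"
    \<comment> \<open>The two approximation errors cost at most 2 K (d + d) = 4 K d \<le> e; the
      summand 1 keeps the quotient meaningful when K = 0.\<close>
    define d where "d = e / (4 * (K + 1))"
    have d: "0 < d" using \<open>0 < e\<close> K by (simp add: d_def)
    have P: "{x. 0 < F x} \<in> sets borel" "{x. F x < 0} \<in> sets borel" by measurable
    obtain \<sigma> \<tau> where \<sigma>: "torus_test \<sigma>" "(LINT x:cell|lborel. \<bar>\<sigma> x - indicator {x. 0 < F x} x\<bar>) \<le> d"
      and \<tau>: "torus_test \<tau>" "(LINT x:cell|lborel. \<bar>\<tau> x - indicator {x. F x < 0} x\<bar>) \<le> d"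
      using torus_approx_borel[OF P(1)] torus_approx_borel[OF P(2)] d unfolding torus_approx_def by meson
    note [measurable] = torus_test_borel[OF \<sigma>(1)] torus_test_borel[OF \<tau>(1)]
    have r: "0 \<le> \<sigma> x" "\<sigma> x \<le> 1" "0 \<le> \<tau> x" "\<tau> x \<le> 1" for x using \<sigma> \<tau> by (auto simp: torus_test_def)
    have p1: "\<bar>\<sigma> x - \<tau> x\<bar> \<le> 1" for x using r[of x] by linarith
    have i: "set_integrable lborel cell (\<lambda>x. \<bar>\<sigma> x - indicator {x. 0 < F x} x\<bar>)"
      "set_integrable lborel cell (\<lambda>x. \<bar>\<tau> x - indicator {x. F x < 0} x\<bar>)"
      by (rule set_integrable_cell_bounded[OF _ torus_test_indicator_diff[OF \<sigma>(1)]], measurable)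
         (rule set_integrable_cell_bounded[OF _ torus_test_indicator_diff[OF \<tau>(1)]], measurable)
    have i2: "set_integrable lborel cell (\<lambda>x. F x * (\<sigma> x - \<tau> x))" "set_integrable lborel cell (\<lambda>x. \<bar>F x\<bar>)"
      by (rule set_integrable_cell_bounded[where K="2*K * 1"], measurable, unfold abs_mult, intro mult_mono bF p1)
         (use K in auto, rule set_integrable_cell_bounded[where K="2*K"], auto simp: bF)
    have "(LINT x:cell|lborel. \<bar>F x\<bar>) \<le> (LINT x:cell|lborel. F x * (\<sigma> x - \<tau> x)
        + 2 * K * (\<bar>\<sigma> x - indicator {x. 0 < F x} x\<bar> + \<bar>\<tau> x - indicator {x. F x < 0} x\<bar>))"
    proof (intro set_integral_mono i i2 set_integral_add(1) set_integrable_mult_right)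
      fix x
      define p where "p = \<sigma> x - indicator {x. 0 < F x} x"
      define q where "q = \<tau> x - indicator {x. F x < 0} x"
      have "\<bar>F x\<bar> = F x * (\<sigma> x - \<tau> x) - F x * p + F x * q"
        by (auto simp: p_def q_def indicator_def algebra_simps)
      also have "\<dots> \<le> F x * (\<sigma> x - \<tau> x) + \<bar>F x\<bar> * \<bar>p\<bar> + \<bar>F x\<bar> * \<bar>q\<bar>"
        using abs_ge_self[of "- (F x * p)"] abs_ge_self[of "F x * q"] by (simp add: abs_mult)
      also have "\<dots> \<le> F x * (\<sigma> x - \<tau> x) + 2 * K * \<bar>p\<bar> + 2 * K * \<bar>q\<bar>"
        using mult_right_mono[OF bF[of x], of "\<bar>p\<bar>"] mult_right_mono[OF bF[of x], of "\<bar>q\<bar>"] by simp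
      finally show "\<bar>F x\<bar> \<le> F x * (\<sigma> x - \<tau> x)
        + 2 * K * (\<bar>\<sigma> x - indicator {x. 0 < F x} x\<bar> + \<bar>\<tau> x - indicator {x. F x < 0} x\<bar>)"
        by (simp add: p_def q_def algebra_simps)
    qed
    also have "\<dots> = (LINT x:cell|lborel. F x * (\<sigma> x - \<tau> x)) + 2 * K * ((LINT x:cell|lborel. \<bar>\<sigma> x - indicator {x. 0 < F x} x\<bar>)
        + (LINT x:cell|lborel. \<bar>\<tau> x - indicator {x. F x < 0} x\<bar>))"
      using i i2 by (simp add: set_integral_add)
    also have "\<dots> \<le> t * T + 2 * K * (d + d)"
    proof (intro add_mono mult_left_mono \<sigma>(2) \<tau>(2))
      show "(LINT x:cell|lborel. F x * (\<sigma> x - \<tau> x)) \<le> t * T"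
        unfolding F_def
      proof (rule shift_pairing_le_variation[OF f per bf T _ _ p1 t])
        show "C_k 1 (\<lambda>x. \<sigma> x - \<tau> x)" using \<sigma> \<tau> C_k_1_diff unfolding torus_test_def by blast
        show "periodic (\<lambda>x. \<sigma> x - \<tau> x)" using \<sigma> \<tau> by (auto simp: torus_test_def periodic_def)
      qed
    qed (use K in auto)
    also have "2 * K * (d + d) \<le> e" using K \<open>0 < e\<close> by (simp add: d_def divide_simps)
    finally show "(LINT x:cell|lborel. \<bar>F x\<bar>) \<le> t * T + e" by simp
  qed
  moreover have "shift_diff f (axis k t) = ennreal (LINT x:cell|lborel. \<bar>F x\<bar>)"
    unfolding shift_diff_def F_def[symmetric] by (rule nn_integral_cell_eq[where K="2*K"]) (auto simp: bF)
  ultimately show ?thesis by (simp add: ennreal_leI)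
qed

section \<open>Iteration over scales\<close>

text \<open>What the iteration uses of \<open>chi\<close> and a competitor \<open>u\<close>:
  \<open>a j\<close> stands for the j-th diagonal entry and \<open>g j k\<close> for the entries of
  chi - u. No entry of a well exceeds 3 in absolute value. The factor 6 is the largest ratio of two
  diagonal entries of a difference of wells; the second well minus zero, with entries -1/2, 2/3, 3,
  attains it. The equation for row j appears as an inequality between absolute values, so that g may
  be treated with Tonelli alone.\<close>

locale coupled_fields =
  fixes a :: "3 \<Rightarrow> real^3 \<Rightarrow> real" and g :: "3 \<Rightarrow> 3 \<Rightarrow> real^3 \<Rightarrow> real" and G :: real
  assumes a_borel [measurable]: "\<And>i. a i \<in> borel_measurable borel"
    and a_per: "\<And>i. ae_per (a i)"
    and a_bound: "\<And>i x. \<bar>a i x\<bar> \<le> 3"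
    and a_compare: "\<And>i j x y. \<bar>a i x - a i y\<bar> \<le> 6 * \<bar>a j x - a j y\<bar>"
    and g_borel [measurable]: "\<And>j k. g j k \<in> borel_measurable borel"
    and g_per: "\<And>j k. ae_per (g j k)"
    and g_L1: "\<And>j k. (\<integral>\<^sup>+x\<in>cell. ennreal \<bar>g j k x\<bar> \<partial>lborel) \<le> ennreal G"
    and G_nonneg: "0 \<le> G"
    and weak: "\<And>j \<phi>. C_infinity \<phi> \<Longrightarrow> compact_support_in UNIV \<phi> \<Longrightarrow>
        ennreal \<bar>\<integral>y. a j y * partial j \<phi> y \<partial>lborel\<bar>
          \<le> (\<Sum>k\<in>UNIV. \<integral>\<^sup>+y. ennreal \<bar>partial k \<phi> y\<bar> * ennreal \<bar>g j k y\<bar> \<partial>lborel)"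

text \<open>Uniform in the entry and in the direction, so that the output of one step has the form
  of the input of the next. Nonnegative shifts are enough because the kernels and the cell lie in
  the nonnegative octant.\<close>

definition shifts_le :: "(3 \<Rightarrow> real^3 \<Rightarrow> real) \<Rightarrow> real \<Rightarrow> real \<Rightarrow> bool" where
  "shifts_le a r \<beta> \<longleftrightarrow> (\<forall>i k s. 0 \<le> s \<and> s \<le> r \<longrightarrow> shift_diff (a i) (axis k s) \<le> ennreal \<beta>)"

lemma shifts_le_mono: "shifts_le a r \<beta> \<Longrightarrow> \<beta> \<le> \<beta>' \<Longrightarrow> shifts_le a r \<beta>'"
  unfolding shifts_le_def by (meson ennreal_leI order_trans)

text \<open>This supplies the missing directions: a shift along axis k is estimated for
  \<open>a k\<close>, the only entry whose equation involves that direction, and then transferred to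
  every other entry.\<close>

lemma (in coupled_fields) shift_diff_compare: "shift_diff (a i) v \<le> 6 * shift_diff (a j) v"
proof -
  have "shift_diff (a i) v \<le> (\<integral>\<^sup>+x. 6 * (ennreal \<bar>a j (x + v) - a j x\<bar> * indicator cell x) \<partial>lborel)"
    unfolding shift_diff_def
  proof (rule nn_integral_mono)
    fix x
    have "ennreal \<bar>a i (x + v) - a i x\<bar> \<le> ennreal (6 * \<bar>a j (x + v) - a j x\<bar>)"
      by (intro ennreal_leI a_compare)
    then show "ennreal \<bar>a i (x + v) - a i x\<bar> * indicator cell x \<le> 6 * (ennreal \<bar>a j (x + v) - a j x\<bar> * indicator cell x)"
      by (simp add: indicator_def ennreal_mult)
  qed
  also have "\<dots> = 6 * shift_diff (a j) v"
    unfolding shift_diff_def by (rule nn_integral_cmult) measurable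
  finally show ?thesis .
qed

text \<open>The constant is fixed before the fields, so it depends neither on chi nor on \<epsilon>.
  Shifts of length at most r are covered by the hypothesis; longer ones along axis k are treated for
  entry k by mollification at scale r and passed on to the other entries.\<close>

lemma step_constant:
  obtains A where "0 < A"
    "\<And>a g G r t \<beta>. coupled_fields a g G \<Longrightarrow> 0 < r \<Longrightarrow> r \<le> t \<Longrightarrow> 0 \<le> \<beta> \<Longrightarrow> shifts_le a r \<beta>
      \<Longrightarrow> shifts_le a t (36 * \<beta> + A * (t / r) * G)"
proof -
  obtain c C :: real where cC: "0 < c" "0 < C" and moll: 
    "\<And>(r::real) t j. 0 < r \<Longrightarrow> r \<le> t \<Longrightarrow> \<exists>\<kappa> \<Phi>. continuous_on UNIV \<kappa> \<and> (\<forall>z. 0 \<le> \<kappa> z \<and> \<kappa> z \<le> 1)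
      \<and> (\<forall>z. \<kappa> z \<noteq> 0 \<longrightarrow> (\<forall>k. 0 \<le> z $ k \<and> z $ k \<le> r))
      \<and> ennreal (c * r ^ 3) \<le> (\<integral>\<^sup>+z. ennreal (\<kappa> z) \<partial>lborel)
      \<and> C_infinity \<Phi> \<and> compact_support_in UNIV \<Phi>
      \<and> (\<forall>y. partial j \<Phi> y = \<kappa> y - \<kappa> (y - axis j t))
      \<and> (\<forall>k. (\<integral>\<^sup>+z. ennreal \<bar>partial k \<Phi> z\<bar> \<partial>lborel) \<le> ennreal (C * r\<^sup>2 * t))"
    using mollifier_exists by blast
  \<comment> \<open>The bound 3 B G / m0 with B = C r^2 s and m0 = c r^3 equals 3 (C / c) (s / r) G.
    The comparison of entries multiplies it by 6, and turns the 6 in front of \<beta> into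
    36.\<close>
  define A where "A = 18 * C / c"
  have "shifts_le a t (36 * \<beta> + A * (t / r) * G)"
    if F: "coupled_fields a g G" and rt: "0 < r" "r \<le> t" and \<beta>: "0 \<le> \<beta>" "shifts_le a r \<beta>" for a g G r t \<beta>
    unfolding shifts_le_def
  proof (intro allI impI)
    interpret coupled_fields a g G by (rule F)
    fix i k s assume s: "0 \<le> s \<and> s \<le> t"
    have nn: "0 \<le> A * (t / r) * G" using cC rt G_nonneg by (simp add: A_def)
    have nn6: "0 \<le> (A / 6) * (t / r) * G" using cC rt G_nonneg by (simp add: A_def)
    show "shift_diff (a i) (axis k s) \<le> ennreal (36 * \<beta> + A * (t / r) * G)"
    proof (cases "s \<le> r")
      case True
      then have "shift_diff (a i) (axis k s) \<le> ennreal \<beta>" using \<beta>(2) s by (simp add: shifts_le_def)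
      also have "\<dots> \<le> ennreal (36 * \<beta> + A * (t / r) * G)" using \<beta>(1) nn by (intro ennreal_leI) linarith
      finally show ?thesis .
    next
      case False
      then have rs: "r \<le> s" by simp
      obtain \<kappa> \<Phi> where \<kappa>: "continuous_on UNIV \<kappa>" "\<And>z. 0 \<le> \<kappa> z" "\<And>z. \<kappa> z \<le> 1"
          "\<And>z k. \<kappa> z \<noteq> 0 \<Longrightarrow> 0 \<le> z $ k \<and> z $ k \<le> r"
          "ennreal (c * r ^ 3) \<le> (\<integral>\<^sup>+z. ennreal (\<kappa> z) \<partial>lborel)"
        and \<Phi>: "C_infinity \<Phi>" "compact_support_in UNIV \<Phi>"
          "\<And>y. partial k \<Phi> y = \<kappa> y - \<kappa> (y - axis k s)"
          "\<And>l. (\<integral>\<^sup>+z. ennreal \<bar>partial l \<Phi> z\<bar> \<partial>lborel) \<le> ennreal (C * r\<^sup>2 * s)"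
        using moll[OF rt(1) rs, of k] by blast
      have "shift_diff (a k) (axis k s) \<le> ennreal (6 * \<beta> + 3 * (C * r\<^sup>2 * s * G) / (c * r ^ 3))"
      proof (rule mollified_step[where K=3 and f="a k" and g="g k" and \<kappa>=\<kappa> and \<Phi>=\<Phi> and r=r])
        show "shift_diff (a k) (axis l q) \<le> ennreal \<beta>" if "0 \<le> q" "q \<le> r" for l q
          using \<beta>(2) that by (simp add: shifts_le_def)
      qed (use \<kappa> \<Phi> a_borel a_per a_bound g_borel g_per g_L1 G_nonneg weak \<beta>(1) cC rt rs in auto)
      moreover have "3 * (C * r\<^sup>2 * s * G) / (c * r ^ 3) = (A / 6) * (s / r) * G"
        using cC rt by (simp add: A_def field_simps power2_eq_square power3_eq_cube)
      moreover have "(A / 6) * (s / r) * G \<le> (A / 6) * (t / r) * G"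
        using s rt cC G_nonneg by (intro mult_right_mono mult_left_mono divide_right_mono) (auto simp: A_def)
      ultimately have "shift_diff (a k) (axis k s) \<le> ennreal (6 * \<beta> + (A / 6) * (t / r) * G)"
        by (smt (verit) ennreal_leI order_trans)
      then have "6 * shift_diff (a k) (axis k s) \<le> 6 * ennreal (6 * \<beta> + (A / 6) * (t / r) * G)"
        by (intro mult_left_mono) auto
      also have "\<dots> = ennreal (6 * (6 * \<beta> + (A / 6) * (t / r) * G))"
        by (subst ennreal_mult) (simp, rule add_nonneg_nonneg, use \<beta>(1) in simp, rule nn6, simp)
      also have "6 * (6 * \<beta> + (A / 6) * (t / r) * G) = 36 * \<beta> + A * (t / r) * G" by simp
      finally show ?thesis using shift_diff_compare[of i "axis k s" k] by (rule order_trans[rotated])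
    qed
  qed
  moreover have "0 < A" using cC by (simp add: A_def)
  ultimately show ?thesis using that by blast
qed

text \<open>Two successive scales always have ratio M, so every step adds the same error A M G.
  Including this error in the starting bound makes it no larger than the current bound, and 36 + 1 =
  37.\<close>

lemma shifts_le_iterate:
  assumes step: "\<And>r t \<beta>. 0 < r \<Longrightarrow> r \<le> t \<Longrightarrow> 0 \<le> \<beta> \<Longrightarrow> shifts_le a r \<beta>
      \<Longrightarrow> shifts_le a t (36 * \<beta> + A * (t / r) * G)"
    and "0 < r" "1 \<le> M" "0 \<le> \<beta>" "0 \<le> A" "0 \<le> G" "shifts_le a r \<beta>"
  shows "shifts_le a (M ^ n * r) (37 ^ n * (\<beta> + A * M * G))"
proof (induction n)
  case 0
  have "\<beta> \<le> \<beta> + A * M * G" using assms by simp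
  then show ?case using shifts_le_mono[OF assms(7)] by simp
next
  case (Suc n)
  let ?X = "\<beta> + A * M * G"
  have X: "0 \<le> ?X" "A * M * G \<le> ?X" using assms by auto
  have pos: "0 < M ^ n * r" using assms by simp
  have "shifts_le a (M ^ Suc n * r) (36 * (37 ^ n * ?X) + A * ((M ^ Suc n * r) / (M ^ n * r)) * G)"
    by (rule step[OF pos _ _ Suc.IH]) (use assms X in \<open>auto simp: mult_right_mono mult_le_cancel_right1\<close>)
  moreover have "(M ^ Suc n * r) / (M ^ n * r) = M" using assms by simp
  moreover have "?X \<le> 37 ^ n * ?X" using X(1) by (simp add: mult_le_cancel_right1)
  then have "36 * (37 ^ n * ?X) + A * M * G \<le> 36 * (37 ^ n * ?X) + 37 ^ n * ?X"
    using X(2) by (intro add_left_mono) linarith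
  moreover have "36 * (37 ^ n * ?X) + 37 ^ n * ?X = 37 ^ Suc n * ?X" by (simp add: algebra_simps)
  ultimately show ?case using shifts_le_mono by simp
qed

section \<open>From translation differences to the variance\<close>

text \<open>The deviation from the mean is an average of f(x) - f(y) over y in the cell. By
  periodicity y may be written as x + z with z in the cell, and Tonelli leaves an average of
  \<open>shift_diff f z\<close>.\<close>

lemma oscillation_le_shift_diff:
  fixes f :: "real^3 \<Rightarrow> real"
  assumes f[measurable]: "f \<in> borel_measurable borel" and per: "ae_per f" and bf: "\<And>x. \<bar>f x\<bar> \<le> K"
    and b: "\<And>v. v \<in> cell \<Longrightarrow> shift_diff f v \<le> ennreal \<beta>"
  shows "(\<integral>\<^sup>+x\<in>cell. ennreal \<bar>f x - (LINT y:cell|lborel. f y)\<bar> \<partial>lborel) \<le> ennreal \<beta>"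
proof -
  define \<mu> where "\<mu> = (LINT y:cell|lborel. f y)"
  have one: "(LINT y:cell|lborel. c) = c" for c :: real
    by (simp add: set_lebesgue_integral_def measure_def emeasure_cell)
  have i: "set_integrable lborel cell f" by (rule set_integrable_cell_bounded[OF f bf])
  have ic: "set_integrable lborel cell (\<lambda>_. c)" for c :: real
    by (rule set_integrable_cell_bounded[where K="\<bar>c\<bar>"]) auto
  have pw: "ennreal \<bar>f x - \<mu>\<bar> \<le> (\<integral>\<^sup>+z. indicator cell z * ennreal \<bar>f (x + z) - f x\<bar> \<partial>lborel)" for x
  proof -
    have "f x - \<mu> = (LINT y:cell|lborel. f x - f y)"
      unfolding \<mu>_def using i ic one by (simp add: set_integral_diff)
    then have "ennreal \<bar>f x - \<mu>\<bar> = ennreal (norm (\<integral>y. indicator cell y *\<^sub>R (f x - f y) \<partial>lborel))"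
      by (simp add: set_lebesgue_integral_def)
    also have "\<dots> \<le> (\<integral>\<^sup>+y. ennreal (norm (indicator cell y *\<^sub>R (f x - f y))) \<partial>lborel)"
      by (rule integral_norm_bound_ennreal)
        (use set_integral_diff(1)[OF ic[of "f x"] i] in \<open>simp add: set_integrable_def\<close>)
    also have "\<dots> = (\<integral>\<^sup>+y\<in>cell. ennreal \<bar>f y - f x\<bar> \<partial>lborel)"
      by (intro nn_integral_cong) (auto simp: indicator_def abs_minus_commute)
    also have "\<dots> = (\<integral>\<^sup>+z\<in>cell. (\<lambda>y. ennreal \<bar>f y - f x\<bar>) (z + x) \<partial>lborel)"
      by (rule nn_integral_cell_shift[symmetric]) (measurable, rule ae_per_comp[OF per])
    also have "\<dots> = (\<integral>\<^sup>+z. indicator cell z * ennreal \<bar>f (x + z) - f x\<bar> \<partial>lborel)"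
      by (simp add: add.commute mult.commute)
    finally show ?thesis .
  qed
  have "(\<integral>\<^sup>+x\<in>cell. ennreal \<bar>f x - \<mu>\<bar> \<partial>lborel)
      \<le> (\<integral>\<^sup>+x\<in>cell. (\<integral>\<^sup>+z. indicator cell z * ennreal \<bar>f (x + z) - f x\<bar> \<partial>lborel) \<partial>lborel)"
    by (intro nn_integral_mono mult_right_mono pw) auto
  also have "\<dots> = (\<integral>\<^sup>+z. indicator cell z * shift_diff f z \<partial>lborel)"
    unfolding shift_diff_def by (rule nn_integral_cell_swap) measurable
  also have "\<dots> \<le> (\<integral>\<^sup>+z. ennreal \<beta> * indicator cell z \<partial>lborel)"
    by (intro nn_integral_mono) (auto simp: indicator_def b)
  also have "\<dots> = ennreal \<beta>" by (simp add: nn_integral_cmult_indicator emeasure_cell)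
  finally show ?thesis unfolding \<mu>_def .
qed

text \<open>Entries and mean are bounded by 3, so a squared deviation is at most 36 and at most 6
  times the deviation. A vector of the cell is a sum of three axis shifts of length below 1 \<le> R,
  whence 18 = 6 * 3.\<close>

lemma (in coupled_fields) variance_le:
  assumes "shifts_le a R \<beta>" "1 \<le> R" "0 \<le> \<beta>"
  shows "(\<integral>\<^sup>+x\<in>cell. ennreal ((a i x - (LINT y:cell|lborel. a i y))\<^sup>2) \<partial>lborel) \<le> ennreal (min 36 (18 * \<beta>))"
proof -
  define \<mu> where "\<mu> = (LINT y:cell|lborel. a i y)"
  have one: "(LINT y:cell|lborel. c) = c" for c :: real
    by (simp add: set_lebesgue_integral_def measure_def emeasure_cell)
  have i: "set_integrable lborel cell (a i)" by (rule set_integrable_cell_bounded[OF a_borel a_bound])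
  have ic: "set_integrable lborel cell (\<lambda>_. c)" for c :: real
    by (rule set_integrable_cell_bounded[where K="\<bar>c\<bar>"]) auto
  have ab: "a i x \<le> 3" "- 3 \<le> a i x" for x using a_bound[of i x] by linarith+
  have "\<mu> \<le> (LINT y:cell|lborel. 3)" "(LINT y:cell|lborel. - 3) \<le> \<mu>"
    unfolding \<mu>_def by (intro set_integral_mono i ic ab)+
  then have \<mu>: "\<bar>\<mu>\<bar> \<le> 3" unfolding one by linarith
  have 6: "\<bar>a i x - \<mu>\<bar> \<le> 6" for x using a_bound[of i x] \<mu> by linarith
  have sq: "(a i x - \<mu>)\<^sup>2 \<le> 6 * \<bar>a i x - \<mu>\<bar>" for x
    using mult_right_mono[OF 6[of x], of "\<bar>a i x - \<mu>\<bar>"] by (simp add: power2_eq_square)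
  have "(\<integral>\<^sup>+x\<in>cell. ennreal ((a i x - \<mu>)\<^sup>2) \<partial>lborel) \<le> (\<integral>\<^sup>+x. ennreal 36 * indicator cell x \<partial>lborel)"
  proof (intro nn_integral_mono mult_right_mono ennreal_leI)
    show "(a i x - \<mu>)\<^sup>2 \<le> 36" for x using order_trans[OF sq[of x], of 36] 6[of x] by simp
  qed auto
  also have "\<dots> = ennreal 36" by (subst nn_integral_cmult_indicator) (simp_all add: emeasure_cell)
  finally have 1: "(\<integral>\<^sup>+x\<in>cell. ennreal ((a i x - \<mu>)\<^sup>2) \<partial>lborel) \<le> ennreal 36" .
  have "(\<integral>\<^sup>+x\<in>cell. ennreal ((a i x - \<mu>)\<^sup>2) \<partial>lborel) \<le> (\<integral>\<^sup>+x. 6 * (ennreal \<bar>a i x - \<mu>\<bar> * indicator cell x) \<partial>lborel)"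
  proof (rule nn_integral_mono)
    fix x
    show "ennreal ((a i x - \<mu>)\<^sup>2) * indicator cell x \<le> 6 * (ennreal \<bar>a i x - \<mu>\<bar> * indicator cell x)"
      using ennreal_leI[OF sq[of x]] by (simp add: indicator_def ennreal_mult)
  qed
  also have "\<dots> = 6 * (\<integral>\<^sup>+x\<in>cell. ennreal \<bar>a i x - \<mu>\<bar> \<partial>lborel)"
    by (rule nn_integral_cmult) measurable
  also have "\<dots> \<le> 6 * ennreal (3 * \<beta>)"
    unfolding \<mu>_def
  proof (intro mult_left_mono oscillation_le_shift_diff[where K=3] a_borel a_per a_bound)
    fix v :: "real^3" assume v: "v \<in> cell"
    show "shift_diff (a i) v \<le> ennreal (3 * \<beta>)"
    proof (intro shift_diff_le_axes a_borel a_per assms)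
      fix k
      have "0 \<le> v $ k" "v $ k \<le> R" using v assms(2) by (auto simp: cell_def intro: less_imp_le order_trans[of _ 1])
      then show "shift_diff (a i) (axis k (v $ k)) \<le> ennreal \<beta>" using assms(1) by (simp add: shifts_le_def)
    qed
  qed auto
  also have "\<dots> = ennreal (18 * \<beta>)" using assms(3) by (simp add: ennreal_mult)
  finally show ?thesis using 1 unfolding \<mu>_def by (simp add: min_def)
qed

lemma uniform_variance_bound:
  obtains C where "0 < C"
    "\<And>a g G T \<epsilon> i. coupled_fields a g G \<Longrightarrow> (\<And>i k s. 0 \<le> s \<Longrightarrow> shift_diff (a i) (axis k s) \<le> ennreal (s * T))
      \<Longrightarrow> 0 \<le> T \<Longrightarrow> 0 < \<epsilon> \<Longrightarrow> \<epsilon> < exp (-1)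
      \<Longrightarrow> (\<integral>\<^sup>+x\<in>cell. ennreal ((a i x - (LINT y:cell|lborel. a i y))\<^sup>2) \<partial>lborel)
        \<le> ennreal (min 36 (exp (C * sqrt \<bar>ln \<epsilon>\<bar>) * (\<epsilon> * T + G)))"
proof -
  obtain A where A: "0 < A" and step:
    "\<And>a g G r t \<beta>. coupled_fields a g G \<Longrightarrow> 0 < r \<Longrightarrow> r \<le> t \<Longrightarrow> 0 \<le> \<beta> \<Longrightarrow> shifts_le a r \<beta>
      \<Longrightarrow> shifts_le a t (36 * \<beta> + A * (t / r) * G)"
    using step_constant by blast
  \<comment> \<open>Exponents are measured in units of q = sqrt |ln \<epsilon>|:
    \<open>37 ^ n\<close> costs 12, \<open>M\<close> costs 1, and the factor 18 (1 + A) is absorbed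
    in an exponential because q \<ge> 1, which is what \<epsilon> < exp (-1) provides.\<close>
  define C where "C = 13 + 18 * (1 + A)"
  have "(\<integral>\<^sup>+x\<in>cell. ennreal ((a i x - (LINT y:cell|lborel. a i y))\<^sup>2) \<partial>lborel)
        \<le> ennreal (min 36 (exp (C * sqrt \<bar>ln \<epsilon>\<bar>) * (\<epsilon> * T + G)))"
    if F: "coupled_fields a g G" and T: "\<And>i k s. 0 \<le> s \<Longrightarrow> shift_diff (a i) (axis k s) \<le> ennreal (s * T)" "0 \<le> T"
      and \<epsilon>: "0 < \<epsilon>" "\<epsilon> < exp (-1)" for a g G T \<epsilon> i
  proof -
    interpret coupled_fields a g G by (rule F)
    define q where "q = sqrt \<bar>ln \<epsilon>\<bar>"
    have "ln \<epsilon> < -1" using \<epsilon> by (metis ln_exp ln_less_cancel_iff exp_gt_zero)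
    then have L: "1 \<le> \<bar>ln \<epsilon>\<bar>" "- \<bar>ln \<epsilon>\<bar> = ln \<epsilon>" by linarith+
    have q: "1 \<le> q" "\<epsilon> = exp (- q\<^sup>2)" using L \<epsilon>(1) by (simp_all add: q_def)
    \<comment> \<open>At least q steps of ratio exp q enlarge the scale by at least exp (q^2) =
      1/\<epsilon>. Rounding up ensures that scale 1 is reached.\<close>
    define n where "n = nat \<lceil>q\<rceil>"
    define M where "M = exp q"
    have n: "q \<le> real n" "real n \<le> q + 1" using q(1) unfolding n_def by linarith+
    have M: "1 \<le> M" using q(1) by (simp add: M_def)
    have "shifts_le a \<epsilon> (\<epsilon> * T)"
      unfolding shifts_le_def
    proof (intro allI impI)
      fix i k s assume s: "0 \<le> s \<and> s \<le> \<epsilon>"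
      then have "s * T \<le> \<epsilon> * T" using T(2) by (intro mult_right_mono) auto
      then show "shift_diff (a i) (axis k s) \<le> ennreal (\<epsilon> * T)"
        using T(1)[of s i k] s by (meson ennreal_leI order_trans)
    qed
    then have sl: "shifts_le a (M ^ n * \<epsilon>) (37 ^ n * (\<epsilon> * T + A * M * G))"
      by (rule shifts_le_iterate[OF step[OF F], rotated -1]) (use \<epsilon> M T(2) A G_nonneg in auto)
    have "1 \<le> M ^ n * \<epsilon>"
    proof -
      have "M ^ n * \<epsilon> = exp (real n * q - q\<^sup>2)"
        by (simp add: M_def q(2) exp_of_nat_mult[symmetric] exp_add[symmetric])
      moreover have "q\<^sup>2 \<le> real n * q" using n(1) q(1) by (simp add: power2_eq_square)
      ultimately show ?thesis by simp
    qed
    moreover have nn: "0 \<le> 37 ^ n * (\<epsilon> * T + A * M * G)"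
      using \<epsilon> M T(2) A G_nonneg by simp
    ultimately have "(\<integral>\<^sup>+x\<in>cell. ennreal ((a i x - (LINT y:cell|lborel. a i y))\<^sup>2) \<partial>lborel)
        \<le> ennreal (min 36 (18 * (37 ^ n * (\<epsilon> * T + A * M * G))))"
      by (intro variance_le[OF sl])
    moreover have "18 * (37 ^ n * (\<epsilon> * T + A * M * G)) \<le> exp (C * q) * (\<epsilon> * T + G)"
    proof -
      have "(2::real) \<le> exp 1" using exp_ge_add_one_self[of 1] by simp
      then have "(2::real) ^ 6 \<le> exp 1 ^ 6" by (intro power_mono) auto
      then have e6: "(37::real) \<le> exp 6" by (simp flip: exp_of_nat_mult)
      have "(37::real) ^ n \<le> exp 6 ^ n" by (intro power_mono e6) auto
      also have "\<dots> = exp (6 * real n)" by (simp flip: exp_of_nat_mult add: mult.commute)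
      \<comment> \<open>n \<le> q + 1 \<le> 2 q, using q \<ge> 1 once more.\<close>
      also have "\<dots> \<le> exp (12 * q)" using n q(1) by simp
      finally have p37: "(37::real) ^ n \<le> exp (12 * q)" .
      have "\<epsilon> * T + A * M * G \<le> ((1 + A) * M) * (\<epsilon> * T) + ((1 + A) * M) * G"
      proof (intro add_mono mult_right_mono)
        show "\<epsilon> * T \<le> (1 + A) * M * (\<epsilon> * T)"
          using mult_right_mono[of 1 "(1 + A) * M" "\<epsilon> * T"] mult_mono[of 1 "1 + A" 1 M] A M \<epsilon> T(2) by simp
      qed (use A M G_nonneg in auto)
      then have p: "\<epsilon> * T + A * M * G \<le> (1 + A) * M * (\<epsilon> * T + G)" by (simp add: algebra_simps)
      have "18 * (1 + A) \<le> exp (18 * (1 + A))" using exp_ge_add_one_self[of "18 * (1 + A)"] by simp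
      also have "\<dots> \<le> exp (18 * (1 + A) * q)" using A q(1) by (simp add: mult_le_cancel_left1)
      finally have pA: "18 * (1 + A) \<le> exp (18 * (1 + A) * q)" .
      have nn2: "0 \<le> \<epsilon> * T + G" using \<epsilon> T G_nonneg by simp
      have "18 * (37 ^ n * (\<epsilon> * T + A * M * G)) \<le> 18 * (exp (12 * q) * ((1 + A) * M * (\<epsilon> * T + G)))"
        by (intro mult_left_mono mult_mono p37 p) (use \<epsilon> T G_nonneg A M in auto)
      also have "\<dots> = (18 * (1 + A)) * (exp (12 * q) * exp q * (\<epsilon> * T + G))" by (simp add: M_def)
      also have "\<dots> \<le> exp (18 * (1 + A) * q) * (exp (12 * q) * exp q * (\<epsilon> * T + G))"
        by (intro mult_right_mono pA) (use nn2 in auto)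
      also have "\<dots> = exp (C * q) * (\<epsilon> * T + G)"
        by (simp add: C_def algebra_simps flip: exp_add)
      finally show ?thesis .
    qed
    then have "ennreal (min 36 (18 * (37 ^ n * (\<epsilon> * T + A * M * G)))) \<le> ennreal (min 36 (exp (C * q) * (\<epsilon> * T + G)))"
      by (intro ennreal_leI min.mono) auto
    ultimately show ?thesis unfolding q_def by (rule order_trans)
  qed
  moreover have "0 < C" using A by (simp add: C_def)
  ultimately show ?thesis using that by blast
qed

section \<open>Test fields, entries of the wells, and L1 against L2\<close>

lemma C_k_scaleR_const:
  fixes f :: "real^3 \<Rightarrow> real" and E :: "'b::real_normed_vector"
  assumes "C_k 1 f"
  shows "C_k 1 (\<lambda>x. f x *\<^sub>R E)" "partial k (\<lambda>x. f x *\<^sub>R E) = (\<lambda>x. partial k f x *\<^sub>R E)"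
proof -
  have d: "(f has_derivative frechet_derivative f (at x)) (at x)" for x
    using assms by (auto simp: frechet_derivative_works)
  note m = has_derivative_scaleR_left[OF d]
  show p: "partial k (\<lambda>x. f x *\<^sub>R E) = (\<lambda>x. partial k f x *\<^sub>R E)" for k
    unfolding partial_def frechet_derivative_at[OF m, symmetric] ..
  have "continuous_on UNIV (\<lambda>x. partial k f x *\<^sub>R E)" for k
    using assms by (auto intro!: continuous_intros)
  then show "C_k 1 (\<lambda>x. f x *\<^sub>R E)" using m by (auto simp: differentiable_def p)
qed

lemma partial_eq_0_outside_support:
  assumes "x \<notin> closure {x. f x \<noteq> 0}"
  shows "partial k f x = 0"
proof -
  have "((\<lambda>_. 0) has_derivative (\<lambda>_. 0)) (at x)" by simp
  then have "(f has_derivative (\<lambda>_. 0)) (at x)"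
    by (rule has_derivative_transform_within_open[where s="- closure {x. f x \<noteq> 0}"])
      (use assms closure_subset[of "{x. f x \<noteq> 0}"] in auto)
  then show ?thesis unfolding partial_def by (simp add: frechet_derivative_at[symmetric])
qed

lemma diag3_nth:
  "diag3 a b c $ i $ j = (if i = j then (if i = 1 then a else if i = 2 then b else c) else 0)"
proof -
  have "\<forall>i j. diag3 a b c $ i $ j = (if i = j then (if i = 1 then a else if i = 2 then b else c) else 0)"
    by (simp add: forall_3 diag3_def vector_3)
  then show ?thesis by blast
qed

lemma wells_entries:
  assumes "B \<in> wells"
  shows "i \<noteq> j \<Longrightarrow> B $ i $ j = 0"
    and "(B $ 1 $ 1, B $ 2 $ 2, B $ 3 $ 3) \<in> {(0, 0, 0), (-1/2, 2/3, 3), (1, 1, 1)}"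
proof -
  consider "B = 0" | "B = diag3 (-1/2) (2/3) 3" | "B = mat 1" using assms by (auto simp: wells_def)
  note cases = this
  show "B $ i $ j = 0" if "i \<noteq> j"
    using cases by cases (use that in \<open>simp_all add: diag3_nth mat_def\<close>)
  show "(B $ 1 $ 1, B $ 2 $ 2, B $ 3 $ 3) \<in> {(0, 0, 0), (-1/2, 2/3, 3), (1, 1, 1)}"
    using cases by cases (simp_all add: diag3_nth mat_def)
qed

text \<open>Young's inequality |y| \<le> G/2 + y^2/(2 G), integrated over a set of measure one,
  takes the place of Cauchy-Schwarz.\<close>

lemma L1_le_of_L2:
  fixes h :: "real^3 \<Rightarrow> real"
  assumes [measurable]: "h \<in> borel_measurable borel" and "0 < G"
    and L2: "(\<integral>\<^sup>+x\<in>cell. ennreal ((h x)\<^sup>2) \<partial>lborel) \<le> ennreal (G\<^sup>2)"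
  shows "(\<integral>\<^sup>+x\<in>cell. ennreal \<bar>h x\<bar> \<partial>lborel) \<le> ennreal G"
proof -
  have "\<bar>y\<bar> \<le> G / 2 + 1 / (2 * G) * y\<^sup>2" for y
  proof -
    have "0 \<le> (G - \<bar>y\<bar>)\<^sup>2" by simp
    then have "2 * G * \<bar>y\<bar> \<le> G\<^sup>2 + y\<^sup>2" by (simp add: power2_diff)
    then show ?thesis using \<open>0 < G\<close> by (simp add: field_simps power2_eq_square)
  qed
  then have "ennreal \<bar>y\<bar> \<le> ennreal (G / 2) + ennreal (1 / (2 * G)) * ennreal (y\<^sup>2)" for y
    using \<open>0 < G\<close> by (simp add: ennreal_leI flip: ennreal_mult ennreal_plus)
  then have "(\<integral>\<^sup>+x\<in>cell. ennreal \<bar>h x\<bar> \<partial>lborel) 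
      \<le> (\<integral>\<^sup>+x. ennreal (G / 2) * indicator cell x + ennreal (1 / (2 * G)) * (ennreal ((h x)\<^sup>2) * indicator cell x) \<partial>lborel)"
    by (intro nn_integral_mono) (auto simp: indicator_def)
  also have "\<dots> = ennreal (G / 2) + ennreal (1 / (2 * G)) * (\<integral>\<^sup>+x\<in>cell. ennreal ((h x)\<^sup>2) \<partial>lborel)"
    by (simp add: nn_integral_add nn_integral_cmult nn_integral_cmult_indicator emeasure_cell)
  also have "\<dots> \<le> ennreal (G / 2) + ennreal (1 / (2 * G)) * ennreal (G\<^sup>2)"
    by (intro add_left_mono mult_left_mono L2) auto
  also have "\<dots> = ennreal (G / 2 + 1 / (2 * G) * G\<^sup>2)"
    using \<open>0 < G\<close> by (simp flip: ennreal_mult ennreal_plus)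
  also have "G / 2 + 1 / (2 * G) * G\<^sup>2 = G" using \<open>0 < G\<close> by (simp add: power2_eq_square)
  finally show ?thesis .
qed

section \<open>Fields with values in the wells\<close>

lemma AE_cube_cell_cong:
  assumes "AE x in lborel. x \<in> cell \<longrightarrow> P x"
  shows "AE x in lborel. (x \<in> cell \<longleftrightarrow> x \<in> unit_cube) \<and> (x \<in> cell \<longrightarrow> P x)"
  using AE_cell_iff(1) assms by eventually_elim simp

lemma set_integral_unit_cube_eq:
  fixes h b :: "real^3 \<Rightarrow> real"
  assumes [measurable]: "b \<in> borel_measurable borel" and ae: "AE x in lborel. x \<in> cell \<longrightarrow> h x = b x"
  shows "set_lebesgue_integral lebesgue unit_cube h = (LINT x:cell|lborel. b x)"
proof -
  have m: "(\<lambda>x. indicator cell x *\<^sub>R b x) \<in> borel_measurable lborel" by measurable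
  have "AE x in lborel. indicator cell x *\<^sub>R b x = indicator unit_cube x *\<^sub>R h x"
    using AE_cube_cell_cong[OF ae] by eventually_elim (auto simp: indicator_def)
  then have e: "AE x in lebesgue. indicator cell x *\<^sub>R b x = indicator unit_cube x *\<^sub>R h x"
    by (rule AE_completion)
  have "(\<integral>x. indicator unit_cube x *\<^sub>R h x \<partial>lebesgue) = (\<integral>x. indicator cell x *\<^sub>R b x \<partial>lebesgue)"
  proof (rule integral_cong_AE)
    show "(\<lambda>x. indicator cell x *\<^sub>R b x) \<in> borel_measurable lebesgue"
      by (rule measurable_completion[OF m])
    then show "(\<lambda>x. indicator unit_cube x *\<^sub>R h x) \<in> borel_measurable lebesgue"
      by (rule borel_measurable_AE[OF _ e])
    show "AE x in lebesgue. indicator unit_cube x *\<^sub>R h x = indicator cell x *\<^sub>R b x"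
      using e by eventually_elim simp
  qed
  also have "\<dots> = (\<integral>x. indicator cell x *\<^sub>R b x \<partial>lborel)" by (rule integral_completion[OF m])
  finally show ?thesis by (simp add: set_lebesgue_integral_def)
qed

lemma nn_integral_unit_cube_eq:
  fixes h b :: "real^3 \<Rightarrow> ennreal"
  assumes ae: "AE x in lborel. x \<in> cell \<longrightarrow> h x = b x"
  shows "(\<integral>\<^sup>+x\<in>unit_cube. h x \<partial>lebesgue) = (\<integral>\<^sup>+x\<in>cell. b x \<partial>lborel)"
proof -
  have "AE x in lborel. h x * indicator unit_cube x = b x * indicator cell x"
    using AE_cube_cell_cong[OF ae] by eventually_elim (auto simp: indicator_def)
  then show ?thesis unfolding nn_integral_completion by (rule nn_integral_cong_AE)
qed

lemma ex_borel_component: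
  fixes f :: "real^3 \<Rightarrow> real^3^3"
  assumes "f \<in> borel_measurable lebesgue"
  obtains b where "\<And>i j. b i j \<in> borel_measurable borel" "AE x in lborel. \<forall>i j. f x $ i $ j = b i j x"
proof -
  have "bounded_linear (\<lambda>A::real^3^3. A $ i $ j)" for i j
    using bounded_linear_compose[of "\<lambda>v::real^3. v $ j" "\<lambda>A::real^3^3. A $ i"]
    by (simp add: bounded_linear_vec_nth)
  then have "(\<lambda>A::real^3^3. A $ i $ j) \<in> borel_measurable borel" for i j
    by (intro borel_measurable_continuous_onI linear_continuous_on)
  then have "(\<lambda>x. f x $ i $ j) \<in> borel_measurable lebesgue" for i j
    using measurable_compose[OF assms] by blast
  then have "\<exists>b\<in>borel_measurable lborel. AE x in lborel. f x $ i $ j = b x" for i j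
    by (rule completion_ex_borel_measurable_real)
  then have "\<forall>p. \<exists>b. b \<in> borel_measurable borel \<and> (AE x in lborel. f x $ fst p $ snd p = b x)"
    by (auto simp: measurable_lborel1)
  from choice[OF this] obtain b' where
    b': "\<forall>p. b' p \<in> borel_measurable borel \<and> (AE x in lborel. f x $ fst p $ snd p = b' p x)" ..
  define b where "b i j = b' (i, j)" for i j
  have b: "b i j \<in> borel_measurable borel" "AE x in lborel. f x $ i $ j = b i j x" for i j
    using b'[rule_format, of "(i, j)"] by (simp_all add: b_def)
  have "AE x in lborel. \<forall>i j. f x $ i $ j = b i j x" using b(2) by (simp add: AE_all_countable)
  then show ?thesis using b(1) that by blast
qed

definition well_entries :: "(real \<times> real \<times> real) set" where
  "well_entries = {(0, 0, 0), (-1/2, 2/3, 3), (1, 1, 1)}"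

text \<open>The field takes values in the wells only almost everywhere, while the iteration compares
  entries at arbitrary pairs of points. The representative has these values, and is periodic, at
  every point.\<close>

lemma BV_wells_representative:
  assumes "chi \<in> BV (box 0 1) wells"
  obtains a where "\<And>i. a i \<in> borel_measurable borel" "\<And>i. periodic (a i)"
    "\<And>x. (a 1 x, a 2 x, a 3 x) \<in> well_entries"
    "AE x in lborel. x \<in> cell \<longrightarrow> (\<forall>i j. chi x $ i $ j = (if i = j then a i x else 0))"
proof -
  have "set_integrable lebesgue (box 0 1) chi" and w: "AE x in lebesgue. x \<in> box 0 1 \<longrightarrow> chi x \<in> wells"
    using assms by (auto simp: BV_def)
  then have "(\<lambda>x. indicator (box 0 1) x *\<^sub>R chi x) \<in> borel_measurable lebesgue"
    unfolding set_integrable_def by simp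
  then obtain b where [measurable]: "\<And>i j. b i j \<in> borel_measurable borel" 
    and b: "AE x in lborel. \<forall>i j. (indicator (box 0 1) x *\<^sub>R chi x) $ i $ j = b i j x"
    using ex_borel_component by blast
  define W where "W = {x. (b 1 1 x, b 2 2 x, b 3 3 x) \<in> well_entries}"
  have "W = {x. (b 1 1 x = 0 \<and> b 2 2 x = 0 \<and> b 3 3 x = 0) \<or> (b 1 1 x = -1/2 \<and> b 2 2 x = 2/3 \<and> b 3 3 x = 3)
      \<or> (b 1 1 x = 1 \<and> b 2 2 x = 1 \<and> b 3 3 x = 1)}" by (auto simp: W_def well_entries_def)
  also have "\<dots> \<in> sets borel" by measurable
  finally have [measurable]: "W \<in> sets borel" .
  \<comment> \<open>Off \<open>W\<close> all three entries get the value 0, the diagonal of the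
    first well, so the triple remains admissible on the exceptional set.\<close>
  define a where "a i x = (if frac_part x \<in> W then b i i (frac_part x) else 0)" for i x
  have "a i \<in> borel_measurable borel" for i unfolding a_def[abs_def] by measurable
  moreover have "periodic (a i)" for i by (simp add: periodic_def a_def frac_part_periodic)
  moreover have "(a 1 x, a 2 x, a 3 x) \<in> well_entries" for x
    by (cases "frac_part x \<in> W") (auto simp: a_def W_def well_entries_def)
  moreover have "AE x in lborel. x \<in> cell \<longrightarrow> (\<forall>i j. chi x $ i $ j = (if i = j then a i x else 0))"
  proof -
    have "AE x in lborel. x \<in> box 0 1 \<longrightarrow> chi x \<in> wells" using w by (simp add: AE_completion_iff)
    with AE_cell_iff(2) b show ?thesis
    proof eventually_elim
      case (elim x)
      show ?case
      proof (intro impI allI)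
        fix i j assume x: "x \<in> cell"
        then have chi: "chi x \<in> wells" "chi x $ i $ j = b i j x" for i j using elim by auto
        then have "x \<in> W" using wells_entries(2)[OF chi(1)] by (simp add: W_def well_entries_def)
        then show "chi x $ i $ j = (if i = j then a i x else 0)"
          using x chi wells_entries(1)[OF chi(1), of i j] by (simp add: a_def frac_part_cell)
      qed
    qed
  qed
  ultimately show ?thesis using that by blast
qed

lemma well_entries_bounds:
  fixes a :: "3 \<Rightarrow> real^3 \<Rightarrow> real"
  assumes "\<And>x. (a 1 x, a 2 x, a 3 x) \<in> well_entries"
  shows "\<bar>a i x\<bar> \<le> 3" "\<bar>a i x - a i y\<bar> \<le> 6 * \<bar>a j x - a j y\<bar>"
proof -
  consider "a 1 x = 0 \<and> a 2 x = 0 \<and> a 3 x = 0" | "a 1 x = -1/2 \<and> a 2 x = 2/3 \<and> a 3 x = 3"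
    | "a 1 x = 1 \<and> a 2 x = 1 \<and> a 3 x = 1" using assms[of x] by (auto simp: well_entries_def)
  note x = this
  consider "a 1 y = 0 \<and> a 2 y = 0 \<and> a 3 y = 0" | "a 1 y = -1/2 \<and> a 2 y = 2/3 \<and> a 3 y = 3"
    | "a 1 y = 1 \<and> a 2 y = 1 \<and> a 3 y = 1" using assms[of y] by (auto simp: well_entries_def)
  note y = this
  have "\<forall>i. \<bar>a i x\<bar> \<le> 3" using x by cases (simp_all add: forall_3)
  then show "\<bar>a i x\<bar> \<le> 3" by blast
  have "\<forall>i j. \<bar>a i x - a i y\<bar> \<le> 6 * \<bar>a j x - a j y\<bar>"
    using x by (cases; use y in \<open>cases; simp add: forall_3\<close>)
  then show "\<bar>a i x - a i y\<bar> \<le> 6 * \<bar>a j x - a j y\<bar>" by blast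
qed

section \<open>The hypotheses of the iteration for a field and a competitor\<close>

lemma integral_le_torus_variation:
  assumes a [measurable]: "a i \<in> borel_measurable borel"
    and ae: "AE x in lborel. x \<in> cell \<longrightarrow> (\<forall>i j. chi x $ i $ j = (if i = j then a i x else 0))"
    and T: "torus_variation chi \<le> ennreal T" "0 \<le> T"
    and \<phi>: "C_k 1 \<phi>" "periodic \<phi>" "\<And>x. \<bar>\<phi> x\<bar> \<le> 1"
  shows "(LINT x:cell|lborel. a i x * partial k \<phi> x) \<le> T"
proof -
  \<comment> \<open>A single entry in position (i, i, k) isolates the k-th derivative against the
    i-th diagonal entry. Its norm is 1, so a bound for \<phi> is a bound for the tensor
    field.\<close>
  define E :: "real^3^3^3" where "E = axis i (axis i (axis k 1))"
  define \<Psi> where "\<Psi> x = \<phi> x *\<^sub>R E" for x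
  have [measurable]: "partial k \<phi> \<in> borel_measurable borel"
    by (rule borel_measurable_continuous_onI[OF continuous_partial[OF \<phi>(1)]])
  have p: "pairing (chi x) \<Psi> x = chi x $ i $ i * partial k \<phi> x" for x
  proof -
    have "pairing (chi x) \<Psi> x = (\<Sum>i'\<in>UNIV. \<Sum>j\<in>UNIV. \<Sum>l\<in>UNIV. 
        if l = k then (if j = i then (if i' = i then chi x $ i' $ j * partial l \<phi> x else 0) else 0) else 0)"
      unfolding pairing_def \<Psi>_def C_k_scaleR_const(2)[OF \<phi>(1)] E_def
      by (intro sum.cong refl) (auto simp: axis_def)
    then show ?thesis by (simp add: sum.delta)
  qed
  have "ennreal (set_lebesgue_integral lebesgue unit_cube (\<lambda>x. pairing (chi x) \<Psi> x)) \<le> torus_variation chi"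
    unfolding torus_variation_def
  proof (rule SUP_upper, intro CollectI conjI allI)
    show "C_k 1 \<Psi>" unfolding \<Psi>_def[abs_def] by (rule C_k_scaleR_const(1)[OF \<phi>(1)])
    show "periodic \<Psi>" using \<phi>(2) by (simp add: periodic_def \<Psi>_def)
    show "norm (\<Psi> x) \<le> 1" for x using \<phi>(3) by (simp add: \<Psi>_def E_def norm_eq_sqrt_inner[of "axis _ _"] inner_axis_axis)
  qed
  also have "set_lebesgue_integral lebesgue unit_cube (\<lambda>x. pairing (chi x) \<Psi> x) = (LINT x:cell|lborel. a i x * partial k \<phi> x)"
    by (rule set_integral_unit_cube_eq) (measurable, use ae in eventually_elim, simp add: p)
  finally have "ennreal (LINT x:cell|lborel. a i x * partial k \<phi> x) \<le> ennreal T" using T(1) by (rule order_trans)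
  then show ?thesis using T(2) by (simp add: ennreal_le_iff)
qed

lemma test_partial_bound:
  fixes \<phi> :: "real^3 \<Rightarrow> real"
  assumes "C_infinity \<phi>" "compact_support_in UNIV \<phi>"
  shows "\<exists>S M. compact S \<and> (\<forall>x. \<bar>partial k \<phi> x\<bar> \<le> M * indicator S x) \<and> 0 < M"
proof -
  define S where "S = closure {x. \<phi> x \<noteq> 0}"
  have S: "compact S" using assms(2) by (simp add: compact_support_in_def S_def)
  have "C_k 1 \<phi>" using assms(1) by (simp add: C_infinity_def)
  then have "bounded (partial k \<phi> ` S)"
    by (intro compact_imp_bounded compact_continuous_image S continuous_on_subset[OF continuous_partial]) auto
  then obtain M where M: "\<And>x. x \<in> S \<Longrightarrow> \<bar>partial k \<phi> x\<bar> \<le> M" "0 < M" by (auto simp: bounded_pos)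
  have "\<bar>partial k \<phi> x\<bar> \<le> M * indicator S x" for x
    using M(1)[of x] partial_eq_0_outside_support[of x \<phi> k] by (cases "x \<in> S") (auto simp: S_def)
  then show ?thesis using S M(2) by blast
qed

lemma partial_test_borel:
  fixes \<phi> :: "real^3 \<Rightarrow> real"
  assumes "C_infinity \<phi>"
  shows "partial k \<phi> \<in> borel_measurable borel"
proof -
  have "C_k 1 \<phi>" using assms by (simp add: C_infinity_def)
  then show ?thesis by (rule borel_measurable_continuous_onI[OF continuous_partial])
qed

text \<open>The derivative of the test function is bounded with compact support, and on that support
  t \<le> 1 + t^2 dominates an entry of \<open>u\<close> by its square. Integrability matters
  because the equation is obtained by splitting an integral into a difference.\<close>

lemma integrable_L2_loc_times_test:
  fixes u :: "real^3 \<Rightarrow> real^3^3"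
  assumes u: "L2_loc u" and U: "U \<in> borel_measurable borel" "AE x in lborel. u x $ i $ j = U x"
    and \<phi>: "C_infinity \<phi>" "compact_support_in UNIV \<phi>"
  shows "integrable lborel (\<lambda>x. U x * partial k \<phi> x)"
proof -
  note [measurable] = U(1) partial_test_borel[OF \<phi>(1)]
  obtain S M where S: "compact S" and M: "\<And>x. \<bar>partial k \<phi> x\<bar> \<le> M * indicator S x" "0 < M"
    using test_partial_bound[OF \<phi>, of k] by (elim exE conjE) (rule that, auto)
  have m: "(\<lambda>x. U x * partial k \<phi> x) \<in> borel_measurable lborel" by measurable
  have "integrable lebesgue (\<lambda>x. U x * partial k \<phi> x)"
  proof (rule Bochner_Integration.integrable_bound)
    have "S \<in> lmeasurable" by (rule lmeasurable_compact[OF S])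
    then have "integrable lebesgue (indicator S :: real^3 \<Rightarrow> real)"
      by (intro integrable_real_indicator) (auto simp: fmeasurable_def)
    moreover have "integrable lebesgue (\<lambda>x. indicator S x *\<^sub>R (norm (u x))\<^sup>2)"
      using u S by (simp add: L2_loc_def set_integrable_def)
    ultimately show "integrable lebesgue (\<lambda>x. M * (indicator S x + indicator S x *\<^sub>R (norm (u x))\<^sup>2))"
      by (intro integrable_mult_right Bochner_Integration.integrable_add)
    show "(\<lambda>x. U x * partial k \<phi> x) \<in> borel_measurable lebesgue" by (rule measurable_completion[OF m])
    have "AE x in lebesgue. u x $ i $ j = U x" by (rule AE_completion[OF U(2)])
    then show "AE x in lebesgue. norm (U x * partial k \<phi> x) \<le> norm (M * (indicator S x + indicator S x *\<^sub>R (norm (u x))\<^sup>2))"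
    proof eventually_elim
      case (elim x)
      have "\<bar>U x\<bar> \<le> norm (u x)"
        using Finite_Cartesian_Product.norm_nth_le[where x="u x $ i" and i=j] Finite_Cartesian_Product.norm_nth_le[where x="u x" and i=i] elim by simp
      also have "\<dots> \<le> 1 + (norm (u x))\<^sup>2"
        using zero_le_power2[of "norm (u x) - 1"] norm_ge_zero[of "u x"]
        unfolding power2_diff one_power2 mult_1_right by linarith
      finally have "\<bar>U x\<bar> * \<bar>partial k \<phi> x\<bar> \<le> (1 + (norm (u x))\<^sup>2) * (M * indicator S x)"
        by (intro mult_mono M) auto
      also have "\<dots> = M * (indicator S x + indicator S x *\<^sub>R (norm (u x))\<^sup>2)" by (simp add: algebra_simps)
      finally show ?case using M(2) by (simp add: abs_mult)
    qed
  qed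
  then show ?thesis using integrable_completion[OF m] by simp
qed

lemma coupled_fields_of_competitor:
  assumes a[measurable]: "\<And>i. a i \<in> borel_measurable borel" and per: "\<And>i. periodic (a i)"
    and we: "\<And>x. (a 1 x, a 2 x, a 3 x) \<in> well_entries"
    and chi: "AE x in lborel. x \<in> cell \<longrightarrow> (\<forall>i j. chi x $ i $ j = (if i = j then a i x else 0))"
    and u: "u \<in> D_per F" and "0 < G"
    and L2: "(\<integral>\<^sup>+x\<in>unit_cube. ennreal ((norm (u x - chi x))\<^sup>2) \<partial>lebesgue) \<le> ennreal (G\<^sup>2)"
  obtains g where "coupled_fields a g G"
proof -
  have uL: "L2_loc u" and up: "ae_periodic u" and ud: "weakly_div_free u" using u by (auto simp: D_per_def)
  then obtain U where U[measurable]: "\<And>i j. U i j \<in> borel_measurable borel"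
    and uU: "AE x in lborel. \<forall>i j. u x $ i $ j = U i j x"
    using ex_borel_component unfolding L2_loc_def by blast
  \<comment> \<open>Almost everywhere on the cell this is chi - u, as \<open>chi\<close> is diagonal
    there; elsewhere the periodic representatives extend it.\<close>
  define g where "g j k x = (if j = k then a j x else 0) - U j k x" for j k x
  have g[measurable]: "g j k \<in> borel_measurable borel" for j k unfolding g_def[abs_def] by measurable
  have Uper: "ae_per (U i j)" for i j
    unfolding ae_per_def
  proof
    fix k
    have "AE x in lborel. u (x + axis k 1) = u x" using up by (simp add: ae_periodic_def AE_completion_iff)
    with uU AE_lborel_shift[OF uU, of "axis k 1"] show "AE x in lborel. U i j (x + axis k 1) = U i j x"
      by eventually_elim metis
  qed
  have "coupled_fields a g G"
  proof
    show "ae_per (a i)" for i by (rule ae_per_of_periodic[OF per])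
    show "\<bar>a i x\<bar> \<le> 3" for i x by (rule well_entries_bounds(1)[of a, OF we])
    show "\<bar>a i x - a i y\<bar> \<le> 6 * \<bar>a j x - a j y\<bar>" for i j x y by (rule well_entries_bounds(2)[of a, OF we])
    show "ae_per (g j k)" for j k
      using ae_per_comp2[OF ae_per_of_periodic[OF per[of j]] Uper[of j k], of "\<lambda>p q. (if j = k then p else 0) - q"]
      by (simp add: g_def[abs_def])
    show "(\<integral>\<^sup>+x\<in>cell. ennreal \<bar>g j k x\<bar> \<partial>lborel) \<le> ennreal G" for j k
    proof (rule L1_le_of_L2[OF g \<open>0 < G\<close>])
      have "(\<integral>\<^sup>+x\<in>cell. ennreal ((g j k x)\<^sup>2) \<partial>lborel) = (\<integral>\<^sup>+x\<in>unit_cube. ennreal (((u x - chi x) $ j $ k)\<^sup>2) \<partial>lebesgue)"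
      proof (rule nn_integral_unit_cube_eq[symmetric])
        show "AE x in lborel. x \<in> cell \<longrightarrow> ennreal (((u x - chi x) $ j $ k)\<^sup>2) = ennreal ((g j k x)\<^sup>2)"
          using chi uU by eventually_elim (auto simp: g_def power2_commute)
      qed
      also have "\<dots> \<le> (\<integral>\<^sup>+x\<in>unit_cube. ennreal ((norm (u x - chi x))\<^sup>2) \<partial>lebesgue)"
      proof (intro nn_integral_mono mult_right_mono ennreal_leI)
        fix x
        have "\<bar>(u x - chi x) $ j $ k\<bar> \<le> norm (u x - chi x)"
          using Finite_Cartesian_Product.norm_nth_le[where x="(u x - chi x) $ j" and i=k] Finite_Cartesian_Product.norm_nth_le[where x="u x - chi x" and i=j] by simp
        then show "((u x - chi x) $ j $ k)\<^sup>2 \<le> (norm (u x - chi x))\<^sup>2"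
          by (rule abs_le_square_iff[THEN iffD1, OF order_trans]) simp
      qed auto
      finally show "(\<integral>\<^sup>+x\<in>cell. ennreal ((g j k x)\<^sup>2) \<partial>lborel) \<le> ennreal (G\<^sup>2)" using L2 by (rule order_trans)
    qed
    show "0 \<le> G" using \<open>0 < G\<close> by simp
    show "ennreal \<bar>\<integral>y. a j y * partial j \<phi> y \<partial>lborel\<bar>
          \<le> (\<Sum>k\<in>UNIV. \<integral>\<^sup>+y. ennreal \<bar>partial k \<phi> y\<bar> * ennreal \<bar>g j k y\<bar> \<partial>lborel)"
      if \<phi>: "C_infinity \<phi>" "compact_support_in UNIV \<phi>" for j and \<phi> :: "real^3 \<Rightarrow> real"
    proof -
      note [measurable] = partial_test_borel[OF \<phi>(1)]
      \<comment> \<open>Row j of the competitor tested against the gradient of \<phi>. Its integral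
        is zero, so subtracting it from the pairing of \<open>a j\<close> changes nothing and leaves
        the pairing with row j of \<open>g\<close>.\<close>
      define h where "h x = (\<Sum>k\<in>UNIV. U j k x * partial k \<phi> x)" for x
      have hm: "h \<in> borel_measurable lborel" unfolding h_def by measurable
      have iU: "integrable lborel (\<lambda>x. U j k x * partial k \<phi> x)" for k
        by (rule integrable_L2_loc_times_test[OF uL U _ \<phi>]) (use uU in eventually_elim, simp)
      have ih: "integrable lborel h" unfolding h_def by (rule Bochner_Integration.integrable_sum[OF iU])
      have "AE x in lborel. h x = (\<Sum>k\<in>UNIV. u x $ j $ k * partial k \<phi> x)"
        using uU by eventually_elim (simp add: h_def)
      then have e: "AE x in lebesgue. h x = (\<Sum>k\<in>UNIV. u x $ j $ k * partial k \<phi> x)" by (rule AE_completion)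
      have "(\<integral>x. (\<Sum>k\<in>UNIV. u x $ j $ k * partial k \<phi> x) \<partial>lebesgue) = (\<integral>x. h x \<partial>lebesgue)"
      proof (rule integral_cong_AE[OF borel_measurable_AE[OF _ e]])
        show "h \<in> borel_measurable lebesgue" "h \<in> borel_measurable lebesgue" using hm by (rule measurable_completion)+
        show "AE x in lebesgue. (\<Sum>k\<in>UNIV. u x $ j $ k * partial k \<phi> x) = h x" using e by eventually_elim simp
      qed
      also have "\<dots> = (\<integral>x. h x \<partial>lborel)" by (rule integral_completion[OF hm])
      finally have h0: "(\<integral>x. h x \<partial>lborel) = 0" using ud \<phi> by (simp add: weakly_div_free_def)
      have ip: "integrable lborel (partial j \<phi>)"
      proof -
        obtain S M where S: "compact S" and M: "\<And>x. \<bar>partial j \<phi> x\<bar> \<le> M * indicator S x" "0 < M"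
          using test_partial_bound[OF \<phi>, of j] by (elim exE conjE) (rule that, auto)
        have "emeasure lborel S < \<infinity>" by (rule emeasure_compact_finite[OF S])
        then have "integrable lborel (\<lambda>x. M * indicator S x)"
          using S by (intro integrable_mult_right integrable_real_indicator) (auto simp: borel_compact)
        then show ?thesis
          by (rule Bochner_Integration.integrable_bound) (auto intro!: AE_I2 order_trans[OF M(1)])
      qed
      have ia: "integrable lborel (\<lambda>y. a j y * partial j \<phi> y)"
        using integrable_mult_bounded[OF ip a[of j] well_entries_bounds(1)[of a, OF we]] by (simp add: mult.commute)
      have s: "(\<Sum>k\<in>UNIV. g j k y * partial k \<phi> y) = a j y * partial j \<phi> y - h y" for y
        by (simp add: g_def h_def left_diff_distrib sum_subtractf if_distrib[of "\<lambda>c. c * _"] cong: if_cong)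
      have isum: "integrable lborel (\<lambda>y. \<Sum>k\<in>UNIV. g j k y * partial k \<phi> y)"
        unfolding s by (intro Bochner_Integration.integrable_diff ia ih)
      have "(\<integral>y. a j y * partial j \<phi> y \<partial>lborel) = (\<integral>y. (\<Sum>k\<in>UNIV. g j k y * partial k \<phi> y) \<partial>lborel)"
        unfolding s using ia ih h0 by simp
      then have "ennreal \<bar>\<integral>y. a j y * partial j \<phi> y \<partial>lborel\<bar>
          \<le> (\<integral>\<^sup>+y. ennreal (norm (\<Sum>k\<in>UNIV. g j k y * partial k \<phi> y)) \<partial>lborel)"
        using integral_norm_bound_ennreal[OF isum] by simp
      also have "\<dots> \<le> (\<integral>\<^sup>+y. (\<Sum>k\<in>UNIV. ennreal \<bar>partial k \<phi> y\<bar> * ennreal \<bar>g j k y\<bar>) \<partial>lborel)"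
      proof (rule nn_integral_mono)
        fix y
        have "norm (\<Sum>k\<in>UNIV. g j k y * partial k \<phi> y) \<le> (\<Sum>k\<in>UNIV. \<bar>partial k \<phi> y\<bar> * \<bar>g j k y\<bar>)"
          by (rule order_trans[OF norm_sum]) (simp add: abs_mult mult.commute)
        then have "ennreal (norm (\<Sum>k\<in>UNIV. g j k y * partial k \<phi> y)) \<le> ennreal (\<Sum>k\<in>UNIV. \<bar>partial k \<phi> y\<bar> * \<bar>g j k y\<bar>)"
          by (rule ennreal_leI)
        then show "ennreal (norm (\<Sum>k\<in>UNIV. g j k y * partial k \<phi> y)) \<le> (\<Sum>k\<in>UNIV. ennreal \<bar>partial k \<phi> y\<bar> * ennreal \<bar>g j k y\<bar>)"
          by (simp add: sum_ennreal[symmetric] ennreal_mult)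
      qed
      also have "\<dots> = (\<Sum>k\<in>UNIV. \<integral>\<^sup>+y. ennreal \<bar>partial k \<phi> y\<bar> * ennreal \<bar>g j k y\<bar> \<partial>lborel)"
        by (rule nn_integral_sum) measurable
      finally show ?thesis .
    qed
  qed (use a g in auto)
  then show ?thesis using that by blast
qed

section \<open>The variance bounded by the energy\<close>

lemma L2_norm_sq_eq:
  assumes a[measurable]: "\<And>i. a i \<in> borel_measurable borel"
    and chi: "AE x in lborel. x \<in> cell \<longrightarrow> (\<forall>i j. chi x $ i $ j = (if i = j then a i x else 0))"
  shows "L2_norm_sq (\<lambda>x. chi x $ i $ i - mean (\<lambda>y. chi y $ i $ i))
    = (\<integral>\<^sup>+x\<in>cell. ennreal ((a i x - (LINT y:cell|lborel. a i y))\<^sup>2) \<partial>lborel)"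
proof -
  have m: "mean (\<lambda>y. chi y $ i $ i) = (LINT y:cell|lborel. a i y)"
    unfolding mean_def by (rule set_integral_unit_cube_eq[OF a]) (use chi in eventually_elim, simp)
  show ?thesis unfolding L2_norm_sq_def m
    by (rule nn_integral_unit_cube_eq) (use chi in eventually_elim, simp)
qed

text \<open>The elastic energy enters as a square root, the surface energy linearly. For total
  energy at most 1 the surface term is itself below the square root; for larger energy the trivial
  bound 36 of each variance suffices.\<close>

lemma variance_sum_bound:
  obtains C where "0 < C"
    "\<And>chi F \<epsilon>. chi \<in> BV (box 0 1) wells \<Longrightarrow> 0 < \<epsilon> \<Longrightarrow> \<epsilon> < exp (-1) \<Longrightarrow>
      (\<Sum>j\<in>UNIV. L2_norm_sq (\<lambda>x. chi x $ j $ j - mean (\<lambda>y. chi y $ j $ j)))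
          \<le> ennreal (exp (C * sqrt \<bar>ln \<epsilon>\<bar>)) * ennreal_sqrt (E_per \<epsilon> chi F)"
proof -
  obtain C0 where C0: "0 < C0" and unif:
    "\<And>a g G T \<epsilon> i. coupled_fields a g G \<Longrightarrow> (\<And>i k s. 0 \<le> s \<Longrightarrow> shift_diff (a i) (axis k s) \<le> ennreal (s * T))
      \<Longrightarrow> 0 \<le> T \<Longrightarrow> 0 < \<epsilon> \<Longrightarrow> \<epsilon> < exp (-1)
      \<Longrightarrow> (\<integral>\<^sup>+x\<in>cell. ennreal ((a i x - (LINT y:cell|lborel. a i y))\<^sup>2) \<partial>lborel)
        \<le> ennreal (min 36 (exp (C0 * sqrt \<bar>ln \<epsilon>\<bar>) * (\<epsilon> * T + G)))"
    using uniform_variance_bound by blast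
  \<comment> \<open>Three entries with constant 36 each give 108, absorbed in an exponential because
    sqrt |ln \<epsilon>| \<ge> 1.\<close>
  define C where "C = C0 + 108"
  have "(\<Sum>j\<in>UNIV. L2_norm_sq (\<lambda>x. chi x $ j $ j - mean (\<lambda>y. chi y $ j $ j)))
          \<le> ennreal (exp (C * sqrt \<bar>ln \<epsilon>\<bar>)) * ennreal_sqrt (E_per \<epsilon> chi F)"
    if BV: "chi \<in> BV (box 0 1) wells" and \<epsilon>: "0 < \<epsilon>" "\<epsilon> < exp (-1)" for chi F \<epsilon>
  proof (cases "E_per \<epsilon> chi F = \<infinity>")
    case True
    then show ?thesis by (simp add: ennreal_sqrt_def ennreal_mult_top)
  next
    case False
    define q where "q = sqrt \<bar>ln \<epsilon>\<bar>"
    have "ln \<epsilon> < -1" using \<epsilon> by (metis ln_exp ln_less_cancel_iff exp_gt_zero)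
    then have q: "1 \<le> q" by (simp add: q_def)
    from False have fin: "E_el chi F \<noteq> \<infinity>" "ennreal \<epsilon> * torus_variation chi \<noteq> \<infinity>" by (auto simp: E_per_def)
    then have "torus_variation chi \<noteq> \<infinity>" using \<epsilon>(1) by (auto simp: ennreal_mult_top)
    then obtain T where T: "torus_variation chi = ennreal T" "0 \<le> T" by (cases "torus_variation chi") auto
    from fin(1) obtain e where e: "E_el chi F = ennreal e" "0 \<le> e" by (cases "E_el chi F") auto
    define E where "E = e + \<epsilon> * T"
    have E: "E_per \<epsilon> chi F = ennreal E" "0 \<le> E" "e \<le> E" "\<epsilon> * T \<le> E"
      using T e \<epsilon>(1) by (simp_all add: E_per_def E_def ennreal_mult ennreal_plus)
    obtain a where a: "\<And>i. a i \<in> borel_measurable borel" "\<And>i. periodic (a i)"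
      "\<And>x. (a 1 x, a 2 x, a 3 x) \<in> well_entries"
      "AE x in lborel. x \<in> cell \<longrightarrow> (\<forall>i j. chi x $ i $ j = (if i = j then a i x else 0))"
      using BV_wells_representative[OF BV] by blast
    have bd: "\<bar>a i x\<bar> \<le> 3" for i x by (rule well_entries_bounds(1)[of a]) (rule a(3))
    have sh: "shift_diff (a i) (axis k s) \<le> ennreal (s * T)" if "0 \<le> s" for i k s
    proof (rule shift_diff_le_variation[where f="a i" and K=3, OF a(1) ae_per_of_periodic[OF a(2)] bd _ that])
      show "(LINT x:cell|lborel. a i x * partial k \<phi> x) \<le> T"
        if "C_k 1 \<phi>" "periodic \<phi>" "\<And>x. \<bar>\<phi> x\<bar> \<le> 1" for \<phi>
        by (rule integral_le_torus_variation[OF a(1) a(4) _ T(2) that]) (simp add: T)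
    qed
    \<comment> \<open>The infimum need not be attained, so a competitor is available only strictly
      above \<open>e\<close>. The choice G = 2 sqrt E below leaves room for this, as e \<le> E < 4
      E.\<close>
    have ex: "\<exists>g. coupled_fields a g G" if G: "0 < G" "e < G\<^sup>2" for G
    proof -
      have "E_el chi F < ennreal (G\<^sup>2)" using e G by (simp add: ennreal_less_iff)
      then obtain u where u: "u \<in> D_per F" and lt: "(\<integral>\<^sup>+x\<in>unit_cube. ennreal ((norm (u x - chi x))\<^sup>2) \<partial>lebesgue) < ennreal (G\<^sup>2)"
        unfolding E_el_def by (auto simp: INF_less_iff)
      obtain g where "coupled_fields a g G"
        by (rule coupled_fields_of_competitor[OF a u G(1) less_imp_le[OF lt]])
      then show ?thesis by (rule exI[of _ g])
    qed
    have var: "(\<integral>\<^sup>+x\<in>cell. ennreal ((a i x - (LINT y:cell|lborel. a i y))\<^sup>2) \<partial>lborel)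
       \<le> ennreal (36 * exp (C0 * q) * sqrt E)" for i
    proof -
      have e1: "1 \<le> exp (C0 * q)" using C0 q by simp
      consider "E = 0" | "0 < E" "E \<le> 1" | "1 < E" using E(2) by linarith
      then show ?thesis
      proof cases
        case 1
        \<comment> \<open>For zero energy the choice 2 sqrt E degenerates. The total variation is
          then zero, so every translation difference vanishes, and G = 1 is good enough to apply
          \<open>variance_le\<close> with \<beta> = 0.\<close>
        then have "e = 0" "T = 0" using e T \<epsilon>(1) E by (auto simp: E_def add_nonneg_eq_0_iff)
        obtain g where "coupled_fields a g 1" using ex[of 1] \<open>e = 0\<close> by auto
        moreover have "shifts_le a 1 0" unfolding shifts_le_def using sh \<open>T = 0\<close> by auto
        ultimately show ?thesis using coupled_fields.variance_le[of a g 1 1 0 i] 1 by simp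
      next
        case 2
        have "e < (2 * sqrt E)\<^sup>2" using E 2 by (simp add: power_mult_distrib)
        then obtain g where g: "coupled_fields a g (2 * sqrt E)" using ex[of "2 * sqrt E"] 2 by auto
        have "E \<le> sqrt E" using 2 by (intro real_le_rsqrt) (simp add: power2_eq_square mult_le_one)
        then have "\<epsilon> * T + 2 * sqrt E \<le> 3 * sqrt E" using E by linarith
        then have "exp (C0 * q) * (\<epsilon> * T + 2 * sqrt E) \<le> exp (C0 * q) * (3 * sqrt E)" by simp
        also have "\<dots> \<le> 36 * exp (C0 * q) * sqrt E" using 2 by simp
        finally have "min 36 (exp (C0 * q) * (\<epsilon> * T + 2 * sqrt E)) \<le> 36 * exp (C0 * q) * sqrt E" by linarith
        then show ?thesis using unif[OF g sh T(2) \<epsilon>, of i] unfolding q_def by (meson ennreal_leI order_trans)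
      next
        case 3
        have "e < (2 * sqrt E)\<^sup>2" using E 3 by (simp add: power_mult_distrib)
        then obtain g where g: "coupled_fields a g (2 * sqrt E)" using ex[of "2 * sqrt E"] 3 by auto
        have "1 * 1 \<le> exp (C0 * q) * sqrt E" using e1 3 by (intro mult_mono) auto
        then have "min 36 (exp (C0 * q) * (\<epsilon> * T + 2 * sqrt E)) \<le> 36 * exp (C0 * q) * sqrt E" by linarith
        then show ?thesis using unif[OF g sh T(2) \<epsilon>, of i] unfolding q_def by (meson ennreal_leI order_trans)
      qed
    qed
    have "(\<Sum>j\<in>UNIV. L2_norm_sq (\<lambda>x. chi x $ j $ j - mean (\<lambda>y. chi y $ j $ j)))
        \<le> (\<Sum>j\<in>(UNIV::3 set). ennreal (36 * exp (C0 * q) * sqrt E))"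
      unfolding L2_norm_sq_eq[OF a(1,4)] by (rule sum_mono[OF var])
    also have "\<dots> = ennreal (\<Sum>j\<in>(UNIV::3 set). 36 * exp (C0 * q) * sqrt E)"
      using E(2) by (intro sum_ennreal) auto
    also have "(\<Sum>j\<in>(UNIV::3 set). 36 * exp (C0 * q) * sqrt E) = 108 * (exp (C0 * q) * sqrt E)" by simp
    also have "\<dots> \<le> exp (108 * q) * (exp (C0 * q) * sqrt E)"
    proof (rule mult_right_mono)
      show "108 \<le> exp (108 * q)" using exp_ge_add_one_self[of "108 * q"] q by linarith
    qed (use E(2) in auto)
    also have "\<dots> = exp (C * q) * sqrt E" by (simp add: C_def algebra_simps flip: exp_add)
    finally show ?thesis
      using E(1,2) by (simp add: ennreal_sqrt_def q_def ennreal_mult ennreal_leI)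
  qed
  moreover have "0 < C" using C0 by (simp add: C_def)
  ultimately show ?thesis using that by blast
qed

theorem proposition1p2:
  fixes F :: "real^3^3"
  assumes "F \<in> quasiconvex_hull wells - wells"
  shows "\<exists>\<epsilon>\<^sub>0>0. \<forall>\<nu>::real. 0 < \<nu> \<and> \<nu> < 1 \<longrightarrow>
    (\<exists>c>0. \<forall>\<epsilon>::real. 0 < \<epsilon> \<and> \<epsilon> < \<epsilon>\<^sub>0 \<longrightarrow>
      (\<forall>chi\<in>BV (box 0 1) wells.
        (\<Sum>j\<in>UNIV. L2_norm_sq (\<lambda>x. chi x $ j $ j - mean (\<lambda>y. chi y $ j $ j)))
          \<le> ennreal (exp (c * \<bar>ln \<epsilon>\<bar> powr (1/2 + \<nu>))) * ennreal_sqrt (E_per \<epsilon> chi F)))"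
proof -
  obtain C where C: "0 < C" and bound:
    "\<And>chi F \<epsilon>. chi \<in> BV (box 0 1) wells \<Longrightarrow> 0 < \<epsilon> \<Longrightarrow> \<epsilon> < exp (-1) \<Longrightarrow>
      (\<Sum>j\<in>UNIV. L2_norm_sq (\<lambda>x. chi x $ j $ j - mean (\<lambda>y. chi y $ j $ j)))
          \<le> ennreal (exp (C * sqrt \<bar>ln \<epsilon>\<bar>)) * ennreal_sqrt (E_per \<epsilon> chi F)"
    using variance_sum_bound by blast
  have "(\<Sum>j\<in>UNIV. L2_norm_sq (\<lambda>x. chi x $ j $ j - mean (\<lambda>y. chi y $ j $ j)))
      \<le> ennreal (exp (C * \<bar>ln \<epsilon>\<bar> powr (1/2 + \<nu>))) * ennreal_sqrt (E_per \<epsilon> chi F)"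
    if \<nu>: "0 < \<nu> \<and> \<nu> < 1" and \<epsilon>: "0 < \<epsilon> \<and> \<epsilon> < exp (-1)" and chi: "chi \<in> BV (box 0 1) wells" for \<nu> \<epsilon> chi
  proof -
    have "ln \<epsilon> < -1" using \<epsilon> by (metis ln_exp ln_less_cancel_iff exp_gt_zero)
    \<comment> \<open>As |ln \<epsilon>| exceeds 1, raising the exponent from 1/2 to 1/2 + \<nu>
      weakens the bound; the threshold exp (-1) and the constant \<open>C\<close> serve for all
      \<nu>.\<close>
    then have "\<bar>ln \<epsilon>\<bar> powr (1/2) \<le> \<bar>ln \<epsilon>\<bar> powr (1/2 + \<nu>)" using \<nu> by (intro powr_mono) auto
    then have "exp (C * sqrt \<bar>ln \<epsilon>\<bar>) \<le> exp (C * \<bar>ln \<epsilon>\<bar> powr (1/2 + \<nu>))"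
      using C by (simp add: powr_half_sqrt)
    from mult_right_mono[OF ennreal_leI[OF this]] show ?thesis
      using bound[OF chi, of \<epsilon> F] \<epsilon> by (meson order_trans zero_le)
  qed
  then show ?thesis using C exp_gt_zero[of "-1"] by blast
qed

end
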